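(* Let a lattice Boltzmann scheme with $N\ge 1$ conserved moments be given, and consider the corresponding macroscopic Finite Difference (FD) schemes $(\mathrm{FD}_i)$, $i=1,\dots,N$, defined in the context. Assume that $M$ and $S$ are fixed (independent of $\Delta x$) as $\Delta x\to 0$, that the lattice velocity $\lambda=\Delta x/\Delta t>0$ is a fixed real number as $\Delta x\to0$ (acoustic scaling), and that the equilibrium functions $m^{\mathrm{eq}}$ are fixed as $\Delta x\to 0$. For $i\in\{1,\dots,N\}$ set $$\gamma_{1,i}(m_1,\dots,m_N):=\lambda\sum_{j=1}^{N}\mathcal G_{ij}m_j+\lambda\sum_{j=N+1}^{q}\mathcal G_{ij}\,m_j^{\mathrm{eq}}(m_1,\dots,m_N).$$ Then, in the limit $\Delta x\to 0$, the FD schemes are consistent with the target PDEs $$\partial_t\tilde m_i+\lambda\sum_{j=1}^{N}\mathcal G_{ij}\tilde m_j+\lambda\sum_{j=N+1}^{q}\mathcal G_{ij}\,m_j^{\mathrm{eq}}(\tilde m_1,\dots,\tilde m_N)=0,\qquad i\in\{1,\dots,N\}.$$ For smooth solutions $\tilde m_1,\dots,\tilde m_N:\mathbb R^+\times\mathbb R^d\to\mathbb R$ of these target PDEs, the truncation error is $$\tau_i=\lambda\Delta x\sum_{j=N+1}^{q}\Big(\frac1{s_j}-\frac12\Big)\mathcal G_{ij}\Big(\sum_{\ell=1}^{N}\mathcal G_{j\ell}\tilde m_\ell+\sum_{\ell=N+1}^{q}\mathcal G_{j\ell}m_\ell^{\mathrm{eq}}(\tilde m_1,\dots,\tilde m_N)-\frac1\lambda\sum_{\ell=1}^{N}\frac{\mathrm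 d m_j^{\mathrm{eq}}}{\mathrm d m_\ell}(\tilde m_1,\dots,\tilde m_N)\,\gamma_{1,\ell}(\tilde m_1,\dots,\tilde m_N)\Big)+O(\Delta x^2).$$ Therefore the modified equations up to second order read, for $i\in\{1,\dots,N\}$, $$\partial_t m_i+\gamma_{1,i}(m_1,\dots,m_N)-\lambda\Delta x\sum_{j=N+1}^{q}\Big(\frac1{s_j}-\frac12\Big)\mathcal G_{ij}\Big(\sum_{\ell=1}^{N}\mathcal G_{j\ell}m_\ell+\sum_{\ell=N+1}^{q}\mathcal G_{j\ell}m_\ell^{\mathrm{eq}}(m_1,\dots,m_N)-\frac1\lambda\sum_{\ell=1}^{N}\frac{\mathrm d m_j^{\mathrm{eq}}}{\mathrm d m_\ell}(m_1,\dots,m_N)\,\gamma_{1,\ell}(m_1,\dots,m_N)\Big)=O(\Delta x^2).$$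
   Context: **Scheme.** Let $d\in\{1,2,3\}$, $\Delta x,\Delta t>0$, $\lambda:=\Delta x/\Delta t$, $q\ge 2$, $c_1,\dots,c_q\in\mathbb Z^d$ (normalized discrete velocities), $N\in\{1,\dots,q-1\}$ (number of conserved moments), $M\in \mathrm{GL}_q(\mathbb R)$ (moment matrix), and $S=\mathrm{diag}(s_1,\dots,s_q)$ (relaxation matrix) with $s_i\in\mathbb R$ for $i\le N$ and $s_i\in(0,2]$ for $i\ge N+1$. The equilibria are a (possibly nonlinear, smooth) function $m^{\mathrm{eq}}:\mathbb R^N\to\mathbb R^q$ of the conserved moments, with $m_i^{\mathrm{eq}}(m_1,\dots,m_N)=m_i$ for $i\le N$. For $z\in\mathbb Z^d$ the space shift is $(\mathsf t_z f)(x)=f(x-z\Delta x)$. FD operators are finite real linear combinations of space shifts; with composition they form a commutative ring $\mathsf D$. The time shift is $(\mathsf z f)(t)=f(t+\Delta t)$; it commutes with $\mathsf D$, and polynomials in $\mathsf z$ with coefficients in $\mathsf D$ form a commutative ring. Put $\mathsf T:=M\,\mathrm{diag}(\mathsf t_{c_1},\dots,\mathsf t_{c_q})M^{-1}$, $\mathsf A:=\mathsf T(I-S)$, $\mathsf B:=\mathsf TS$. The lattice Boltzmann scheme is $\mathsf z\, m=\mathsf A m+\mathsf B m^{\mathrm{eq}}(m_1,\dots,m_N)$ for the vector of moments $m=(m_1,\dots,m_q)^{\intercal}$. **Corresponding FD schemes.** For $i\in\{1,\dots,N\}$ let $\mathsf A_i$ be the matrix obtained from $\mathsf A$ by keeping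 the entries whose row and column indices both lie in $\{i\}\cup\{N+1,\dots,q\}$ and setting all the others to zero, and $\mathsf A_i^\diamond:=\mathsf A-\mathsf A_i$. The $i$-th corresponding FD scheme, which involves only the conserved moments (the coefficients of the non-conserved moments in $(\mathrm{adj}(\mathsf zI-\mathsf A_i)\mathsf A_i^\diamond m)_i$ vanish), is $$(\mathrm{FD}_i)\qquad \det(\mathsf zI-\mathsf A_i)\,m_i=\big(\mathrm{adj}(\mathsf zI-\mathsf A_i)\,\mathsf A_i^\diamond\, m\big)_i+\big(\mathrm{adj}(\mathsf zI-\mathsf A_i)\,\mathsf B\, m^{\mathrm{eq}}\big)_i ,$$ where $\mathrm{adj}$ is the adjugate (transpose of the cofactor matrix). An overall time shift of the scheme (e.g. by $\mathsf z^{-(q-1)}$, so that the latest time is $t+\Delta t$) gives the same scheme. **Momentum-velocity operator matrix.** $\mathcal G:=M\Big(\sum_{|\nu|=1}\mathrm{diag}(c_1^{\nu},\dots,c_q^{\nu})\,\partial^{\nu}\Big)M^{-1}$ ($\nu\in\mathbb N^d$ multi-index, $\partial^\nu$ in the space variables), a $q\times q$ matrix of first-order differential operators in space with entries $\mathcal G_{ij}$. Operators $\mathcal G_{ij}$ act on everything to their right. $\mathrm d m_j^{\mathrm{eq}}/\mathrm d m_\ell$ denotes the partial derivative of $m_j^{\mathrm{eq}}$ with respect to its $\ell$-th argument. **Truncation error, consistency, modified equations.** Let $R_i(m_1,\dots,m_N)$ be the left-hand side minus the right-hand side of $(\mathrm{FD}_i)$, applied to smooth functions of $(t,x)\in\mathbb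 R^+\times\mathbb R^d$. With $\Pi:=\prod_{j=N+1}^q s_j\ne0$, the truncation error on a smooth solution of the target PDEs (not depending on $\Delta x$) is $\tau_i:=-R_i(\tilde m_1,\dots,\tilde m_N)/(\Pi\Delta t)$; the scheme is consistent with the target PDEs if $\tau_i\to0$ as $\Delta x\to0$ for smooth solutions $\tilde m_1,\dots,\tilde m_N$. The modified equations are (formal) relations satisfied, as $\Delta x\to 0$, by smooth functions $m_1,\dots,m_N$ (possibly depending on $\Delta x$, with every derivative bounded, locally uniformly in $(t,x)$, as $\Delta x\to0$) which satisfy $R_i(m_1,\dots,m_N)=0$ identically for all $i\in\{1,\dots,N\}$. $O(\cdot)$ is understood as $\Delta x\to0$. *)

theory Defs
  imports
    "HOL-Analysis.Analysis"
    "HOL-Library.Poly_Mapping"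
    "HOL-Computational_Algebra.Polynomial"
begin

text \<open>
  Conserved moments are indexed by the finite type \<open>'n\<close>, non-conserved ones by the finite type
  \<open>'k\<close>, and all moments by the sum type \<open>'n + 'k\<close>.  Thus \<open>N = CARD('n)\<close> and
  \<open>q = CARD('n) + CARD('k)\<close>, where \<open>1 \<le> N \<le> q - 1\<close> and \<open>q \<ge> 2\<close> hold because
  types are nonempty.
\<close>

subsection \<open>Smooth functions\<close>

text \<open>
  Derivatives are taken within the domain \<open>X\<close>.  For open \<open>X\<close> these are the usual ones; for a closed
  half-space they are one-sided at the boundary.
\<close>

definition dirderiv ::
  "'a::real_normed_vector set \<Rightarrow> 'a \<Rightarrow> ('a \<Rightarrow> 'b::real_normed_vector) \<Rightarrow> 'a \<Rightarrow> 'b" where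
  "dirderiv X v f p = frechet_derivative f (at p within X) v"

definition iter_deriv ::
  "'a::real_normed_vector set \<Rightarrow> 'a list \<Rightarrow> ('a \<Rightarrow> 'b::real_normed_vector) \<Rightarrow> 'a \<Rightarrow> 'b" where
  "iter_deriv X vs f = foldr (dirderiv X) vs f"

definition smooth_fun_on ::
  "'a::real_normed_vector set \<Rightarrow> ('a \<Rightarrow> 'b::real_normed_vector) \<Rightarrow> bool" where
  "smooth_fun_on X f \<longleftrightarrow> (\<forall>vs. iter_deriv X vs f differentiable_on X)"

text \<open>The first component of a point of \<open>real \<times> (real ^ 'd)\<close> is time, the second one is space.\<close>

definition dt_op ::
  "(real \<times> (real ^ 'd::finite)) set \<Rightarrow> (real \<times> (real ^ 'd) \<Rightarrow> real) \<Rightarrow> real \<times> (real ^ 'd) \<Rightarrow> real" where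
  "dt_op X = dirderiv X (1, 0)"

definition dx_op ::
  "(real \<times> (real ^ 'd::finite)) set \<Rightarrow> 'd \<Rightarrow> (real \<times> (real ^ 'd) \<Rightarrow> real) \<Rightarrow> real \<times> (real ^ 'd) \<Rightarrow> real" where
  "dx_op X k = dirderiv X (0, axis k 1)"

subsection \<open>Matrices\<close>

definition diag_matrix :: "'a::zero ^ 'm::finite \<Rightarrow> 'a ^ 'm ^ 'm" where
  "diag_matrix v = (\<chi> r c. if r = c then v $ r else 0)"

definition map_entries :: "('a \<Rightarrow> 'b) \<Rightarrow> 'a ^ 'm::finite ^ 'm \<Rightarrow> 'b ^ 'm ^ 'm" where
  "map_entries f A = (\<chi> r c. f (A $ r $ c))"

text \<open>
  The index type carries no order, so the signed minor obtained by deleting row \<open>r\<close> and column \<open>c\<close>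
  is written as the determinant in which that row and that column are replaced by unit vectors.
\<close>

definition matrix_cofactor :: "'a::comm_ring_1 ^ 'm::finite ^ 'm \<Rightarrow> 'm \<Rightarrow> 'm \<Rightarrow> 'a" where
  "matrix_cofactor A r c =
     det (\<chi> a b. if a = r \<and> b = c then 1 else if a = r \<or> b = c then 0 else A $ a $ b)"

definition adjugate :: "'a::comm_ring_1 ^ 'm::finite ^ 'm \<Rightarrow> 'a ^ 'm ^ 'm" where
  "adjugate A = transpose (\<chi> r c. matrix_cofactor A r c)"

subsection \<open>Finite difference operators\<close>

text \<open>
  The ring of FD operators is represented by the group algebra of \<open>\<int>\<^sup>d\<close>: the operator
  \<open>Poly_Mapping.single z 1\<close> is the shift by \<open>z\<close>, and multiplication is composition since
  shifts by \<open>z\<close> and \<open>z'\<close> compose to the shift by \<open>z + z'\<close>.  Space-time operators are polynomials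
  over this ring, the indeterminate being the time shift.
\<close>

type_synonym 'd fd_op = "int ^ 'd \<Rightarrow>\<^sub>0 real"

definition shift :: "int ^ 'd::finite \<Rightarrow> 'd fd_op" where
  "shift z = Poly_Mapping.single z 1"

definition const_op :: "real \<Rightarrow> ('d::finite) fd_op" where
  "const_op a = Poly_Mapping.single 0 a"

definition fd_apply ::
  "real \<Rightarrow> ('d::finite) fd_op \<Rightarrow> (real ^ 'd \<Rightarrow> real) \<Rightarrow> real ^ 'd \<Rightarrow> real" where
  "fd_apply \<Delta>x D f x =
     (\<Sum>z\<in>Poly_Mapping.keys D. Poly_Mapping.lookup D z * f (x - \<Delta>x *\<^sub>R (\<chi> k. real_of_int (z $ k))))"

definition st_apply ::
  "real \<Rightarrow> real \<Rightarrow> ('d::finite) fd_op poly \<Rightarrow> (real \<times> (real ^ 'd) \<Rightarrow> real) \<Rightarrow> real \<times> (real ^ 'd) \<Rightarrow> real" where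
  "st_apply \<Delta>x \<Delta>t P f = (\<lambda>(t, x).
     \<Sum>r\<le>degree P. fd_apply \<Delta>x (coeff P r) (\<lambda>y. f (t + real r * \<Delta>t, y)) x)"

definition row_apply ::
  "real \<Rightarrow> real \<Rightarrow> ('d::finite) fd_op poly ^ 'm::finite \<Rightarrow> (real \<times> (real ^ 'd) \<Rightarrow> real ^ 'm)
     \<Rightarrow> real \<times> (real ^ 'd) \<Rightarrow> real" where
  "row_apply \<Delta>x \<Delta>t w f p = (\<Sum>r\<in>UNIV. st_apply \<Delta>x \<Delta>t (w $ r) (\<lambda>p. f p $ r) p)"

subsection \<open>The scheme and its corresponding FD schemes\<close>

definition opT :: "int ^ 'd::finite ^ 'm::finite \<Rightarrow> real ^ 'm ^ 'm \<Rightarrow> 'd fd_op ^ 'm ^ 'm" where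
  "opT c M = map_entries const_op M ** diag_matrix (\<chi> j. shift (c $ j))
               ** map_entries const_op (matrix_inv M)"

definition opA ::
  "int ^ 'd::finite ^ 'm::finite \<Rightarrow> real ^ 'm ^ 'm \<Rightarrow> real ^ 'm \<Rightarrow> 'd fd_op ^ 'm ^ 'm" where
  "opA c M s = opT c M ** map_entries const_op (mat 1 - diag_matrix s)"

definition opB ::
  "int ^ 'd::finite ^ 'm::finite \<Rightarrow> real ^ 'm ^ 'm \<Rightarrow> real ^ 'm \<Rightarrow> 'd fd_op ^ 'm ^ 'm" where
  "opB c M s = opT c M ** map_entries const_op (diag_matrix s)"

definition kept_indices :: "'n \<Rightarrow> ('n + 'k) set" where
  "kept_indices i = insert (Inl i) (range Inr)"

definition restrict_op ::
  "'n::finite \<Rightarrow> 'a::zero ^ ('n + 'k::finite) ^ ('n + 'k) \<Rightarrow> 'a ^ ('n + 'k) ^ ('n + 'k)" where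
  "restrict_op i A =
     (\<chi> r c. if r \<in> kept_indices i \<and> c \<in> kept_indices i then A $ r $ c else 0)"

definition zI_minus :: "'a::comm_ring_1 ^ 'm::finite ^ 'm \<Rightarrow> 'a poly ^ 'm ^ 'm" where
  "zI_minus A = mat [:0, 1:] - map_entries (\<lambda>a. [:a:]) A"

definition coeff_diamond ::
  "int ^ 'd::finite ^ ('n::finite + 'k::finite) \<Rightarrow> real ^ ('n + 'k) ^ ('n + 'k) \<Rightarrow> real ^ ('n + 'k)
     \<Rightarrow> 'n \<Rightarrow> 'd fd_op poly ^ ('n + 'k) ^ ('n + 'k)" where
  "coeff_diamond c M s i =
     adjugate (zI_minus (restrict_op i (opA c M s)))
       ** map_entries (\<lambda>a. [:a:]) (opA c M s - restrict_op i (opA c M s))"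

definition coeff_eq ::
  "int ^ 'd::finite ^ ('n::finite + 'k::finite) \<Rightarrow> real ^ ('n + 'k) ^ ('n + 'k) \<Rightarrow> real ^ ('n + 'k)
     \<Rightarrow> 'n \<Rightarrow> 'd fd_op poly ^ ('n + 'k) ^ ('n + 'k)" where
  "coeff_eq c M s i =
     adjugate (zI_minus (restrict_op i (opA c M s))) ** map_entries (\<lambda>a. [:a:]) (opB c M s)"

text \<open>
  The \<open>i\<close>-th corresponding FD scheme involves the conserved moments only, so it does not matter how
  they are completed to a vector of all the moments.
\<close>

lemma det_eq_0_if_column_eq_0:
  fixes A :: "'a::comm_ring_1 ^ 'm::finite ^ 'm"
  assumes "\<And>a. A $ a $ c = 0"
  shows "det A = 0"
proof -
  have "(\<Prod>a\<in>UNIV. transpose A $ a $ p a) = 0" for p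
    by (rule prod_zero) (auto simp: transpose_def assms intro!: exI[of _ c])
  then have "det (transpose A) = 0"
    unfolding det_def by simp
  then show ?thesis
    by simp
qed

lemma coeff_diamond_nonconserved: "coeff_diamond c M s i $ Inl i $ Inr j = 0"
proof -
  let ?A = "opA c M s"
  let ?Z = "zI_minus (restrict_op i ?A)"
  have "adjugate ?Z $ Inl i $ r *
          map_entries (\<lambda>a. [:a:]) (?A - restrict_op i ?A) $ r $ Inr j = 0" for r
  proof (cases "r \<in> kept_indices i")
    case True
    then show ?thesis
      by (simp add: map_entries_def restrict_op_def kept_indices_def)
  next
    case False
    then have "matrix_cofactor ?Z r (Inl i) = 0"
      unfolding matrix_cofactor_def
      by (intro det_eq_0_if_column_eq_0[where c = r])
        (auto simp: zI_minus_def mat_def map_entries_def restrict_op_def kept_indices_def)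
    then show ?thesis
      by (simp add: adjugate_def transpose_def)
  qed
  then show ?thesis
    unfolding coeff_diamond_def matrix_matrix_mult_def by simp
qed

definition complete_moments :: "real ^ 'n::finite \<Rightarrow> real ^ ('n + 'k::finite)" where
  "complete_moments w = (\<chi> r. case r of Inl l \<Rightarrow> w $ l | Inr _ \<Rightarrow> 0)"

definition fd_residual ::
  "int ^ 'd::finite ^ ('n::finite + 'k::finite) \<Rightarrow> real ^ ('n + 'k) ^ ('n + 'k) \<Rightarrow> real ^ ('n + 'k)
     \<Rightarrow> (real ^ 'n \<Rightarrow> real ^ ('n + 'k)) \<Rightarrow> real \<Rightarrow> real \<Rightarrow> 'n
     \<Rightarrow> (real \<times> (real ^ 'd) \<Rightarrow> real ^ 'n) \<Rightarrow> real \<times> (real ^ 'd) \<Rightarrow> real" where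
  "fd_residual c M s meq \<Delta>x \<Delta>t i u p =
     st_apply \<Delta>x \<Delta>t (det (zI_minus (restrict_op i (opA c M s)))) (\<lambda>p. u p $ i) p
     - (row_apply \<Delta>x \<Delta>t (coeff_diamond c M s i $ Inl i) (\<lambda>p. complete_moments (u p)) p
        + row_apply \<Delta>x \<Delta>t (coeff_eq c M s i $ Inl i) (\<lambda>p. meq (u p)) p)"

definition truncation_error ::
  "int ^ 'd::finite ^ ('n::finite + 'k::finite) \<Rightarrow> real ^ ('n + 'k) ^ ('n + 'k) \<Rightarrow> real ^ ('n + 'k)
     \<Rightarrow> (real ^ 'n \<Rightarrow> real ^ ('n + 'k)) \<Rightarrow> real \<Rightarrow> real \<Rightarrow> 'n
     \<Rightarrow> (real \<times> (real ^ 'd) \<Rightarrow> real ^ 'n) \<Rightarrow> real \<times> (real ^ 'd) \<Rightarrow> real" where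
  "truncation_error c M s meq \<Delta>x \<Delta>t i u p =
     - fd_residual c M s meq \<Delta>x \<Delta>t i u p / ((\<Prod>j\<in>UNIV. s $ Inr j) * \<Delta>t)"

subsection \<open>Differential operators\<close>

text \<open>The multi-indices of length one correspond to the space directions \<open>k\<close>.\<close>

definition G_op ::
  "(real \<times> (real ^ 'd::finite)) set \<Rightarrow> int ^ 'd ^ 'm::finite \<Rightarrow> real ^ 'm ^ 'm \<Rightarrow> 'm \<Rightarrow> 'm
     \<Rightarrow> (real \<times> (real ^ 'd) \<Rightarrow> real) \<Rightarrow> real \<times> (real ^ 'd) \<Rightarrow> real" where
  "G_op X c M i j f p =
     (\<Sum>k\<in>UNIV. (M ** diag_matrix (\<chi> r. real_of_int (c $ r $ k)) ** matrix_inv M) $ i $ j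
                 * dx_op X k f p)"

definition gamma1 ::
  "(real \<times> (real ^ 'd::finite)) set \<Rightarrow> int ^ 'd ^ ('n::finite + 'k::finite)
     \<Rightarrow> real ^ ('n + 'k) ^ ('n + 'k) \<Rightarrow> (real ^ 'n \<Rightarrow> real ^ ('n + 'k)) \<Rightarrow> real \<Rightarrow> 'n
     \<Rightarrow> (real \<times> (real ^ 'd) \<Rightarrow> real ^ 'n) \<Rightarrow> real \<times> (real ^ 'd) \<Rightarrow> real" where
  "gamma1 X c M meq lam i u p =
     lam * (\<Sum>j\<in>UNIV. G_op X c M (Inl i) (Inl j) (\<lambda>p. u p $ j) p)
     + lam * (\<Sum>j\<in>UNIV. G_op X c M (Inl i) (Inr j) (\<lambda>p. meq (u p) $ Inr j) p)"

definition target_pde_solution ::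
  "(real \<times> (real ^ 'd::finite)) set \<Rightarrow> int ^ 'd ^ ('n::finite + 'k::finite)
     \<Rightarrow> real ^ ('n + 'k) ^ ('n + 'k) \<Rightarrow> (real ^ 'n \<Rightarrow> real ^ ('n + 'k)) \<Rightarrow> real
     \<Rightarrow> (real \<times> (real ^ 'd) \<Rightarrow> real ^ 'n) \<Rightarrow> bool" where
  "target_pde_solution X c M meq lam u \<longleftrightarrow>
     (\<forall>i. \<forall>p\<in>X. dt_op X (\<lambda>p. u p $ i) p + gamma1 X c M meq lam i u p = 0)"

definition second_order_term ::
  "(real \<times> (real ^ 'd::finite)) set \<Rightarrow> int ^ 'd ^ ('n::finite + 'k::finite)
     \<Rightarrow> real ^ ('n + 'k) ^ ('n + 'k) \<Rightarrow> real ^ ('n + 'k) \<Rightarrow> (real ^ 'n \<Rightarrow> real ^ ('n + 'k))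
     \<Rightarrow> real \<Rightarrow> 'n \<Rightarrow> (real \<times> (real ^ 'd) \<Rightarrow> real ^ 'n) \<Rightarrow> real \<times> (real ^ 'd) \<Rightarrow> real" where
  "second_order_term X c M s meq lam i u p =
     (\<Sum>j\<in>UNIV. (1 / s $ Inr j - 1 / 2) *
        G_op X c M (Inl i) (Inr j)
          (\<lambda>p. (\<Sum>l\<in>UNIV. G_op X c M (Inr j) (Inl l) (\<lambda>p. u p $ l) p)
             + (\<Sum>l\<in>UNIV. G_op X c M (Inr j) (Inr l) (\<lambda>p. meq (u p) $ Inr l) p)
             - 1 / lam * (\<Sum>l\<in>UNIV. dirderiv UNIV (axis l 1) (\<lambda>w. meq w $ Inr j) (u p)
                                     * gamma1 X c M meq lam l u p)) p)"

subsection \<open>The limit of vanishing space step\<close>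

definition locally_uniform_bigo ::
  "'a::topological_space set \<Rightarrow> (real \<Rightarrow> 'a \<Rightarrow> real) \<Rightarrow> (real \<Rightarrow> real) \<Rightarrow> bool" where
  "locally_uniform_bigo X E g \<longleftrightarrow>
     (\<forall>K. compact K \<and> K \<subseteq> X \<longrightarrow>
        (\<exists>C. \<forall>\<^sub>F \<Delta>x in at_right 0. \<forall>p\<in>K. \<bar>E \<Delta>x p\<bar> \<le> C * \<bar>g \<Delta>x\<bar>))"

text \<open>The empty list of directions gives a bound on the functions themselves.\<close>

definition derivatives_locally_bounded ::
  "'a::real_normed_vector set \<Rightarrow> (real \<Rightarrow> 'a \<Rightarrow> 'b::real_normed_vector) \<Rightarrow> bool" where
  "derivatives_locally_bounded X u \<longleftrightarrow>
     (\<forall>vs K. compact K \<and> K \<subseteq> X \<longrightarrow>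
        (\<exists>C. \<forall>\<^sub>F \<Delta>x in at_right 0. \<forall>p\<in>K. norm (iter_deriv X vs (u \<Delta>x) p) \<le> C))"

text \<open>Acoustic scaling: the time step is \<open>\<Delta>x / lam\<close> with \<open>lam\<close> fixed.\<close>

definition consistent_with_target ::
  "(real \<times> (real ^ 'd::finite)) set \<Rightarrow> int ^ 'd ^ ('n::finite + 'k::finite)
     \<Rightarrow> real ^ ('n + 'k) ^ ('n + 'k) \<Rightarrow> real ^ ('n + 'k) \<Rightarrow> (real ^ 'n \<Rightarrow> real ^ ('n + 'k))
     \<Rightarrow> real \<Rightarrow> bool" where
  "consistent_with_target X c M s meq lam \<longleftrightarrow>
     (\<forall>u i K. smooth_fun_on X u \<and> target_pde_solution X c M meq lam u \<and> compact K \<and> K \<subseteq> X \<longrightarrow>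
        uniform_limit K (\<lambda>\<Delta>x. truncation_error c M s meq \<Delta>x (\<Delta>x / lam) i u) (\<lambda>_. 0) (at_right 0))"

end

theory Submission
  imports Defs
begin

text \<open>
  Write \<open>h\<close> for the space step and \<open>E\<^sub>r\<close> for the residual of row \<open>r\<close> of the lattice Boltzmann scheme.
  Multiplication by the adjugate shows that the residual of the \<open>i\<close>-th FD scheme equals
  \<open>\<Sum>\<^sub>r adj\<^sub>i\<^sub>r E\<^sub>r\<close> for every choice of the non-conserved moments.  Take the equilibria
  corrected at first order, \<open>m\<^sub>j = m\<^sub>j\<^sup>e\<^sup>q - h D\<^sub>j / s\<^sub>j\<close>, where \<open>D\<^sub>r\<close> is the defect of
  the equilibria in the advection equation \<open>\<partial>\<^sub>t / lam + \<G>\<close>.  Then \<open>E\<^sub>j = O(h\<^sup>2)\<close> for non-conserved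
  \<open>j\<close>, and \<open>E\<^sub>i = h D\<^sub>i + O(h\<^sup>2)\<close>, where the term of second order follows from applying
  \<open>\<partial>\<^sub>t / lam - \<G>\<close> to the defects.  Since the shifts tend to the identity, \<open>adj\<^sub>i\<^sub>i\<close> tends to
  \<open>\<Prod>\<^sub>j s\<^sub>j\<close> and the other \<open>adj\<^sub>i\<^sub>j\<close> to \<open>0\<close>.  Differentiating the expansions costs nothing as all
  the estimates are for families of functions whose derivatives of every order are of the same order
  in \<open>h\<close>; this is needed for the modified equations, where \<open>D\<^sub>i = O(h)\<close> is only known a posteriori.
\<close>

subsection \<open>Derivatives along forward directions\<close>

text \<open>Accuracy is counted backwards. The truncation error divides the residual by a multiple
  of \<open>h\<close>, so an error \<open>O(h^2)\<close> there asks for the FD residual modulo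
  \<open>h^3\<close>. Row \<open>j\<close> has order 2 and its entry tends to 0, which gains one
  more \<open>h\<close>. Row \<open>i\<close> keeps the factor
  \<open>\<Prod>\<^sub>j s\<^sub>j\<close> up to a relative error \<open>O(h)\<close>, which is
  harmless as soon as the row itself has order 2, that is, as soon as
  \<open>D\<^sub>i = O(h)\<close>. On target solutions \<open>D\<^sub>i = 0\<close>. For the
  modified equations a first pass modulo \<open>h^2\<close>, which assumes nothing on
  \<open>D\<^sub>i\<close>, yields \<open>D\<^sub>i = O(h)\<close>, and a second pass uses this.
  Another obstacle is the boundary \<open>t = 0\<close>. Backward steps in time may leave the
  domain, so uniqueness of derivatives, symmetry of mixed derivatives and Taylor's formula are
  obtained from forward steps only.\<close>

lemma eventually_small_right: "\<forall>\<^sub>F h in at_right (0::real). 0 < h \<and> h \<le> 1"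
  by (rule eventually_at_rightI[of 0 1]) auto

section \<open>Calculus of locally uniform bounds\<close>

lemma locally_uniform_bigo_cong:
  assumes "locally_uniform_bigo X f g"
    and "\<forall>\<^sub>F h in at_right 0. \<forall>p\<in>X. f h p = f' h p"
  shows "locally_uniform_bigo X f' g"
  unfolding locally_uniform_bigo_def
proof (intro allI impI)
  fix K assume K: "compact K \<and> K \<subseteq> X"
  with assms(1) obtain C where "\<forall>\<^sub>F h in at_right 0. \<forall>p\<in>K. \<bar>f h p\<bar> \<le> C * \<bar>g h\<bar>"
    unfolding locally_uniform_bigo_def by blast
  with assms(2) have "\<forall>\<^sub>F h in at_right 0. \<forall>p\<in>K. \<bar>f' h p\<bar> \<le> C * \<bar>g h\<bar>"
    by eventually_elim (use K in \<open>metis subsetD\<close>)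
  then show "\<exists>C. \<forall>\<^sub>F h in at_right 0. \<forall>p\<in>K. \<bar>f' h p\<bar> \<le> C * \<bar>g h\<bar>" ..
qed

lemma locally_uniform_bigo_add:
  assumes "locally_uniform_bigo X f g" "locally_uniform_bigo X f' g"
  shows "locally_uniform_bigo X (\<lambda>h p. f h p + f' h p) g"
  unfolding locally_uniform_bigo_def
proof (intro allI impI)
  fix K assume K: "compact K \<and> K \<subseteq> X"
  with assms obtain C C' where
    "\<forall>\<^sub>F h in at_right 0. \<forall>p\<in>K. \<bar>f h p\<bar> \<le> C * \<bar>g h\<bar>"
    "\<forall>\<^sub>F h in at_right 0. \<forall>p\<in>K. \<bar>f' h p\<bar> \<le> C' * \<bar>g h\<bar>"
    unfolding locally_uniform_bigo_def by meson
  then have "\<forall>\<^sub>F h in at_right 0. \<forall>p\<in>K. \<bar>f h p + f' h p\<bar> \<le> (C + C') * \<bar>g h\<bar>"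
    by eventually_elim (simp add: distrib_right, meson order_trans[OF abs_triangle_ineq] add_mono)
  then show "\<exists>C. \<forall>\<^sub>F h in at_right 0. \<forall>p\<in>K. \<bar>f h p + f' h p\<bar> \<le> C * \<bar>g h\<bar>" ..
qed

lemma locally_uniform_bigo_mult:
  assumes "locally_uniform_bigo X f g" "locally_uniform_bigo X f' g'"
  shows "locally_uniform_bigo X (\<lambda>h p. f h p * f' h p) (\<lambda>h. g h * g' h)"
  unfolding locally_uniform_bigo_def
proof (intro allI impI)
  fix K assume K: "compact K \<and> K \<subseteq> X"
  with assms obtain C C' where
    "\<forall>\<^sub>F h in at_right 0. \<forall>p\<in>K. \<bar>f h p\<bar> \<le> C * \<bar>g h\<bar>"
    "\<forall>\<^sub>F h in at_right 0. \<forall>p\<in>K. \<bar>f' h p\<bar> \<le> C' * \<bar>g' h\<bar>"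
    unfolding locally_uniform_bigo_def by meson
  then have "\<forall>\<^sub>F h in at_right 0. \<forall>p\<in>K. \<bar>f h p * f' h p\<bar> \<le> (C * C') * \<bar>g h * g' h\<bar>"
  proof eventually_elim
    case (elim h)
    show ?case
    proof
      fix p assume "p \<in> K"
      with elim have "\<bar>f h p\<bar> * \<bar>f' h p\<bar> \<le> (C * \<bar>g h\<bar>) * (C' * \<bar>g' h\<bar>)"
        by (intro mult_mono) (auto intro: order_trans[OF abs_ge_zero])
      then show "\<bar>f h p * f' h p\<bar> \<le> (C * C') * \<bar>g h * g' h\<bar>"
        by (simp add: abs_mult mult_ac)
    qed
  qed
  then show "\<exists>C. \<forall>\<^sub>F h in at_right 0. \<forall>p\<in>K. \<bar>f h p * f' h p\<bar> \<le> C * \<bar>g h * g' h\<bar>" ..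
qed

lemma locally_uniform_bigo_trans:
  assumes "locally_uniform_bigo X f g" "\<forall>\<^sub>F h in at_right 0. \<bar>g h\<bar> \<le> \<bar>g' h\<bar>"
  shows "locally_uniform_bigo X f g'"
  unfolding locally_uniform_bigo_def
proof (intro allI impI)
  fix K assume K: "compact K \<and> K \<subseteq> X"
  with assms obtain C where
    "\<forall>\<^sub>F h in at_right 0. \<forall>p\<in>K. \<bar>f h p\<bar> \<le> C * \<bar>g h\<bar>"
    unfolding locally_uniform_bigo_def by meson
  \<comment> \<open>\<open>C\<close> may be negative, in which case enlarging \<open>g\<close> would
    spoil the bound.\<close>
  with assms(2) have "\<forall>\<^sub>F h in at_right 0. \<forall>p\<in>K. \<bar>f h p\<bar> \<le> \<bar>C\<bar> * \<bar>g' h\<bar>"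
  proof eventually_elim
    case (elim h)
    have "C * \<bar>g h\<bar> \<le> \<bar>C\<bar> * \<bar>g' h\<bar>"
      using elim(1) by (intro mult_mono) auto
    with elim(2) show ?case by force
  qed
  then show "\<exists>C. \<forall>\<^sub>F h in at_right 0. \<forall>p\<in>K. \<bar>f h p\<bar> \<le> C * \<bar>g' h\<bar>" ..
qed

lemma locally_uniform_bigo_const: "locally_uniform_bigo X (\<lambda>h p. a) (\<lambda>h. 1)"
  unfolding locally_uniform_bigo_def by (intro allI impI exI[of _ "\<bar>a\<bar>"]) auto

lemma locally_uniform_bigo_self: "locally_uniform_bigo X (\<lambda>h p. g h) g"
  unfolding locally_uniform_bigo_def by (intro allI impI exI[of _ 1]) auto

lemma uniform_limit_if_locally_uniform_bigo:
  assumes "locally_uniform_bigo X E (\<lambda>h. h)" "compact K" "K \<subseteq> X"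
  shows "uniform_limit K E (\<lambda>_. 0) (at_right 0)"
proof -
  obtain C where C: "\<forall>\<^sub>F h in at_right 0. \<forall>p\<in>K. \<bar>E h p\<bar> \<le> C * \<bar>h\<bar>"
    using assms unfolding locally_uniform_bigo_def by blast
  have lim: "((\<lambda>h. C * \<bar>h\<bar>) \<longlongrightarrow> 0) (at_right 0)"
    by (auto intro!: tendsto_eq_intros)
  show ?thesis
    unfolding uniform_limit_iff
  proof (intro allI impI)
    fix e :: real assume "0 < e"
    with lim have "\<forall>\<^sub>F h in at_right 0. C * \<bar>h\<bar> < e"
      by (rule order_tendstoD)
    with C show "\<forall>\<^sub>F h in at_right 0. \<forall>p\<in>K. dist (E h p) 0 < e"
      by eventually_elim auto
  qed
qed

section \<open>Directional derivatives within the domain\<close>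

lemma smooth_fun_on_differentiable: "smooth_fun_on X f \<Longrightarrow> f differentiable_on X"
  unfolding smooth_fun_on_def iter_deriv_def by (metis foldr.simps(1) id_apply)

text \<open>\<open>iter_deriv\<close> on \<open>vs @ [v]\<close> differentiates along
  \<open>v\<close> first, so lists of directions absorb the extra derivative.\<close>

lemma smooth_fun_on_dirderiv: "smooth_fun_on X f \<Longrightarrow> smooth_fun_on X (dirderiv X v f)"
  unfolding smooth_fun_on_def iter_deriv_def
  by (metis (no_types) foldr_append foldr.simps comp_apply id_apply)

text \<open>
  As \<open>V\<close> contains a basis, derivatives within \<open>X\<close> are unique, at boundary points too.
\<close>

locale forward_domain =
  fixes X V :: "'a::euclidean_space set"
  assumes Basis_subset: "Basis \<subseteq> V"
    and scale_mem: "v \<in> V \<Longrightarrow> 0 \<le> a \<Longrightarrow> a *\<^sub>R v \<in> V"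
    and add_mem: "x \<in> X \<Longrightarrow> v \<in> V \<Longrightarrow> x + v \<in> X"
begin

lemma ray_mem: "x \<in> X \<Longrightarrow> v \<in> V \<Longrightarrow> 0 \<le> a \<Longrightarrow> x + a *\<^sub>R v \<in> X"
  by (simp add: add_mem scale_mem)

text \<open>\<open>frechet_derivative\<close> is a choice among the derivatives within
  \<open>X\<close>, so it can be computed only where these are unique. Uniqueness needs points of
  \<open>X\<close> arbitrarily near \<open>x\<close> on each axis; one side suffices, and small
  positive steps along \<open>Basis\<close> stay in \<open>X\<close>.\<close>

lemma dirderiv_eq:
  fixes f :: "'a \<Rightarrow> 'b::real_normed_vector"
  assumes "(f has_derivative f') (at x within X)" "x \<in> X"
  shows "dirderiv X v f x = f' v"
proof -
  have "(f has_derivative frechet_derivative f (at x within X)) (at x within X)"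
    using assms(1) frechet_derivative_works differentiable_def by blast
  then have "frechet_derivative f (at x within X) = f'"
  proof (rule frechet_derivative_unique_within[OF _ assms(1)])
    fix i :: 'a and e :: real assume "i \<in> Basis" "0 < e"
    then show "\<exists>d. 0 < \<bar>d\<bar> \<and> \<bar>d\<bar> < e \<and> x + d *\<^sub>R i \<in> X"
      using ray_mem[OF assms(2), of i "e/2"] Basis_subset by (intro exI[of _ "e/2"]) auto
  qed
  then show ?thesis by (simp add: dirderiv_def)
qed

lemma has_derivative_dirderiv:
  fixes f :: "'a \<Rightarrow> 'b::real_normed_vector"
  assumes "f differentiable_on X" "x \<in> X"
  shows "(f has_derivative (\<lambda>v. dirderiv X v f x)) (at x within X)"
  using assms unfolding differentiable_on_def dirderiv_def
  by (metis frechet_derivative_works)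

text \<open>Holds without differentiability: both functions have the same derivatives within
  \<open>X\<close>, hence the same choice among them.\<close>

lemma dirderiv_cong:
  fixes f :: "'a \<Rightarrow> 'b::real_normed_vector"
  assumes "\<And>y. y \<in> X \<Longrightarrow> f y = g y" "x \<in> X"
  shows "dirderiv X v f x = dirderiv X v g x"
proof -
  have "(f has_derivative f') (at x within X) \<longleftrightarrow> (g has_derivative f') (at x within X)" for f'
    using assms by (metis has_derivative_transform)
  then show ?thesis
    by (simp add: dirderiv_def frechet_derivative_def)
qed

lemma dirderiv_const: "x \<in> X \<Longrightarrow> dirderiv X v (\<lambda>_. a) x = 0"
  by (rule dirderiv_eq[where f' = "\<lambda>_. 0"]) auto

lemma dirderiv_add:
  fixes f g :: "'a \<Rightarrow> 'b::real_normed_vector"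
  assumes "f differentiable_on X" "g differentiable_on X" "x \<in> X"
  shows "dirderiv X v (\<lambda>x. f x + g x) x = dirderiv X v f x + dirderiv X v g x"
  by (rule dirderiv_eq[OF has_derivative_add])
    (use assms in \<open>auto intro!: has_derivative_dirderiv\<close>)

lemma dirderiv_mult:
  fixes f g :: "'a \<Rightarrow> real"
  assumes "f differentiable_on X" "g differentiable_on X" "x \<in> X"
  shows "dirderiv X v (\<lambda>x. f x * g x) x = f x * dirderiv X v g x + dirderiv X v f x * g x"
  by (rule dirderiv_eq[OF has_derivative_mult])
    (use assms in \<open>auto intro!: has_derivative_dirderiv\<close>)

lemma dirderiv_scale_direction:
  fixes f :: "'a \<Rightarrow> 'b::real_normed_vector"
  assumes "f differentiable_on X" "x \<in> X"
  shows "dirderiv X (a *\<^sub>R v) f x = a *\<^sub>R dirderiv X v f x"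
  by (rule linear_cmul[OF has_derivative_linear[OF has_derivative_dirderiv[OF assms]]])

lemma dirderiv_sum_direction:
  fixes f :: "'a \<Rightarrow> 'b::real_normed_vector"
  assumes "f differentiable_on X" "x \<in> X"
  shows "dirderiv X (\<Sum>i\<in>I. v i) f x = (\<Sum>i\<in>I. dirderiv X (v i) f x)"
  by (rule linear_sum[OF has_derivative_linear[OF has_derivative_dirderiv[OF assms]]])

lemma has_derivative_shift:
  fixes f :: "'a \<Rightarrow> 'b::real_normed_vector"
  assumes "f differentiable_on X" "x \<in> X" "w \<in> V"
  shows "((\<lambda>x. f (x + w)) has_derivative (\<lambda>v. dirderiv X v f (x + w))) (at x within X)"
  by (rule has_derivative_in_compose2[where g = f and t = X, OF has_derivative_dirderiv[OF assms(1)],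
        where f = "\<lambda>x. x + w" and f' = "\<lambda>v. v", simplified])
    (use assms add_mem in \<open>auto intro!: derivative_eq_intros\<close>)

lemma dirderiv_shift:
  fixes f :: "'a \<Rightarrow> 'b::real_normed_vector"
  assumes "f differentiable_on X" "x \<in> X" "w \<in> V"
  shows "dirderiv X v (\<lambda>x. f (x + w)) x = dirderiv X v f (x + w)"
  by (rule dirderiv_eq[OF has_derivative_shift[OF assms] assms(2)])

text \<open>The derivative in the ray parameter is one-sided at \<open>t = 0\<close>, since the ray
  need not stay in \<open>X\<close> for negative parameters.\<close>

lemma has_derivative_ray:
  fixes f :: "'a \<Rightarrow> 'b::real_normed_vector"
  assumes "f differentiable_on X" "x \<in> X" "v \<in> V" "0 \<le> t"
  shows "((\<lambda>t. f (x + t *\<^sub>R v)) has_derivative (\<lambda>r. r *\<^sub>R dirderiv X v f (x + t *\<^sub>R v)))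
    (at t within {0..T})"
proof -
  have "((\<lambda>t. f (x + t *\<^sub>R v)) has_derivative (\<lambda>r. dirderiv X (r *\<^sub>R v) f (x + t *\<^sub>R v)))
    (at t within {0..T})"
    by (rule has_derivative_in_compose[where g = f, where f = "\<lambda>t. x + t *\<^sub>R v" and f' = "\<lambda>r. r *\<^sub>R v"])
      (use assms ray_mem in \<open>auto intro!: derivative_eq_intros
         intro: has_derivative_subset[OF has_derivative_dirderiv]\<close>)
  then show ?thesis
    using assms ray_mem by (simp add: dirderiv_scale_direction)
qed

text \<open>Difference quotients of second order, formed in either order, have mean values of both
  mixed derivatives nearby; it suffices to stay on the forward side of the base point.\<close>

lemma second_difference:
  fixes f :: "'a \<Rightarrow> real"
  assumes f: "f differentiable_on X" and fv: "dirderiv X v f differentiable_on X"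
    and x: "x \<in> X" and v: "v \<in> V" and w: "w \<in> V" and h: "0 < h"
  shows "\<exists>a\<in>{0..h}. \<exists>b\<in>{0..h}. f (x + h *\<^sub>R v + h *\<^sub>R w) - f (x + h *\<^sub>R v) - f (x + h *\<^sub>R w) + f x
    = h * h * dirderiv X w (dirderiv X v f) (x + a *\<^sub>R v + b *\<^sub>R w)"
proof -
  \<comment> \<open>\<open>g\<close> is the increment of \<open>f\<close> along \<open>w\<close> as
    a function of the step along \<open>v\<close>; one mean value theorem along \<open>v\<close> and
    one along \<open>w\<close> reduce \<open>g h - g 0\<close>.\<close>
  define g where "g t = f ((x + h *\<^sub>R w) + t *\<^sub>R v) - f (x + t *\<^sub>R v)" for t
  have xw: "x + h *\<^sub>R w \<in> X" using ray_mem x w h by simp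
  have "(g has_derivative (\<lambda>r. r * (dirderiv X v f ((x + h *\<^sub>R w) + t *\<^sub>R v)
      - dirderiv X v f (x + t *\<^sub>R v)))) (at t within {0..h})" if "0 \<le> t" for t
    unfolding g_def right_diff_distrib
    using has_derivative_diff[OF has_derivative_ray[OF f xw v that] has_derivative_ray[OF f x v that]]
    by simp
  then have "\<exists>a\<in>{0..h}. g h - g 0 = (h - 0) * (dirderiv X v f ((x + h *\<^sub>R w) + a *\<^sub>R v)
      - dirderiv X v f (x + a *\<^sub>R v))"
    using h by (intro mvt_very_simple) auto
  then obtain a where a: "a \<in> {0..h}"
    "g h - g 0 = h * (dirderiv X v f ((x + h *\<^sub>R w) + a *\<^sub>R v) - dirderiv X v f (x + a *\<^sub>R v))"
    by auto
  define y where "y = x + a *\<^sub>R v"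
  have y: "y \<in> X" unfolding y_def using ray_mem x v a by simp
  have "\<exists>b\<in>{0..h}. dirderiv X v f (y + h *\<^sub>R w) - dirderiv X v f (y + 0 *\<^sub>R w)
      = (h - 0) *\<^sub>R dirderiv X w (dirderiv X v f) (y + b *\<^sub>R w)"
    using h has_derivative_ray[OF fv y w] by (intro mvt_very_simple) auto
  then obtain b where b: "b \<in> {0..h}"
    "dirderiv X v f (y + h *\<^sub>R w) - dirderiv X v f y = h * dirderiv X w (dirderiv X v f) (y + b *\<^sub>R w)"
    by auto
  have "f (x + h *\<^sub>R v + h *\<^sub>R w) - f (x + h *\<^sub>R v) - f (x + h *\<^sub>R w) + f x = g h - g 0"
    by (simp add: g_def algebra_simps)
  also have "\<dots> = h * h * dirderiv X w (dirderiv X v f) (x + a *\<^sub>R v + b *\<^sub>R w)"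
    using a(2) b(2) by (simp add: y_def algebra_simps)
  finally show ?thesis using a(1) b(1) by blast
qed

text \<open>Schwarz's theorem in a form valid at boundary points: the second difference is symmetric
  in \<open>v\<close> and \<open>w\<close>, so some value of one mixed derivative near
  \<open>x\<close> equals some value of the other, and continuity passes to the limit.\<close>

lemma dirderiv_commute:
  fixes f :: "'a \<Rightarrow> real"
  assumes f: "f differentiable_on X" "dirderiv X v f differentiable_on X" "dirderiv X w f differentiable_on X"
    and c: "continuous_on X (dirderiv X w (dirderiv X v f))" "continuous_on X (dirderiv X v (dirderiv X w f))"
    and x: "x \<in> X" and v: "v \<in> V" and w: "w \<in> V"
  shows "dirderiv X w (dirderiv X v f) x = dirderiv X v (dirderiv X w f) x"
proof -
  let ?F = "dirderiv X w (dirderiv X v f)" and ?G = "dirderiv X v (dirderiv X w f)"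
  have "\<exists>a\<in>{0..h}. \<exists>b\<in>{0..h}. \<exists>a'\<in>{0..h}. \<exists>b'\<in>{0..h}.
      ?F (x + a *\<^sub>R v + b *\<^sub>R w) = ?G (x + a' *\<^sub>R v + b' *\<^sub>R w)" if h: "h > 0" for h
  proof -
    obtain a b where ab: "a \<in> {0..h}" "b \<in> {0..h}"
      "f (x + h *\<^sub>R v + h *\<^sub>R w) - f (x + h *\<^sub>R v) - f (x + h *\<^sub>R w) + f x
        = h * h * ?F (x + a *\<^sub>R v + b *\<^sub>R w)"
      using second_difference[OF f(1,2) x v w h] by auto
    obtain a' b' where a'b': "a' \<in> {0..h}" "b' \<in> {0..h}"
      "f (x + h *\<^sub>R w + h *\<^sub>R v) - f (x + h *\<^sub>R w) - f (x + h *\<^sub>R v) + f x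
        = h * h * ?G (x + a' *\<^sub>R w + b' *\<^sub>R v)"
      using second_difference[OF f(1,3) x w v h] by auto
    have eqs: "x + h *\<^sub>R w + h *\<^sub>R v = x + h *\<^sub>R v + h *\<^sub>R w"
      "x + a' *\<^sub>R w + b' *\<^sub>R v = x + b' *\<^sub>R v + a' *\<^sub>R w"
      by (simp_all add: algebra_simps)
    have "h * h * ?F (x + a *\<^sub>R v + b *\<^sub>R w) = h * h * ?G (x + b' *\<^sub>R v + a' *\<^sub>R w)"
      using ab(3) a'b'(3)[unfolded eqs] by linarith
    with h ab a'b' show ?thesis by (metis mult_cancel_left mult_eq_0_iff less_irrefl)
  qed
  \<comment> \<open>Steps \<open>h = 1 / (n + 1)\<close> turn the mean points into sequences that
    converge to \<open>x\<close>.\<close>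
  then have "\<forall>n::nat. \<exists>a b a' b'. a \<in> {0..1 / real (Suc n)} \<and> b \<in> {0..1 / real (Suc n)}
      \<and> a' \<in> {0..1 / real (Suc n)} \<and> b' \<in> {0..1 / real (Suc n)} \<and>
      ?F (x + a *\<^sub>R v + b *\<^sub>R w) = ?G (x + a' *\<^sub>R v + b' *\<^sub>R w)"
    by (metis zero_less_divide_1_iff of_nat_0_less_iff zero_less_Suc)
  then obtain a b a' b' where
    I: "\<And>n. a n \<in> {0..1 / real (Suc n)}" "\<And>n. b n \<in> {0..1 / real (Suc n)}"
      "\<And>n. a' n \<in> {0..1 / real (Suc n)}" "\<And>n. b' n \<in> {0..1 / real (Suc n)}"
    and eq: "\<And>n. ?F (x + a n *\<^sub>R v + b n *\<^sub>R w) = ?G (x + a' n *\<^sub>R v + b' n *\<^sub>R w)"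
    by metis
  have lim: "r \<longlonglongrightarrow> 0" if "\<And>n. r n \<in> {0..1 / real (Suc n)}" for r :: "nat \<Rightarrow> real"
    by (rule tendsto_sandwich[of "\<lambda>_. 0" _ _ "\<lambda>n. 1 / real (Suc n)"])
      (use that LIMSEQ_inverse_real_of_nat in \<open>auto simp: inverse_eq_divide\<close>)
  have conv: "(\<lambda>n. H (x + r n *\<^sub>R v + r' n *\<^sub>R w)) \<longlonglongrightarrow> H x"
    if "\<And>n. r n \<in> {0..1 / real (Suc n)}" "\<And>n. r' n \<in> {0..1 / real (Suc n)}" "continuous_on X H"
    for r r' :: "nat \<Rightarrow> real" and H :: "'a \<Rightarrow> real"
  proof (rule continuous_on_tendsto_compose[OF that(3) _ x])
    have "(\<lambda>n. x + r n *\<^sub>R v + r' n *\<^sub>R w) \<longlonglongrightarrow> x + 0 *\<^sub>R v + 0 *\<^sub>R w"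
      by (intro tendsto_intros lim that)
    then show "(\<lambda>n. x + r n *\<^sub>R v + r' n *\<^sub>R w) \<longlonglongrightarrow> x" by simp
    show "\<forall>\<^sub>F n in sequentially. x + r n *\<^sub>R v + r' n *\<^sub>R w \<in> X"
      using that ray_mem x v w by (intro always_eventually allI) simp
  qed
  show ?thesis
    using conv[OF I(1,2) c(1)] conv[OF I(3,4) c(2)] unfolding eq
    using LIMSEQ_unique by blast
qed

subsection \<open>Families of functions with all derivatives of a given order\<close>

text \<open>
  Only the directions in \<open>V\<close> are differentiated: in the half-space they are those not pointing
  backwards in time, which suffices because the schemes look only forward.
\<close>

primrec derivs_bigo :: "nat \<Rightarrow> nat \<Rightarrow> (real \<Rightarrow> 'a \<Rightarrow> real) \<Rightarrow> bool" where
  "derivs_bigo 0 k f \<longleftrightarrow>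
     (\<forall>\<^sub>F h in at_right 0. f h differentiable_on X) \<and> locally_uniform_bigo X f (\<lambda>h. h ^ k)"
| "derivs_bigo (Suc n) k f \<longleftrightarrow>
     (\<forall>\<^sub>F h in at_right 0. f h differentiable_on X) \<and> locally_uniform_bigo X f (\<lambda>h. h ^ k) \<and>
     (\<forall>v\<in>V. derivs_bigo n k (\<lambda>h. dirderiv X v (f h)))"

lemma derivs_bigo_differentiable: "derivs_bigo n k f \<Longrightarrow> \<forall>\<^sub>F h in at_right 0. f h differentiable_on X"
  by (cases n) auto

lemma derivs_bigo_bound: "derivs_bigo n k f \<Longrightarrow> locally_uniform_bigo X f (\<lambda>h. h ^ k)"
  by (cases n) auto

lemma derivs_bigo_SucD: "derivs_bigo (Suc n) k f \<Longrightarrow> derivs_bigo n k f"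
  by (induction n arbitrary: f) auto

lemma derivs_bigo_cong:
  assumes "derivs_bigo n k f" "\<forall>\<^sub>F h in at_right 0. \<forall>p\<in>X. f h p = g h p"
  shows "derivs_bigo n k g"
  using assms
proof (induction n arbitrary: f g)
  have base: "(\<forall>\<^sub>F h in at_right 0. g h differentiable_on X)
      \<and> locally_uniform_bigo X g (\<lambda>h. h ^ k)"
    if "derivs_bigo n k f" "\<forall>\<^sub>F h in at_right 0. \<forall>p\<in>X. f h p = g h p" for f g n
  proof
    show "\<forall>\<^sub>F h in at_right 0. g h differentiable_on X"
      using derivs_bigo_differentiable[OF that(1)] that(2)
      by eventually_elim (metis differentiable_on_def differentiable_transform_within zero_less_one)
    show "locally_uniform_bigo X g (\<lambda>h. h ^ k)"
      using locally_uniform_bigo_cong[OF derivs_bigo_bound] that by blast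
  qed
  {
    case 0
    then show ?case using base[of 0 f g] by simp
  next
    case (Suc n)
    have "\<forall>\<^sub>F h in at_right 0. \<forall>p\<in>X. dirderiv X v (f h) p = dirderiv X v (g h) p" for v
      using Suc.prems(2) by eventually_elim (auto intro: dirderiv_cong)
    then have "derivs_bigo n k (\<lambda>h. dirderiv X v (g h))" if "v \<in> V" for v
      using Suc.prems(1) that by (intro Suc.IH[of "\<lambda>h. dirderiv X v (f h)" "\<lambda>h. dirderiv X v (g h)"]) simp_all
    then show ?case using base[OF Suc.prems] by simp
  }
qed

lemma derivs_bigo_zero: "derivs_bigo n k (\<lambda>h p. 0)"
proof (induction n)
  have base: "locally_uniform_bigo X (\<lambda>h p. 0) (\<lambda>h. h ^ k)"
    unfolding locally_uniform_bigo_def by (intro allI impI exI[of _ 0]) simp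
  {
    case 0
    then show ?case using base by simp
  next
    case (Suc n)
    have "derivs_bigo n k (\<lambda>h. dirderiv X v (\<lambda>p. 0))" for v
      by (rule derivs_bigo_cong[OF Suc]) (simp add: dirderiv_const)
    then show ?case using base by simp
  }
qed

lemma derivs_bigo_add:
  assumes "derivs_bigo n k f" "derivs_bigo n k g"
  shows "derivs_bigo n k (\<lambda>h p. f h p + g h p)"
  using assms
proof (induction n arbitrary: f g)
  have base: "(\<forall>\<^sub>F h in at_right 0. (\<lambda>p. f h p + g h p) differentiable_on X)
      \<and> locally_uniform_bigo X (\<lambda>h p. f h p + g h p) (\<lambda>h. h ^ k)"
    if "derivs_bigo n k f" "derivs_bigo n k g" for f g n
  proof
    show "\<forall>\<^sub>F h in at_right 0. (\<lambda>p. f h p + g h p) differentiable_on X"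
      using that[THEN derivs_bigo_differentiable] by eventually_elim (rule differentiable_on_add)
  qed (intro locally_uniform_bigo_add that[THEN derivs_bigo_bound])
  {
    case 0
    then show ?case using base[of 0] by simp
  next
    case (Suc n)
    have "derivs_bigo n k (\<lambda>h. dirderiv X v (\<lambda>p. f h p + g h p))" if "v \<in> V" for v
    proof (rule derivs_bigo_cong)
      show "derivs_bigo n k (\<lambda>h p. dirderiv X v (f h) p + dirderiv X v (g h) p)"
        using Suc.prems that by (intro Suc.IH) auto
      show "\<forall>\<^sub>F h in at_right 0. \<forall>p\<in>X. dirderiv X v (f h) p + dirderiv X v (g h) p =
          dirderiv X v (\<lambda>p. f h p + g h p) p"
        using Suc.prems[THEN derivs_bigo_differentiable] by eventually_elim (simp add: dirderiv_add)
    qed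
    then show ?case using base[OF Suc.prems] by simp
  }
qed

text \<open>Leibniz's rule preserves the sum of the orders: each term has one factor differentiated
  and one left alone, and the latter gives up one derivative by
  \<open>derivs_bigo_SucD\<close>.\<close>

lemma derivs_bigo_mult:
  assumes "derivs_bigo n k f" "derivs_bigo n l g"
  shows "derivs_bigo n (k + l) (\<lambda>h p. f h p * g h p)"
  using assms
proof (induction n arbitrary: f g)
  have base: "(\<forall>\<^sub>F h in at_right 0. (\<lambda>p. f h p * g h p) differentiable_on X)
      \<and> locally_uniform_bigo X (\<lambda>h p. f h p * g h p) (\<lambda>h. h ^ (k + l))"
    if "derivs_bigo n k f" "derivs_bigo n l g" for f g n
  proof
    show "\<forall>\<^sub>F h in at_right 0. (\<lambda>p. f h p * g h p) differentiable_on X"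
      using that[THEN derivs_bigo_differentiable] by eventually_elim (rule differentiable_on_mult)
    show "locally_uniform_bigo X (\<lambda>h p. f h p * g h p) (\<lambda>h. h ^ (k + l))"
      unfolding power_add by (intro locally_uniform_bigo_mult that[THEN derivs_bigo_bound])
  qed
  {
    case 0
    then show ?case using base[of 0] by simp
  next
    case (Suc n)
    have "derivs_bigo n (k + l) (\<lambda>h. dirderiv X v (\<lambda>p. f h p * g h p))" if "v \<in> V" for v
    proof (rule derivs_bigo_cong)
      show "derivs_bigo n (k + l) (\<lambda>h p. f h p * dirderiv X v (g h) p + dirderiv X v (f h) p * g h p)"
        using Suc.prems that Suc.prems[THEN derivs_bigo_SucD]
        by (intro derivs_bigo_add Suc.IH) auto
      show "\<forall>\<^sub>F h in at_right 0. \<forall>p\<in>X. f h p * dirderiv X v (g h) p + dirderiv X v (f h) p * g h p =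
          dirderiv X v (\<lambda>p. f h p * g h p) p"
        using Suc.prems[THEN derivs_bigo_differentiable] by eventually_elim (simp add: dirderiv_mult)
    qed
    then show ?case using base[OF Suc.prems] by simp
  }
qed

text \<open>Serves the constants and the powers of \<open>h\<close>, seen as families that do not
  depend on the point.\<close>

lemma derivs_bigo_spatially_constant:
  assumes "locally_uniform_bigo X (\<lambda>h p. c h) (\<lambda>h. h ^ k)"
  shows "derivs_bigo n k (\<lambda>h p. c h)"
proof (cases n)
  case (Suc m)
  have "derivs_bigo m k (\<lambda>h. dirderiv X v (\<lambda>p. c h))" for v
    by (rule derivs_bigo_cong[OF derivs_bigo_zero]) (simp add: dirderiv_const)
  then show ?thesis using assms Suc by simp
qed (use assms in simp)

lemma derivs_bigo_antimono:
  assumes "derivs_bigo n k f" "j \<le> k"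
  shows "derivs_bigo n j f"
  using assms(1)
proof (induction n arbitrary: f)
  have base: "locally_uniform_bigo X f (\<lambda>h. h ^ j)" if "derivs_bigo n k f" for f n
  proof (rule locally_uniform_bigo_trans[OF derivs_bigo_bound[OF that]])
    show "\<forall>\<^sub>F h in at_right (0::real). \<bar>h ^ k\<bar> \<le> \<bar>h ^ j\<bar>"
      using eventually_small_right by eventually_elim (use assms(2) in \<open>simp add: power_decreasing\<close>)
  qed
  {
    case 0
    then show ?case using base[of 0] by simp
  next
    case (Suc n)
    then show ?case using base[of "Suc n"] by simp
  }
qed

lemma derivs_bigo_power_mult:
  "derivs_bigo n k f \<Longrightarrow> derivs_bigo n (j + k) (\<lambda>h p. h ^ j * f h p)"
  by (intro derivs_bigo_mult derivs_bigo_spatially_constant locally_uniform_bigo_self)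

text \<open>Legitimate because \<open>h\<close> is positive and does not depend on the point, so it
  factors out of every derivative. This turns a residual of known order into bounds on the defects
  and on the truncation error.\<close>

lemma derivs_bigo_power_cancel:
  assumes "derivs_bigo n (j + k) (\<lambda>h p. h ^ j * f h p)"
  shows "derivs_bigo n k f"
  using assms
proof (induction n arbitrary: f)
  have diff: "\<forall>\<^sub>F h in at_right 0. f h differentiable_on X"
    if "derivs_bigo n (j + k) (\<lambda>h p. h ^ j * f h p)" for f n
    using derivs_bigo_differentiable[OF that] eventually_small_right
  proof eventually_elim
    case (elim h)
    have "(\<lambda>p. inverse (h ^ j) * (h ^ j * f h p)) differentiable_on X"
      by (rule differentiable_on_mult[OF differentiable_on_const elim(1)])
    moreover have "(\<lambda>p. inverse (h ^ j) * (h ^ j * f h p)) = f h"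
      using elim by (simp add: fun_eq_iff field_simps)
    ultimately show ?case by (simp only:)
  qed
  have base: "locally_uniform_bigo X f (\<lambda>h. h ^ k)"
    if "derivs_bigo n (j + k) (\<lambda>h p. h ^ j * f h p)" for f n
    unfolding locally_uniform_bigo_def
  proof (intro allI impI)
    fix K assume K: "compact K \<and> K \<subseteq> X"
    with derivs_bigo_bound[OF that] obtain C where
      "\<forall>\<^sub>F h in at_right 0. \<forall>p\<in>K. \<bar>h ^ j * f h p\<bar> \<le> C * \<bar>h ^ (j + k)\<bar>"
      unfolding locally_uniform_bigo_def by blast
    with eventually_small_right have "\<forall>\<^sub>F h in at_right 0. \<forall>p\<in>K. \<bar>f h p\<bar> \<le> C * \<bar>h ^ k\<bar>"
    proof eventually_elim
      case (elim h)
      then show ?case by (auto simp: abs_mult power_add mult.left_commute[of C])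
    qed
    then show "\<exists>C. \<forall>\<^sub>F h in at_right 0. \<forall>p\<in>K. \<bar>f h p\<bar> \<le> C * \<bar>h ^ k\<bar>" ..
  qed
  {
    case 0
    then show ?case using base[of 0] diff[of 0] by simp
  next
    case (Suc n)
    have "derivs_bigo n k (\<lambda>h. dirderiv X v (f h))" if "v \<in> V" for v
    proof (rule Suc.IH, rule derivs_bigo_cong)
      show "derivs_bigo n (j + k) (\<lambda>h. dirderiv X v (\<lambda>p. h ^ j * f h p))"
        using Suc.prems that by simp
      show "\<forall>\<^sub>F h in at_right 0. \<forall>p\<in>X. dirderiv X v (\<lambda>p. h ^ j * f h p) p = h ^ j * dirderiv X v (f h) p"
        using diff[OF Suc.prems] by eventually_elim (simp add: dirderiv_mult dirderiv_const)
    qed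
    then show ?case using base[OF Suc.prems] diff[OF Suc.prems] by simp
  }
qed

text \<open>For \<open>0 \<le> h \<le> 1\<close> the shifts of \<open>K\<close> by \<open>h\<close>
  times \<open>v\<close> remain in this compact subset of \<open>X\<close>, so a bound valid on
  compact sets survives a shift that depends on \<open>h\<close>.\<close>

lemma compact_segments:
  assumes "compact K" "K \<subseteq> X" "v \<in> V"
  shows "compact ((\<lambda>(p, t). p + t *\<^sub>R v) ` (K \<times> {0..1}))"
    and "(\<lambda>(p, t). p + t *\<^sub>R v) ` (K \<times> {0..1}) \<subseteq> X"
proof -
  show "compact ((\<lambda>(p, t). p + t *\<^sub>R v) ` (K \<times> {0..1}))"
    by (intro compact_continuous_image compact_Times assms)
      (auto simp: case_prod_unfold intro!: continuous_intros)
  show "(\<lambda>(p, t). p + t *\<^sub>R v) ` (K \<times> {0..1}) \<subseteq> X"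
    using assms ray_mem by auto
qed

lemma differentiable_on_shift:
  assumes "f differentiable_on X" "w \<in> V"
  shows "(\<lambda>x. f (x + w)) differentiable_on X"
  using has_derivative_shift[OF assms(1) _ assms(2)]
  unfolding differentiable_on_def differentiable_def by blast

lemma derivs_bigo_shift:
  assumes "derivs_bigo n k f" "w \<in> V"
  shows "derivs_bigo n k (\<lambda>h p. f h (p + h *\<^sub>R w))"
  using assms(1)
proof (induction n arbitrary: f)
  have diff: "\<forall>\<^sub>F h in at_right 0. (\<lambda>p. f h (p + h *\<^sub>R w)) differentiable_on X"
    if "derivs_bigo n k f" for f n
    using derivs_bigo_differentiable[OF that] eventually_small_right
    by eventually_elim (simp add: differentiable_on_shift scale_mem assms(2))
  have base: "locally_uniform_bigo X (\<lambda>h p. f h (p + h *\<^sub>R w)) (\<lambda>h. h ^ k)"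
    if "derivs_bigo n k f" for f n
    unfolding locally_uniform_bigo_def
  proof (intro allI impI)
    fix K assume K: "compact K \<and> K \<subseteq> X"
    with derivs_bigo_bound[OF that] obtain C where
      "\<forall>\<^sub>F h in at_right 0. \<forall>p\<in>(\<lambda>(p, t). p + t *\<^sub>R w) ` (K \<times> {0..1}). \<bar>f h p\<bar> \<le> C * \<bar>h ^ k\<bar>"
      using compact_segments[of K w] assms(2) unfolding locally_uniform_bigo_def by auto
    with eventually_small_right have "\<forall>\<^sub>F h in at_right 0. \<forall>p\<in>K. \<bar>f h (p + h *\<^sub>R w)\<bar> \<le> C * \<bar>h ^ k\<bar>"
      by eventually_elim force
    then show "\<exists>C. \<forall>\<^sub>F h in at_right 0. \<forall>p\<in>K. \<bar>f h (p + h *\<^sub>R w)\<bar> \<le> C * \<bar>h ^ k\<bar>" ..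
  qed
  {
    case 0
    then show ?case using base[of 0] diff[of 0] by simp
  next
    case (Suc n)
    have "derivs_bigo n k (\<lambda>h. dirderiv X v (\<lambda>p. f h (p + h *\<^sub>R w)))" if "v \<in> V" for v
    proof (rule derivs_bigo_cong)
      show "derivs_bigo n k (\<lambda>h p. dirderiv X v (f h) (p + h *\<^sub>R w))"
        using Suc.prems that by (intro Suc.IH) simp
      show "\<forall>\<^sub>F h in at_right 0. \<forall>p\<in>X. dirderiv X v (f h) (p + h *\<^sub>R w)
          = dirderiv X v (\<lambda>p. f h (p + h *\<^sub>R w)) p"
        using derivs_bigo_differentiable[OF Suc.prems] eventually_small_right
        by eventually_elim (simp add: dirderiv_shift scale_mem assms(2))
    qed
    then show ?case using base[OF Suc.prems] diff[OF Suc.prems] by simp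
  }
qed

text \<open>All orders at once: the class is then closed under differentiation, with no count of the
  derivatives spent.\<close>

definition smooth_bigo :: "nat \<Rightarrow> (real \<Rightarrow> 'a \<Rightarrow> real) \<Rightarrow> bool" where
  "smooth_bigo k f \<longleftrightarrow> (\<forall>n. derivs_bigo n k f)"

lemma smooth_bigo_differentiable: "smooth_bigo k f \<Longrightarrow> \<forall>\<^sub>F h in at_right 0. f h differentiable_on X"
  using derivs_bigo_differentiable smooth_bigo_def by blast

lemma smooth_bigo_bound: "smooth_bigo k f \<Longrightarrow> locally_uniform_bigo X f (\<lambda>h. h ^ k)"
  using derivs_bigo_bound smooth_bigo_def by blast

lemma smooth_bigo_cong:
  "smooth_bigo k f \<Longrightarrow> \<forall>\<^sub>F h in at_right 0. \<forall>p\<in>X. f h p = g h p \<Longrightarrow> smooth_bigo k g"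
  using derivs_bigo_cong smooth_bigo_def by blast

lemma smooth_bigo_zero: "smooth_bigo k (\<lambda>h p. 0)"
  by (simp add: smooth_bigo_def derivs_bigo_zero)

lemma smooth_bigo_add:
  "smooth_bigo k f \<Longrightarrow> smooth_bigo k g \<Longrightarrow> smooth_bigo k (\<lambda>h p. f h p + g h p)"
  by (simp add: smooth_bigo_def derivs_bigo_add)

lemma smooth_bigo_mult:
  "smooth_bigo k f \<Longrightarrow> smooth_bigo l g \<Longrightarrow> smooth_bigo (k + l) (\<lambda>h p. f h p * g h p)"
  by (simp add: smooth_bigo_def derivs_bigo_mult)

lemma smooth_bigo_antimono: "smooth_bigo k f \<Longrightarrow> j \<le> k \<Longrightarrow> smooth_bigo j f"
  unfolding smooth_bigo_def by (auto intro: derivs_bigo_antimono)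

lemma smooth_bigo_const: "smooth_bigo 0 (\<lambda>h p. a)"
  by (simp add: smooth_bigo_def derivs_bigo_spatially_constant locally_uniform_bigo_const)

lemma smooth_bigo_cmult: "smooth_bigo k f \<Longrightarrow> smooth_bigo k (\<lambda>h p. a * f h p)"
  using smooth_bigo_mult[OF smooth_bigo_const] by fastforce

lemma smooth_bigo_diff:
  "smooth_bigo k f \<Longrightarrow> smooth_bigo k g \<Longrightarrow> smooth_bigo k (\<lambda>h p. f h p - g h p)"
  using smooth_bigo_add[OF _ smooth_bigo_cmult[of k g "-1"], of f] by simp

lemma smooth_bigo_sum:
  "(\<And>i. i \<in> I \<Longrightarrow> smooth_bigo k (f i)) \<Longrightarrow> smooth_bigo k (\<lambda>h p. \<Sum>i\<in>I. f i h p)"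
  by (induction I rule: infinite_finite_induct) (auto intro: smooth_bigo_zero smooth_bigo_add)

lemma smooth_bigo_power_mult: "smooth_bigo k f \<Longrightarrow> smooth_bigo (j + k) (\<lambda>h p. h ^ j * f h p)"
  by (simp add: smooth_bigo_def derivs_bigo_power_mult)

lemma smooth_bigo_power_cancel: "smooth_bigo (j + k) (\<lambda>h p. h ^ j * f h p) \<Longrightarrow> smooth_bigo k f"
  using derivs_bigo_power_cancel smooth_bigo_def by blast

lemma smooth_bigo_shift:
  "smooth_bigo k f \<Longrightarrow> w \<in> V \<Longrightarrow> smooth_bigo k (\<lambda>h p. f h (p + h *\<^sub>R w))"
  by (simp add: smooth_bigo_def derivs_bigo_shift)

lemma smooth_bigo_dirderiv:
  "smooth_bigo k f \<Longrightarrow> v \<in> V \<Longrightarrow> smooth_bigo k (\<lambda>h. dirderiv X v (f h))"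
  unfolding smooth_bigo_def by (metis derivs_bigo.simps(2))

lemma smooth_bigo_dirderiv_power:
  "smooth_bigo k f \<Longrightarrow> v \<in> V \<Longrightarrow> smooth_bigo k (\<lambda>h. (dirderiv X v ^^ r) (f h))"
  by (induction r) (auto intro: smooth_bigo_dirderiv)

lemma smooth_bigo_dirderiv_commute:
  assumes "smooth_bigo k f" "v \<in> V" "w \<in> V"
  shows "\<forall>\<^sub>F h in at_right 0. \<forall>p\<in>X.
    dirderiv X w (dirderiv X v (f h)) p = dirderiv X v (dirderiv X w (f h)) p"
proof -
  note sm = smooth_bigo_dirderiv[OF _ assms(2)] smooth_bigo_dirderiv[OF _ assms(3)]
  note d = smooth_bigo_differentiable
  show ?thesis
    using d[OF assms(1)] d[OF sm(1)[OF assms(1)]] d[OF sm(2)[OF assms(1)]]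
      d[OF sm(2)[OF sm(1)[OF assms(1)]]] d[OF sm(1)[OF sm(2)[OF assms(1)]]]
    by eventually_elim (use assms in \<open>auto intro!: dirderiv_commute differentiable_imp_continuous_on\<close>)
qed

text \<open>Allows a derivative to be moved inside the Taylor sum.\<close>

lemma smooth_bigo_dirderiv_power_commute:
  assumes "smooth_bigo k f" "v \<in> V" "w \<in> V"
  shows "\<forall>\<^sub>F h in at_right 0. \<forall>p\<in>X.
    dirderiv X w ((dirderiv X v ^^ r) (f h)) p = (dirderiv X v ^^ r) (dirderiv X w (f h)) p"
proof (induction r)
  case (Suc r)
  show ?case
    using Suc smooth_bigo_dirderiv_commute[OF smooth_bigo_dirderiv_power[OF assms(1,2), of r] assms(2,3)]
  proof eventually_elim
    case (elim h)
    show ?case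
    proof
      fix p assume "p \<in> X"
      have "dirderiv X v (dirderiv X w ((dirderiv X v ^^ r) (f h))) p
          = dirderiv X v ((dirderiv X v ^^ r) (dirderiv X w (f h))) p"
        by (rule dirderiv_cong) (use elim(1) \<open>p \<in> X\<close> in auto)
      with elim(2) \<open>p \<in> X\<close> show "dirderiv X w ((dirderiv X v ^^ Suc r) (f h)) p
          = (dirderiv X v ^^ Suc r) (dirderiv X w (f h)) p"
        by simp
    qed
  qed
qed simp

section \<open>Taylor expansion along forward directions\<close>

definition taylor_remainder :: "nat \<Rightarrow> 'a \<Rightarrow> ('a \<Rightarrow> real) \<Rightarrow> real \<Rightarrow> 'a \<Rightarrow> real" where
  "taylor_remainder m v f t x =
     f (x + t *\<^sub>R v) - (\<Sum>r<m. t ^ r / fact r * (dirderiv X v ^^ r) f x)"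

text \<open>The derivative in \<open>t\<close> of the remainder of order \<open>m + 1\<close> of
  \<open>f\<close> is the remainder of order \<open>m\<close> of its derivative along
  \<open>v\<close>, which gives the induction. The mean value theorem is applied without
  integrating, so the bound has no factor \<open>1 / fact m\<close>; only the order matters.\<close>

lemma taylor_remainder_bound:
  assumes "\<And>r. r < m \<Longrightarrow> (dirderiv X v ^^ r) f differentiable_on X"
    and "x \<in> X" "v \<in> V" "0 \<le> t"
    and "\<And>s. 0 \<le> s \<Longrightarrow> s \<le> t \<Longrightarrow> \<bar>(dirderiv X v ^^ m) f (x + s *\<^sub>R v)\<bar> \<le> C"
  shows "\<bar>taylor_remainder m v f t x\<bar> \<le> C * t ^ m"
  using assms(1,4,5)
proof (induction m arbitrary: f t)
  case 0
  then show ?case by (simp add: taylor_remainder_def)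
next
  case (Suc m)
  have f: "f differentiable_on X" using Suc.prems(1)[of 0] by simp
  let ?R = "\<lambda>s. taylor_remainder (Suc m) v f s x"
  let ?R' = "\<lambda>s. taylor_remainder m v (dirderiv X v f) s x"
  have split: "?R s = f (x + s *\<^sub>R v) - f x
      - (\<Sum>r<m. s ^ Suc r / fact (Suc r) * (dirderiv X v ^^ r) (dirderiv X v f) x)" for s
    unfolding taylor_remainder_def sum.lessThan_Suc_shift
    by (simp add: funpow_swap1 del: fact_Suc)
  have poly: "((\<lambda>s. s ^ Suc r / fact (Suc r) * a) has_derivative (\<lambda>d. d * (s ^ r / fact r * a)))
      (at s within {0..t})" for r and a s :: real
  proof -
    have "((\<lambda>s. s ^ Suc r * (a / fact (Suc r))) has_derivative
        (\<lambda>d. real (Suc r) * d * s ^ (Suc r - 1) * (a / fact (Suc r)))) (at s within {0..t})"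
      by (intro has_derivative_mult_left has_derivative_power has_derivative_ident)
    moreover have "real (Suc r) * d * s ^ (Suc r - 1) * (a / fact (Suc r)) = d * (s ^ r / fact r * a)" for d
      by (simp add: fact_Suc del: of_nat_Suc)
    ultimately show ?thesis by simp
  qed
  have "(?R has_derivative (\<lambda>d. d * ?R' s)) (at s within {0..t})" if "0 \<le> s" for s
  proof -
    have "((\<lambda>s. f (x + s *\<^sub>R v) - f x
      - (\<Sum>r<m. s ^ Suc r / fact (Suc r) * (dirderiv X v ^^ r) (dirderiv X v f) x)) has_derivative
      (\<lambda>d. d *\<^sub>R dirderiv X v f (x + s *\<^sub>R v) - 0
      - (\<Sum>r<m. d * (s ^ r / fact r * (dirderiv X v ^^ r) (dirderiv X v f) x)))) (at s within {0..t})"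
      by (intro has_derivative_diff has_derivative_sum poly has_derivative_const
          has_derivative_ray[OF f assms(2,3) that])
    then show ?thesis
      unfolding split by (simp add: taylor_remainder_def right_diff_distrib sum_distrib_left)
  qed
  then have "\<exists>s\<in>{0..t}. ?R t - ?R 0 = (t - 0) * ?R' s"
    using Suc.prems(2) by (intro mvt_very_simple) auto
  then obtain s where s: "0 \<le> s" "s \<le> t" "?R t - ?R 0 = t * ?R' s" by auto
  have "?R 0 = 0" by (simp add: split)
  have C: "0 \<le> C" using Suc.prems(3)[of 0] Suc.prems(2) by force
  have "\<bar>?R' s\<bar> \<le> C * s ^ m"
  proof (rule Suc.IH)
    show "(dirderiv X v ^^ r) (dirderiv X v f) differentiable_on X" if "r < m" for r
      using Suc.prems(1)[of "Suc r"] that by (simp add: funpow_swap1)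
    show "\<bar>(dirderiv X v ^^ m) (dirderiv X v f) (x + r *\<^sub>R v)\<bar> \<le> C" if "0 \<le> r" "r \<le> s" for r
      using Suc.prems(3)[of r] that s by (simp add: funpow_swap1)
  qed fact
  also have "\<dots> \<le> C * t ^ m"
    using s C by (intro mult_left_mono power_mono) auto
  finally have "t * \<bar>?R' s\<bar> \<le> t * (C * t ^ m)"
    using Suc.prems(2) by (intro mult_left_mono)
  then show ?case
    using s(3) \<open>?R 0 = 0\<close> Suc.prems(2) by (simp add: abs_mult mult_ac)
qed

text \<open>The remainder commutes with differentiation: its derivative along \<open>w\<close> is
  the remainder of the derivative of \<open>f\<close> along \<open>w\<close>. The pointwise bound,
  applied to all derivatives of \<open>f\<close>, therefore bounds all derivatives of the
  remainder.\<close>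

lemma smooth_bigo_taylor:
  assumes "smooth_bigo k f" and v: "v \<in> V"
  shows "smooth_bigo (k + m) (\<lambda>h. taylor_remainder m v (f h) h)"
proof -
  have "derivs_bigo n (k + m) (\<lambda>h. taylor_remainder m v (f h) h)" if "smooth_bigo k f" for n f
    using that
  proof (induction n arbitrary: f)
    have diffs: "\<forall>\<^sub>F h in at_right 0. \<forall>r<m. (dirderiv X v ^^ r) (f h) differentiable_on X"
      if "smooth_bigo k f" for f
    proof -
      have "\<forall>\<^sub>F h in at_right 0. \<forall>r\<in>{..<m}. (dirderiv X v ^^ r) (f h) differentiable_on X"
        by (rule eventually_ball_finite)
          (use smooth_bigo_differentiable[OF smooth_bigo_dirderiv_power[OF that v]] in auto)
      then show ?thesis by (rule eventually_mono) simp
    qed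
    have diff: "\<forall>\<^sub>F h in at_right 0. taylor_remainder m v (f h) h differentiable_on X"
      if "smooth_bigo k f" for f
      using diffs[OF that] smooth_bigo_differentiable[OF smooth_bigo_shift[OF that v]]
      unfolding taylor_remainder_def differentiable_on_def
      by eventually_elim (auto intro!: differentiable_diff differentiable_sum differentiable_mult)
    have bound: "locally_uniform_bigo X (\<lambda>h. taylor_remainder m v (f h) h) (\<lambda>h. h ^ (k + m))"
      if "smooth_bigo k f" for f
      unfolding locally_uniform_bigo_def
    proof (intro allI impI)
      fix K assume K: "compact K \<and> K \<subseteq> X"
      with smooth_bigo_bound[OF smooth_bigo_dirderiv_power[OF that v, of m]] obtain C where
        "\<forall>\<^sub>F h in at_right 0. \<forall>p\<in>(\<lambda>(p, t). p + t *\<^sub>R v) ` (K \<times> {0..1}).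
          \<bar>(dirderiv X v ^^ m) (f h) p\<bar> \<le> C * \<bar>h ^ k\<bar>"
        using compact_segments[of K v] v unfolding locally_uniform_bigo_def by auto
      with eventually_small_right diffs[OF that]
      have "\<forall>\<^sub>F h in at_right 0. \<forall>p\<in>K. \<bar>taylor_remainder m v (f h) h p\<bar> \<le> C * \<bar>h ^ (k + m)\<bar>"
      proof eventually_elim
        case (elim h)
        have "\<bar>taylor_remainder m v (f h) h p\<bar> \<le> (C * \<bar>h ^ k\<bar>) * h ^ m" if "p \<in> K" for p
          by (rule taylor_remainder_bound) (use elim v K that in \<open>auto intro!: imageI\<close>)
        with elim show ?case by (simp add: power_add mult.assoc abs_mult)
      qed
      then show "\<exists>C. \<forall>\<^sub>F h in at_right 0. \<forall>p\<in>K. \<bar>taylor_remainder m v (f h) h p\<bar> \<le> C * \<bar>h ^ (k + m)\<bar>" ..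
    qed
    {
      case 0
      then show ?case using diff bound by simp
    next
      case (Suc n)
      have "derivs_bigo n (k + m) (\<lambda>h. dirderiv X w (taylor_remainder m v (f h) h))" if w: "w \<in> V" for w
      proof (rule derivs_bigo_cong)
        show "derivs_bigo n (k + m) (\<lambda>h. taylor_remainder m v (dirderiv X w (f h)) h)"
          by (intro Suc.IH smooth_bigo_dirderiv Suc.prems w)
        have "\<forall>\<^sub>F h in at_right 0. \<forall>r\<in>{..<m}. \<forall>p\<in>X.
          dirderiv X w ((dirderiv X v ^^ r) (f h)) p = (dirderiv X v ^^ r) (dirderiv X w (f h)) p"
          by (intro eventually_ball_finite ballI smooth_bigo_dirderiv_power_commute[OF Suc.prems v w]) simp
        then show "\<forall>\<^sub>F h in at_right 0. \<forall>p\<in>X. taylor_remainder m v (dirderiv X w (f h)) h p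
          = dirderiv X w (taylor_remainder m v (f h) h) p"
          using diffs[OF Suc.prems] smooth_bigo_differentiable[OF Suc.prems] eventually_small_right
        proof eventually_elim
          case (elim h)
          have "(taylor_remainder m v (f h) h has_derivative
            (\<lambda>d. dirderiv X d (f h) (p + h *\<^sub>R v) - (\<Sum>r<m. h ^ r / fact r * dirderiv X d ((dirderiv X v ^^ r) (f h)) p)))
            (at p within X)" if "p \<in> X" for p
            unfolding taylor_remainder_def
            by (intro has_derivative_diff has_derivative_sum has_derivative_mult_right
                has_derivative_shift has_derivative_dirderiv)
              (use elim that v scale_mem in auto)
          then have "dirderiv X w (taylor_remainder m v (f h) h) p = dirderiv X w (f h) (p + h *\<^sub>R v)
              - (\<Sum>r<m. h ^ r / fact r * dirderiv X w ((dirderiv X v ^^ r) (f h)) p)" if "p \<in> X" for p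
            using dirderiv_eq that by blast
          then show ?case
            using elim(1) by (simp add: taylor_remainder_def)
        qed
      qed
      then show ?case using diff[OF Suc.prems] bound[OF Suc.prems] by simp
    }
  qed
  then show ?thesis using assms(1) by (simp add: smooth_bigo_def)
qed

section \<open>Rules of differentiation and composition with smooth functions\<close>

lemma dirderiv_cmult:
  fixes f :: "'a \<Rightarrow> real"
  assumes "f differentiable_on X" "x \<in> X"
  shows "dirderiv X v (\<lambda>x. a * f x) x = a * dirderiv X v f x"
  using dirderiv_mult[of "\<lambda>_. a" f x v] assms by (simp add: dirderiv_const)

lemma dirderiv_diff:
  fixes f g :: "'a \<Rightarrow> 'b::real_normed_vector"
  assumes "f differentiable_on X" "g differentiable_on X" "x \<in> X"
  shows "dirderiv X v (\<lambda>x. f x - g x) x = dirderiv X v f x - dirderiv X v g x"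
  by (rule dirderiv_eq[OF has_derivative_diff])
    (use assms in \<open>auto intro!: has_derivative_dirderiv\<close>)

lemma dirderiv_sum:
  fixes f :: "'i \<Rightarrow> 'a \<Rightarrow> 'b::real_normed_vector"
  assumes "\<And>i. i \<in> I \<Longrightarrow> f i differentiable_on X" "x \<in> X"
  shows "dirderiv X v (\<lambda>x. \<Sum>i\<in>I. f i x) x = (\<Sum>i\<in>I. dirderiv X v (f i) x)"
  by (rule dirderiv_eq[OF has_derivative_sum])
    (use assms in \<open>auto intro!: has_derivative_dirderiv\<close>)

lemma has_derivative_vec_components:
  fixes f :: "'a \<Rightarrow> real ^ 'n::finite"
  assumes "\<And>l. (\<lambda>x. f x $ l) differentiable_on X" "x \<in> X"
  shows "(f has_derivative (\<lambda>v. \<chi> l. dirderiv X v (\<lambda>x. f x $ l) x)) (at x within X)"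
  unfolding has_derivative_componentwise_within[of f]
  using has_derivative_dirderiv[OF assms] by (auto simp: Basis_vec_def inner_axis)

lemma dirderiv_vec_nth:
  fixes f :: "'a \<Rightarrow> real ^ 'n::finite"
  assumes "f differentiable_on X" "x \<in> X"
  shows "dirderiv X v (\<lambda>x. f x $ l) x = dirderiv X v f x $ l"
  by (rule dirderiv_eq[OF bounded_linear.has_derivative[OF bounded_linear_vec_nth]])
    (use assms in \<open>auto intro!: has_derivative_dirderiv\<close>)

text \<open>Only componentwise differentiability of \<open>f\<close> is asked for, as the classes of
  families are made of real functions. The sum over partial derivatives has the shape of the one in
  the second-order term of the theorem.\<close>

lemma dirderiv_compose_vec:
  fixes f :: "'a \<Rightarrow> real ^ 'n::finite" and g :: "real ^ 'n \<Rightarrow> real"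
  assumes "\<And>l. (\<lambda>x. f x $ l) differentiable_on X" "x \<in> X" "g differentiable_on UNIV"
  shows "((\<lambda>x. g (f x)) has_derivative (\<lambda>v. \<Sum>l\<in>UNIV. dirderiv UNIV (axis l 1) g (f x) *
      dirderiv X v (\<lambda>x. f x $ l) x)) (at x within X)"
    and "dirderiv X v (\<lambda>x. g (f x)) x =
      (\<Sum>l\<in>UNIV. dirderiv UNIV (axis l 1) g (f x) * dirderiv X v (\<lambda>x. f x $ l) x)"
proof -
  have gd: "(g has_derivative (\<lambda>w. dirderiv UNIV w g y)) (at y)" for y
    using assms(3) unfolding differentiable_on_def dirderiv_def by (simp add: frechet_derivative_works)
  have "dirderiv UNIV (\<chi> l. d l) g y = (\<Sum>l\<in>UNIV. dirderiv UNIV (axis l 1) g y * d l)" for d :: "'n \<Rightarrow> real" and y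
  proof -
    have "(\<chi> l. d l) = (\<Sum>l\<in>UNIV. d l *\<^sub>R axis l 1)"
      by (simp add: vec_eq_iff axis_def if_distrib[of "\<lambda>x. _ * x"] cong: if_cong)
    moreover have lin: "linear (\<lambda>w. dirderiv UNIV w g y)"
      by (rule has_derivative_linear[OF gd])
    ultimately show ?thesis
      by (simp add: linear_sum[OF lin] linear_cmul[OF lin] mult.commute)
  qed
  then show *: "((\<lambda>x. g (f x)) has_derivative (\<lambda>v. \<Sum>l\<in>UNIV. dirderiv UNIV (axis l 1) g (f x) *
      dirderiv X v (\<lambda>x. f x $ l) x)) (at x within X)"
    using has_derivative_compose[OF has_derivative_vec_components[OF assms(1,2)] gd] by simp
  show "dirderiv X v (\<lambda>x. g (f x)) x =
      (\<Sum>l\<in>UNIV. dirderiv UNIV (axis l 1) g (f x) * dirderiv X v (\<lambda>x. f x $ l) x)"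
    by (rule dirderiv_eq[OF * assms(2)])
qed

text \<open>Order 0 only: a nonlinear \<open>g\<close> keeps bounded families bounded but need not
  keep small ones small. The induction varies \<open>g\<close>, since the chain rule brings in its
  partial derivatives, again composed with \<open>f\<close>.\<close>

lemma derivs_bigo_compose:
  fixes f :: "real \<Rightarrow> 'a \<Rightarrow> real ^ 'n::finite" and g :: "real ^ 'n \<Rightarrow> real"
  assumes "\<And>l. derivs_bigo n 0 (\<lambda>h p. f h p $ l)" "smooth_fun_on UNIV g"
  shows "derivs_bigo n 0 (\<lambda>h p. g (f h p))"
  using assms
proof (induction n arbitrary: g)
  have diffs: "\<forall>\<^sub>F h in at_right 0. \<forall>l. (\<lambda>p. f h p $ l) differentiable_on X"
    if "\<And>l. derivs_bigo n 0 (\<lambda>h p. f h p $ l)" for n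
    using derivs_bigo_differentiable[OF that] by (rule eventually_all_finite)
  have diff: "\<forall>\<^sub>F h in at_right 0. (\<lambda>p. g (f h p)) differentiable_on X"
    if f: "\<And>l. derivs_bigo n 0 (\<lambda>h p. f h p $ l)" and g: "smooth_fun_on UNIV g" for n and g :: "real ^ 'n \<Rightarrow> real"
    using diffs[OF f]
  proof eventually_elim
    case (elim h)
    then have "\<exists>f'. ((\<lambda>p. g (f h p)) has_derivative f') (at x within X)" if "x \<in> X" for x
      using dirderiv_compose_vec(1)[of "f h" x g] smooth_fun_on_differentiable[OF g] that by blast
    then show ?case
      unfolding differentiable_on_def differentiable_def by blast
  qed
  have bound: "locally_uniform_bigo X (\<lambda>h p. g (f h p)) (\<lambda>h. h ^ 0)"
    if f: "\<And>l. derivs_bigo n 0 (\<lambda>h p. f h p $ l)" and g: "smooth_fun_on UNIV g" for n and g :: "real ^ 'n \<Rightarrow> real"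
    unfolding locally_uniform_bigo_def
  proof (intro allI impI)
    fix K assume K: "compact K \<and> K \<subseteq> X"
    have "\<exists>C. \<forall>\<^sub>F h in at_right 0. \<forall>p\<in>K. \<bar>f h p $ l\<bar> \<le> C" for l
    proof -
      obtain C where "\<forall>\<^sub>F h in at_right 0. \<forall>p\<in>K. \<bar>f h p $ l\<bar> \<le> C * \<bar>h ^ 0\<bar>"
        using derivs_bigo_bound[OF f, of l] K unfolding locally_uniform_bigo_def by blast
      then show ?thesis by auto
    qed
    then have "\<exists>C. \<forall>l. \<forall>\<^sub>F h in at_right 0. \<forall>p\<in>K. \<bar>f h p $ l\<bar> \<le> C l"
      by (intro choice allI)
    then obtain C where "\<And>l. \<forall>\<^sub>F h in at_right 0. \<forall>p\<in>K. \<bar>f h p $ l\<bar> \<le> C l" by blast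
    then have C: "\<forall>\<^sub>F h in at_right 0. \<forall>l. \<forall>p\<in>K. \<bar>f h p $ l\<bar> \<le> C l" by (rule eventually_all_finite)
    \<comment> \<open>The sum of the absolute components dominates the Euclidean norm, so on
      \<open>K\<close> all values of \<open>f h\<close> for small \<open>h\<close> lie in one
      compact ball, where \<open>g\<close> is bounded.\<close>
    have "continuous_on (cball 0 (\<Sum>l\<in>UNIV. C l)) g"
      using differentiable_imp_continuous_on[OF smooth_fun_on_differentiable[OF g]]
      by (rule continuous_on_subset) simp
    then have "bounded (g ` cball 0 (\<Sum>l\<in>UNIV. C l))"
      by (intro compact_imp_bounded compact_continuous_image) auto
    then obtain B where B: "\<forall>y\<in>cball 0 (\<Sum>l\<in>UNIV. C l). \<bar>g y\<bar> \<le> B"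
      by (auto simp: bounded_iff)
    from C have "\<forall>\<^sub>F h in at_right 0. \<forall>p\<in>K. \<bar>g (f h p)\<bar> \<le> B * \<bar>h ^ 0\<bar>"
    proof eventually_elim
      case (elim h)
      have "norm (f h p) \<le> (\<Sum>l\<in>UNIV. C l)" if "p \<in> K" for p
        using norm_le_l1_cart[of "f h p"] sum_mono[of UNIV "\<lambda>l. \<bar>f h p $ l\<bar>" C] elim that by fastforce
      then show ?case using B by simp
    qed
    then show "\<exists>C. \<forall>\<^sub>F h in at_right 0. \<forall>p\<in>K. \<bar>g (f h p)\<bar> \<le> C * \<bar>h ^ 0\<bar>" ..
  qed
  {
    case 0
    then show ?case using diff[of 0 g] bound[of 0 g] by simp
  next
    case (Suc n)
    have "derivs_bigo n 0 (\<lambda>h. dirderiv X v (\<lambda>p. g (f h p)))" if v: "v \<in> V" for v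
    proof (rule derivs_bigo_cong)
      have "derivs_bigo n (0 + 0) (\<lambda>h p. dirderiv UNIV (axis l 1) g (f h p) * dirderiv X v (\<lambda>p. f h p $ l) p)" for l
      proof -
        have "derivs_bigo n 0 (\<lambda>h p. f h p $ l')" for l'
          by (rule derivs_bigo_SucD[OF Suc.prems(1)])
        then have "derivs_bigo n 0 (\<lambda>h p. dirderiv UNIV (axis l 1) g (f h p))"
          by (rule Suc.IH[OF _ smooth_fun_on_dirderiv[OF Suc.prems(2)]])
        moreover have "derivs_bigo n 0 (\<lambda>h. dirderiv X v (\<lambda>p. f h p $ l))"
          using Suc.prems(1)[of l] v by simp
        ultimately show ?thesis
          by (rule derivs_bigo_mult)
      qed
      moreover have "derivs_bigo n 0 (\<lambda>h p. \<Sum>l\<in>I. G l h p)" if "\<And>l. derivs_bigo n 0 (G l)"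
        for I :: "'n set" and G
        by (induction I rule: infinite_finite_induct) (use that in \<open>auto intro: derivs_bigo_zero derivs_bigo_add\<close>)
      ultimately show "derivs_bigo n 0
        (\<lambda>h p. \<Sum>l\<in>UNIV. dirderiv UNIV (axis l 1) g (f h p) * dirderiv X v (\<lambda>p. f h p $ l) p)"
        by simp
      show "\<forall>\<^sub>F h in at_right 0. \<forall>p\<in>X.
        (\<Sum>l\<in>UNIV. dirderiv UNIV (axis l 1) g (f h p) * dirderiv X v (\<lambda>p. f h p $ l) p)
        = dirderiv X v (\<lambda>p. g (f h p)) p"
        using diffs[OF Suc.prems(1)]
        by eventually_elim
          (simp add: dirderiv_compose_vec(2) smooth_fun_on_differentiable[OF Suc.prems(2)])
    qed
    then show ?case using bound[OF Suc.prems] diff[OF Suc.prems] by simp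
  }
qed

lemma smooth_bigo_compose:
  fixes f :: "real \<Rightarrow> 'a \<Rightarrow> real ^ 'n::finite" and g :: "real ^ 'n \<Rightarrow> real"
  assumes "\<And>l. smooth_bigo 0 (\<lambda>h p. f h p $ l)" "smooth_fun_on UNIV g"
  shows "smooth_bigo 0 (\<lambda>h p. g (f h p))"
  using assms unfolding smooth_bigo_def by (auto intro: derivs_bigo_compose)

text \<open>The hypothesis speaks of iterated derivatives of the vector function, the conclusion of
  derivatives of its components. The list \<open>ws\<close> of derivatives already taken varies in
  the induction, and the next direction is put at its head.\<close>

lemma smooth_bigo_component:
  fixes u :: "real \<Rightarrow> 'a \<Rightarrow> real ^ 'n::finite"
  assumes "\<forall>\<^sub>F h in at_right 0. smooth_fun_on X (u h)" "derivatives_locally_bounded X u"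
  shows "smooth_bigo 0 (\<lambda>h p. u h p $ l)"
proof -
  have "derivs_bigo n 0 (\<lambda>h p. iter_deriv X ws (u h) p $ l)" for n ws
  proof (induction n arbitrary: ws)
    have diff: "\<forall>\<^sub>F h in at_right 0. iter_deriv X ws (u h) differentiable_on X" for ws
      using assms(1) by eventually_elim (simp add: smooth_fun_on_def)
    have diff': "\<forall>\<^sub>F h in at_right 0. (\<lambda>p. iter_deriv X ws (u h) p $ l) differentiable_on X" for ws
      using diff[of ws]
      by eventually_elim (auto simp: differentiable_on_def differentiable_def
        intro: bounded_linear.has_derivative[OF bounded_linear_vec_nth])
    have bound: "locally_uniform_bigo X (\<lambda>h p. iter_deriv X ws (u h) p $ l) (\<lambda>h. h ^ 0)" for ws
      unfolding locally_uniform_bigo_def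
    proof (intro allI impI)
      fix K assume "compact K \<and> K \<subseteq> X"
      then obtain C where "\<forall>\<^sub>F h in at_right 0. \<forall>p\<in>K. norm (iter_deriv X ws (u h) p) \<le> C"
        using assms(2) unfolding derivatives_locally_bounded_def by blast
      then have "\<forall>\<^sub>F h in at_right 0. \<forall>p\<in>K. \<bar>iter_deriv X ws (u h) p $ l\<bar> \<le> C * \<bar>h ^ 0\<bar>"
        by eventually_elim (auto intro: order_trans[OF component_le_norm_cart])
      then show "\<exists>C. \<forall>\<^sub>F h in at_right 0. \<forall>p\<in>K. \<bar>iter_deriv X ws (u h) p $ l\<bar> \<le> C * \<bar>h ^ 0\<bar>" ..
    qed
    {
      case 0
      then show ?case using diff' bound by simp
    next
      case (Suc n)
      have "derivs_bigo n 0 (\<lambda>h. dirderiv X v (\<lambda>p. iter_deriv X ws (u h) p $ l))" for v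
      proof (rule derivs_bigo_cong[OF Suc.IH[of "v # ws"]])
        show "\<forall>\<^sub>F h in at_right 0. \<forall>p\<in>X. iter_deriv X (v # ws) (u h) p $ l
          = dirderiv X v (\<lambda>p. iter_deriv X ws (u h) p $ l) p"
          using diff[of ws] by eventually_elim (simp add: dirderiv_vec_nth, simp add: iter_deriv_def)
      qed
      then show ?case using diff' bound by simp
    }
  qed
  from this[of _ "[]"] show ?thesis by (simp add: smooth_bigo_def iter_deriv_def)
qed

text \<open>Continuity bounds every derivative on compact sets; this makes a target solution a
  family constant in \<open>h\<close>.\<close>

lemma derivatives_locally_bounded_const:
  fixes u :: "'a \<Rightarrow> 'b::real_normed_vector"
  assumes "smooth_fun_on X u"
  shows "derivatives_locally_bounded X (\<lambda>h. u)"
  unfolding derivatives_locally_bounded_def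
proof (intro allI impI)
  fix vs K assume K: "compact K \<and> K \<subseteq> X"
  have "continuous_on X (iter_deriv X vs u)"
    using assms by (simp add: smooth_fun_on_def differentiable_imp_continuous_on)
  then have "bounded (iter_deriv X vs u ` K)"
    using K by (intro compact_imp_bounded compact_continuous_image) (auto intro: continuous_on_subset)
  then show "\<exists>C. \<forall>\<^sub>F h in at_right (0::real). \<forall>p\<in>K. norm (iter_deriv X vs u p) \<le> C"
    unfolding bounded_iff by fastforce
qed

section \<open>Congruence of families up to order \<open>h ^ k\<close>\<close>

definition approx :: "nat \<Rightarrow> (real \<Rightarrow> 'a \<Rightarrow> real) \<Rightarrow> (real \<Rightarrow> 'a \<Rightarrow> real) \<Rightarrow> bool" where
  "approx k f g \<longleftrightarrow> smooth_bigo k (\<lambda>h p. f h p - g h p)"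

lemma approx_eq: "\<forall>\<^sub>F h in at_right 0. \<forall>p\<in>X. f h p = g h p \<Longrightarrow> approx k f g"
  unfolding approx_def by (rule smooth_bigo_cong[OF smooth_bigo_zero]) (auto elim: eventually_mono)

lemma approx_refl: "approx k f f"
  by (simp add: approx_def smooth_bigo_zero)

lemma approx_sym: "approx k f g \<Longrightarrow> approx k g f"
  using smooth_bigo_cmult[of k "\<lambda>h p. f h p - g h p" "-1"] by (simp add: approx_def)

lemma approx_trans: "approx k f g \<Longrightarrow> approx k g e \<Longrightarrow> approx k f e"
  using smooth_bigo_add[of k "\<lambda>h p. f h p - g h p" "\<lambda>h p. g h p - e h p"] by (simp add: approx_def)

lemma approx_antimono: "approx k f g \<Longrightarrow> j \<le> k \<Longrightarrow> approx j f g"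
  unfolding approx_def by (rule smooth_bigo_antimono)

lemma approx_add:
  "approx k f g \<Longrightarrow> approx k f' g' \<Longrightarrow> approx k (\<lambda>h p. f h p + f' h p) (\<lambda>h p. g h p + g' h p)"
  using smooth_bigo_add[of k "\<lambda>h p. f h p - g h p" "\<lambda>h p. f' h p - g' h p"]
  by (simp add: approx_def algebra_simps)

lemma approx_diff:
  "approx k f g \<Longrightarrow> approx k f' g' \<Longrightarrow> approx k (\<lambda>h p. f h p - f' h p) (\<lambda>h p. g h p - g' h p)"
  using smooth_bigo_diff[of k "\<lambda>h p. f h p - g h p" "\<lambda>h p. f' h p - g' h p"]
  by (simp add: approx_def algebra_simps)

lemma approx_cmult: "approx k f g \<Longrightarrow> approx k (\<lambda>h p. a * f h p) (\<lambda>h p. a * g h p)"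
  using smooth_bigo_cmult[of k "\<lambda>h p. f h p - g h p" a] by (simp add: approx_def algebra_simps)

lemma approx_power_mult:
  "approx k f g \<Longrightarrow> approx (j + k) (\<lambda>h p. h ^ j * f h p) (\<lambda>h p. h ^ j * g h p)"
  using smooth_bigo_power_mult[of k "\<lambda>h p. f h p - g h p" j] by (simp add: approx_def algebra_simps)

lemma approx_sum:
  "(\<And>i. i \<in> I \<Longrightarrow> approx k (f i) (g i)) \<Longrightarrow> approx k (\<lambda>h p. \<Sum>i\<in>I. f i h p) (\<lambda>h p. \<Sum>i\<in>I. g i h p)"
  unfolding approx_def sum_subtractf[symmetric] by (rule smooth_bigo_sum)

text \<open>Smoothness of \<open>f\<close> and \<open>g\<close>, in whatever orders \<open>j\<close>
  and \<open>i\<close>, splits the derivative of the difference; the order \<open>k\<close> comes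
  from the difference alone.\<close>

lemma approx_dirderiv:
  assumes "approx k f g" "smooth_bigo j f" "smooth_bigo i g" "v \<in> V"
  shows "approx k (\<lambda>h. dirderiv X v (f h)) (\<lambda>h. dirderiv X v (g h))"
  unfolding approx_def
proof (rule smooth_bigo_cong)
  show "smooth_bigo k (\<lambda>h. dirderiv X v (\<lambda>p. f h p - g h p))"
    using assms by (intro smooth_bigo_dirderiv) (auto simp: approx_def)
  show "\<forall>\<^sub>F h in at_right 0. \<forall>p\<in>X. dirderiv X v (\<lambda>p. f h p - g h p) p
      = dirderiv X v (f h) p - dirderiv X v (g h) p"
    using assms(2,3)[THEN smooth_bigo_differentiable] by eventually_elim (simp add: dirderiv_diff)
qed

lemma approx_smooth_bigo: "approx k f g \<Longrightarrow> smooth_bigo k g \<Longrightarrow> smooth_bigo k f"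
  using smooth_bigo_add[of k "\<lambda>h p. f h p - g h p" g] by (simp add: approx_def)

text \<open>Three truncations for three uses: one term for the entries of the adjugate, two for the
  correction, which already carries a factor \<open>h\<close>, and three for moments of order
  0.\<close>

lemma approx_shift_1:
  assumes "smooth_bigo k f" "v \<in> V"
  shows "approx (k + 1) (\<lambda>h p. f h (p + h *\<^sub>R v)) f"
  using smooth_bigo_taylor[OF assms, of 1] by (simp add: approx_def taylor_remainder_def[abs_def])

lemma approx_shift_2:
  assumes "smooth_bigo k f" "v \<in> V"
  shows "approx (k + 2) (\<lambda>h p. f h (p + h *\<^sub>R v)) (\<lambda>h p. f h p + h * dirderiv X v (f h) p)"
  using smooth_bigo_taylor[OF assms, of 2]
  by (simp add: approx_def taylor_remainder_def[abs_def] numeral_2_eq_2)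

lemma approx_shift_3:
  assumes "smooth_bigo k f" "v \<in> V"
  shows "approx (k + 3) (\<lambda>h p. f h (p + h *\<^sub>R v)) (\<lambda>h p. f h p + h * dirderiv X v (f h) p
    + h ^ 2 / 2 * dirderiv X v (dirderiv X v (f h)) p)"
  using smooth_bigo_taylor[OF assms, of 3]
  by (simp add: approx_def taylor_remainder_def[abs_def] numeral_3_eq_3 numeral_2_eq_2)

end

subsection \<open>Finite difference operators and the adjugate\<close>

lemma matrix_inv_mult:
  assumes "invertible A"
  shows "A ** matrix_inv A = mat 1" "matrix_inv A ** A = mat 1"
  using someI_ex[OF assms[unfolded invertible_def]] by (simp_all add: matrix_inv_def)

section \<open>The adjugate over a commutative ring\<close>

text \<open>A permutation with \<open>p r = c\<close> takes only the entry 1 from row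
  \<open>r\<close> and column \<open>c\<close>; any other one meets a zero in both matrices. So it
  makes no difference whether row \<open>r\<close> is cleared, and the cofactor becomes a
  determinant with a single replaced column.\<close>

lemma matrix_cofactor_eq_det_column:
  fixes A :: "'a::comm_ring_1 ^ 'm::finite ^ 'm"
  shows "matrix_cofactor A r c = det (\<chi> a b. if b = c then (if a = r then 1 else 0) else A $ a $ b)"
  (is "_ = det ?B")
proof -
  let ?C = "\<chi> a b. if a = r \<and> b = c then 1 else if a = r \<or> b = c then 0 else A $ a $ b"
  have "(\<Prod>a\<in>UNIV. ?C $ a $ p a) = (\<Prod>a\<in>UNIV. ?B $ a $ p a)" if p: "p permutes UNIV" for p
  proof (cases "p r = c")
    case True
    then have "p a = c \<longleftrightarrow> a = r" for a
      using permutes_inj[OF p] by (auto dest: injD)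
    then show ?thesis by (intro prod.cong) auto
  next
    case False
    obtain a where "p a = c" using permutes_surj[OF p] by (metis surjD)
    with False have "(\<Prod>a\<in>UNIV. ?B $ a $ p a) = 0"
      by (intro prod_zero) (auto intro!: exI[of _ a])
    moreover from False have "(\<Prod>a\<in>UNIV. ?C $ a $ p a) = 0"
      by (intro prod_zero) (auto intro!: exI[of _ r])
    ultimately show ?thesis by simp
  qed
  then show ?thesis
    unfolding matrix_cofactor_def det_def by (intro sum.cong) auto
qed

text \<open>Entry \<open>(i, j)\<close> is the expansion along column \<open>i\<close> of
  \<open>A\<close> with that column replaced by column \<open>j\<close>: this is
  \<open>det A\<close> for \<open>i = j\<close> and has a repeated column otherwise. Transposing
  lets linearity in rows be applied.\<close>

lemma adjugate_mult_left:
  fixes A :: "'a::comm_ring_1 ^ 'm::finite ^ 'm"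
  shows "(adjugate A ** A) $ i $ j = (if i = j then det A else 0)"
proof -
  let ?R = "\<lambda>r b. \<chi> a. if a = i then r else transpose A $ a"
  have col: "matrix_cofactor A r i = det (\<chi> a. if a = i then axis r 1 else transpose A $ a)" for r
  proof -
    have "matrix_cofactor A r i
      = det (transpose (\<chi> a b. if b = i then (if a = r then 1 else 0) else A $ a $ b))"
      by (simp add: matrix_cofactor_eq_det_column)
    also have "transpose (\<chi> a b. if b = i then (if a = r then 1 else 0) else A $ a $ b)
      = (\<chi> a. if a = i then axis r 1 else transpose A $ a)"
      by (auto simp: vec_eq_iff transpose_def axis_def)
    finally show ?thesis .
  qed
  have "(adjugate A ** A) $ i $ j = (\<Sum>r\<in>UNIV. A $ r $ j * matrix_cofactor A r i)"
    by (simp add: adjugate_def matrix_matrix_mult_def transpose_def mult.commute)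
  also have "\<dots> = (\<Sum>r\<in>UNIV. det (\<chi> a. if a = i then A $ r $ j *s axis r 1 else transpose A $ a))"
    by (simp add: col det_row_mul)
  also have "\<dots> = det (\<chi> a. if a = i then (\<Sum>r\<in>UNIV. A $ r $ j *s axis r 1) else transpose A $ a)"
    by (rule det_linear_row_sum[symmetric]) simp
  also have "(\<Sum>r\<in>UNIV. A $ r $ j *s axis r 1) = transpose A $ j"
    by (simp add: vec_eq_iff transpose_def axis_def if_distrib[of "\<lambda>x. _ * x"] cong: if_cong)
  also have "det (\<chi> a. if a = i then transpose A $ j else transpose A $ a) = (if i = j then det A else 0)"
  proof (cases "i = j")
    case True
    then have "(\<chi> a. if a = i then transpose A $ j else transpose A $ a) = transpose A"
      by (simp add: vec_eq_iff)
    with True show ?thesis by simp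
  next
    case False
    have "det (\<chi> a. if a = i then transpose A $ j else transpose A $ a) = 0"
      by (rule det_identical_rows[OF False]) (simp add: row_def False)
    with False show ?thesis by simp
  qed
  finally show ?thesis .
qed

section \<open>Action of the operator rings on functions\<close>

abbreviation lattice_vector :: "int ^ 'd \<Rightarrow> real ^ 'd" where
  "lattice_vector z \<equiv> \<chi> k. real_of_int (z $ k)"

text \<open>Cancellation may remove keys from a sum, so operators are compared over a common finite
  set of shifts.\<close>

lemma fd_apply_superset:
  assumes "finite S" "Poly_Mapping.keys D \<subseteq> S"
  shows "fd_apply h D f x = (\<Sum>z\<in>S. Poly_Mapping.lookup D z * f (x - h *\<^sub>R lattice_vector z))"
  unfolding fd_apply_def
  by (rule sum.mono_neutral_left) (use assms in \<open>auto simp: in_keys_iff\<close>)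

lemma fd_apply_0: "fd_apply h 0 f x = 0"
  by (simp add: fd_apply_def)

lemma fd_apply_add: "fd_apply h (D + E) f x = fd_apply h D f x + fd_apply h E f x"
  using fd_apply_superset[of "Poly_Mapping.keys D \<union> Poly_Mapping.keys E" D]
    fd_apply_superset[of "Poly_Mapping.keys D \<union> Poly_Mapping.keys E" E]
    fd_apply_superset[of "Poly_Mapping.keys D \<union> Poly_Mapping.keys E" "D + E"] Poly_Mapping.keys_add[of D E]
  by (simp add: lookup_add distrib_right sum.distrib)

lemma fd_apply_sum: "fd_apply h (\<Sum>i\<in>I. D i) f x = (\<Sum>i\<in>I. fd_apply h (D i) f x)"
  by (induction I rule: infinite_finite_induct) (auto simp: fd_apply_0 fd_apply_add)

lemma fd_apply_single: "fd_apply h (Poly_Mapping.single z a) f x = a * f (x - h *\<^sub>R lattice_vector z)"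
  by (subst fd_apply_superset[of "{z}"]) auto

lemma fd_apply_linear:
  "fd_apply h D (\<lambda>y. a * f y + b * g y) x = a * fd_apply h D f x + b * fd_apply h D g x"
  by (simp add: fd_apply_def sum.distrib sum_distrib_left algebra_simps)

lemma poly_mapping_eq_sum_single:
  "D = (\<Sum>z\<in>Poly_Mapping.keys D. Poly_Mapping.single z (Poly_Mapping.lookup D z))"
  by (rule poly_mapping_eqI)
    (auto simp: lookup_sum lookup_single when_def in_keys_iff cong: if_cong)

lemma lattice_vector_add: "lattice_vector (z + z') = lattice_vector z + lattice_vector z'"
  by (simp add: vec_eq_iff)

text \<open>Bilinearity reduces the claim to two shifts, which compose by adding lattice
  vectors.\<close>

lemma fd_apply_mult: "fd_apply h (D * E) f x = fd_apply h D (fd_apply h E f) x"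
proof -
  let ?d = "Poly_Mapping.lookup D" and ?e = "Poly_Mapping.lookup E"
  have "D * E = (\<Sum>z\<in>Poly_Mapping.keys D. \<Sum>z'\<in>Poly_Mapping.keys E.
      Poly_Mapping.single (z + z') (?d z * ?e z'))"
    by (subst poly_mapping_eq_sum_single[of D], subst poly_mapping_eq_sum_single[of E])
      (simp only: sum_product mult_single)
  then have "fd_apply h (D * E) f x = (\<Sum>z\<in>Poly_Mapping.keys D. \<Sum>z'\<in>Poly_Mapping.keys E.
      ?d z * ?e z' * f (x - h *\<^sub>R lattice_vector (z + z')))"
    by (simp only: fd_apply_sum fd_apply_single)
  also have "\<dots> = fd_apply h D (fd_apply h E f) x"
    unfolding fd_apply_def lattice_vector_add
    by (simp add: sum_distrib_left algebra_simps)
  finally show ?thesis .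
qed

lemma st_apply_degree_le:
  assumes "degree P \<le> n"
  shows "st_apply h k P f (t, x) = (\<Sum>r\<le>n. fd_apply h (coeff P r) (\<lambda>y. f (t + real r * k, y)) x)"
  unfolding st_apply_def prod.case
  by (rule sum.mono_neutral_left) (use assms in \<open>auto simp: coeff_eq_0 fd_apply_0\<close>)

lemma st_apply_0: "st_apply h k 0 f p = 0"
  by (cases p) (simp add: st_apply_def fd_apply_0)

lemma st_apply_add: "st_apply h k (P + Q) f p = st_apply h k P f p + st_apply h k Q f p"
proof (cases p)
  case (Pair t x)
  let ?n = "max (degree P) (degree Q)"
  show ?thesis
    unfolding Pair
    using st_apply_degree_le[of P ?n] st_apply_degree_le[of Q ?n] st_apply_degree_le[of "P + Q" ?n]
      degree_add_le_max[of P Q]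
    by (simp add: fd_apply_add sum.distrib)
qed

lemma st_apply_sum: "st_apply h k (\<Sum>i\<in>I. P i) f p = (\<Sum>i\<in>I. st_apply h k (P i) f p)"
  by (induction I rule: infinite_finite_induct) (auto simp: st_apply_0 st_apply_add)

lemma st_apply_monom:
  "st_apply h k (monom D r) f (t, x) = fd_apply h D (\<lambda>y. f (t + real r * k, y)) x"
proof -
  have "st_apply h k (monom D r) f (t, x)
      = (\<Sum>i\<le>r. fd_apply h (coeff (monom D r) i) (\<lambda>y. f (t + real i * k, y)) x)"
    by (rule st_apply_degree_le) (rule degree_monom_le)
  also have "\<dots> = (\<Sum>i\<le>r. if i = r then fd_apply h D (\<lambda>y. f (t + real i * k, y)) x else 0)"
    by (rule sum.cong) (auto simp: fd_apply_0)
  finally show ?thesis by simp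
qed

lemma st_apply_const: "st_apply h k [:D:] f (t, x) = fd_apply h D (\<lambda>y. f (t, y)) x"
  using st_apply_monom[of h k D 0] by (simp add: monom_0)

lemma st_apply_time_shift:
  fixes f :: "real \<times> (real ^ 'd::finite) \<Rightarrow> real"
  shows "st_apply h k [:0, 1:] f (t, x) = f (t + k, x)"
proof -
  have "[:0, 1:] = monom (Poly_Mapping.single 0 1 :: 'd fd_op) 1"
    by (simp add: monom_Suc monom_0)
  then show ?thesis
    using st_apply_monom[of h k "Poly_Mapping.single 0 1" 1 f t x]
    by (simp add: fd_apply_single del: single_one flip: zero_vec_def)
qed

lemma st_apply_linear:
  "st_apply h k P (\<lambda>p. a * f p + b * g p) q = a * st_apply h k P f q + b * st_apply h k P g q"
  by (cases q) (simp add: st_apply_def fd_apply_linear sum.distrib sum_distrib_left)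

lemma st_apply_arg_zero: "st_apply h k P (\<lambda>p. 0) q = 0"
  using st_apply_linear[of h k P 0 "\<lambda>p. 0" 0 "\<lambda>p. 0" q] by simp

lemma st_apply_arg_add: "st_apply h k P (\<lambda>p. f p + g p) q = st_apply h k P f q + st_apply h k P g q"
  using st_apply_linear[of h k P 1 f 1 g q] by simp

lemma st_apply_arg_diff: "st_apply h k P (\<lambda>p. f p - g p) q = st_apply h k P f q - st_apply h k P g q"
  using st_apply_linear[of h k P 1 f "-1" g q] by simp

lemma st_apply_arg_sum: "st_apply h k P (\<lambda>p. \<Sum>i\<in>I. f i p) q = (\<Sum>i\<in>I. st_apply h k P (f i) q)"
  by (induction I rule: infinite_finite_induct) (auto simp: st_apply_arg_zero st_apply_arg_add)

text \<open>In monomials the claim says that time shifts add up and commute with the space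
  operators.\<close>

lemma st_apply_mult: "st_apply h k (P * Q) f p = st_apply h k P (st_apply h k Q f) p"
proof -
  have monom: "st_apply h k (monom D r * monom E s) f p
      = st_apply h k (monom D r) (st_apply h k (monom E s) f) p" for D E r s p
    by (cases p) (simp add: mult_monom st_apply_monom fd_apply_mult algebra_simps)
  have "st_apply h k (P * Q) f p = st_apply h k
      ((\<Sum>r\<le>degree P. monom (coeff P r) r) * (\<Sum>s\<le>degree Q. monom (coeff Q s) s)) f p"
    by (simp only: poly_as_sum_of_monoms)
  also have "\<dots> = (\<Sum>r\<le>degree P. \<Sum>s\<le>degree Q.
      st_apply h k (monom (coeff P r) r) (st_apply h k (monom (coeff Q s) s) f) p)"
    by (simp only: sum_product st_apply_sum monom)
  also have "\<dots> = st_apply h k (\<Sum>r\<le>degree P. monom (coeff P r) r)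
      (\<lambda>p. st_apply h k (\<Sum>s\<le>degree Q. monom (coeff Q s) s) f p) p"
    by (simp only: st_apply_sum st_apply_arg_sum) (rule sum.swap)
  finally show ?thesis by (simp only: poly_as_sum_of_monoms)
qed

text \<open>The ring homomorphism that sends all shifts, in space and in time, to \<open>1\<close>.\<close>

definition augment :: "('d::finite) fd_op poly \<Rightarrow> real" where
  "augment P = st_apply 0 0 P (\<lambda>_. 1) 0"

text \<open>With zero steps every shift is the identity and the operator acts as a scalar, so
  multiplicativity of \<open>augment\<close> follows from that of the action.\<close>

lemma st_apply_zero_step: "st_apply 0 0 P f p = augment P * f p"
  by (cases p) (simp add: augment_def st_apply_def fd_apply_def zero_prod_def sum_distrib_right)

lemma augment_add: "augment (P + Q) = augment P + augment Q"
  by (simp add: augment_def st_apply_add)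

lemma augment_0: "augment 0 = 0"
  by (simp add: augment_def st_apply_0)

lemma augment_sum: "augment (\<Sum>i\<in>I. P i) = (\<Sum>i\<in>I. augment (P i))"
  by (simp add: augment_def st_apply_sum)

lemma augment_mult: "augment (P * Q) = augment P * augment Q"
  unfolding augment_def[of "P * Q"] st_apply_mult by (simp add: st_apply_zero_step)

lemma augment_single: "augment [:Poly_Mapping.single z a:] = a"
  by (simp add: augment_def zero_prod_def st_apply_const fd_apply_single)

lemma augment_1: "augment 1 = 1"
  using augment_single[of 0 1] by (simp add: one_pCons)

lemma augment_time_shift: "augment [:0, 1:] = 1"
  by (simp add: augment_def zero_prod_def st_apply_time_shift)

lemma augment_uminus: "augment (- P) = - augment P"
  using augment_add[of P "- P"] by (simp add: augment_0)

lemma augment_diff: "augment (P - Q) = augment P - augment Q"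
  using augment_add[of P "- Q"] by (simp add: augment_uminus)

lemma augment_prod: "augment (\<Prod>i\<in>I. P i) = (\<Prod>i\<in>I. augment (P i))"
  by (induction I rule: infinite_finite_induct) (auto simp: augment_1 augment_mult)

lemma augment_det:
  fixes A :: "('d::finite) fd_op poly ^ 'm::finite ^ 'm"
  shows "augment (det A) = det (map_entries augment A)"
proof -
  have "augment (of_int (sign p) :: 'd fd_op poly) = of_int (sign p)" for p :: "'m \<Rightarrow> 'm"
    by (simp add: sign_def augment_1 augment_uminus)
  then show ?thesis
    unfolding det_def by (simp add: augment_sum augment_mult augment_prod map_entries_def)
qed

lemma augment_adjugate: "augment (adjugate A $ r $ c) = adjugate (map_entries augment A) $ r $ c"
  unfolding adjugate_def matrix_cofactor_def transpose_def
  by (simp add: augment_det)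
    (auto intro!: arg_cong[of _ _ det] simp: vec_eq_iff map_entries_def augment_0 augment_1)

lemma adjugate_diag_matrix:
  fixes v :: "'a::comm_ring_1 ^ 'm::finite"
  shows "adjugate (diag_matrix v) $ i $ j = (if i = j then \<Prod>a\<in>UNIV - {i}. v $ a else 0)"
proof (cases "i = j")
  case True
  have "adjugate (diag_matrix v) $ i $ i = det (diag_matrix (\<chi> a. if a = i then 1 else v $ a))"
    unfolding adjugate_def matrix_cofactor_def transpose_def
    by (auto intro!: arg_cong[of _ _ det] simp: vec_eq_iff diag_matrix_def)
  also have "\<dots> = (\<Prod>a\<in>UNIV. if a = i then 1 else v $ a)"
    by (subst det_diagonal) (auto simp: diag_matrix_def)
  also have "\<dots> = (\<Prod>a\<in>UNIV - {i}. v $ a)"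
    by (subst prod.remove[of _ i]) (auto intro!: prod.cong)
  finally show ?thesis using True by simp
next
  case False
  then have "adjugate (diag_matrix v) $ i $ j = 0"
    unfolding adjugate_def matrix_cofactor_def transpose_def
    by (simp only: vec_lambda_beta, intro det_eq_0_if_column_eq_0[of _ j]) (auto simp: diag_matrix_def)
  with False show ?thesis by simp
qed

section \<open>Elimination of the non-conserved moments\<close>

lemma opT_entry:
  "opT c M $ r $ a = (\<Sum>k\<in>UNIV. Poly_Mapping.single (c $ k) (M $ r $ k * matrix_inv M $ k $ a))"
  unfolding opT_def matrix_matrix_mult_def map_entries_def diag_matrix_def
  by (simp add: if_distrib[of "\<lambda>x. _ * x"] const_op_def shift_def mult_single cong: if_cong)

lemma opA_entry: "opA c M s $ r $ a = opT c M $ r $ a * const_op (1 - s $ a)"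
proof -
  have "opA c M s $ r $ a = (\<Sum>b\<in>UNIV. if b = a then opT c M $ r $ a * const_op (1 - s $ a) else 0)"
    unfolding opA_def matrix_matrix_mult_def map_entries_def diag_matrix_def
    by (simp only: vec_lambda_beta) (rule sum.cong, auto simp: const_op_def mat_def)
  then show ?thesis by simp
qed

lemma opB_entry: "opB c M s $ r $ a = opT c M $ r $ a * const_op (s $ a)"
proof -
  have "opB c M s $ r $ a = (\<Sum>b\<in>UNIV. if b = a then opT c M $ r $ a * const_op (s $ a) else 0)"
    unfolding opB_def matrix_matrix_mult_def map_entries_def diag_matrix_def
    by (simp only: vec_lambda_beta) (rule sum.cong, auto simp: const_op_def)
  then show ?thesis by simp
qed

lemma fd_apply_const_op: "fd_apply h (const_op a) f = (\<lambda>y. a * f y)"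
  by (rule ext) (simp add: const_op_def fd_apply_single flip: zero_vec_def)

text \<open>Moves a relaxation rate from the operator to its argument; this merges the terms of
  \<open>opA\<close> and \<open>opB\<close> into \<open>opT\<close> applied to the post-collision
  moments.\<close>

lemma st_apply_mult_const_op:
  "st_apply h k [:D * const_op a:] f p = st_apply h k [:D:] (\<lambda>p. a * f p) p"
  by (cases p) (simp add: st_apply_const fd_apply_mult fd_apply_const_op)

definition mat_apply ::
  "real \<Rightarrow> real \<Rightarrow> ('d::finite) fd_op poly ^ 'm::finite ^ 'm
    \<Rightarrow> ('m \<Rightarrow> real \<times> (real ^ 'd) \<Rightarrow> real) \<Rightarrow> 'm \<Rightarrow> real \<times> (real ^ 'd) \<Rightarrow> real" where
  "mat_apply h k P f r p = (\<Sum>a\<in>UNIV. st_apply h k (P $ r $ a) (f a) p)"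

lemma mat_apply_mult: "mat_apply h k (P ** Q) f r p = mat_apply h k P (mat_apply h k Q f) r p"
proof -
  have "mat_apply h k (P ** Q) f r p
      = (\<Sum>a\<in>UNIV. \<Sum>b\<in>UNIV. st_apply h k (P $ r $ b) (st_apply h k (Q $ b $ a) (f a)) p)"
    by (simp add: mat_apply_def matrix_matrix_mult_def st_apply_sum st_apply_mult)
  also have "\<dots> = (\<Sum>b\<in>UNIV. \<Sum>a\<in>UNIV. st_apply h k (P $ r $ b) (st_apply h k (Q $ b $ a) (f a)) p)"
    by (rule sum.swap)
  also have "\<dots> = (\<Sum>b\<in>UNIV. st_apply h k (P $ r $ b) (\<lambda>p. \<Sum>a\<in>UNIV. st_apply h k (Q $ b $ a) (f a) p) p)"
    by (simp add: st_apply_arg_sum)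
  finally show ?thesis by (simp add: mat_apply_def[abs_def])
qed

text \<open>Row and column \<open>r\<close> of the matrix are zero off the diagonal. Replacing row
  \<open>r\<close> by a unit vector supported at \<open>Inl i\<close> also removes the diagonal
  entry, and column \<open>r\<close> vanishes.\<close>

lemma adjugate_restrict_eq_0:
  assumes "r \<notin> kept_indices i"
  shows "adjugate (zI_minus (restrict_op i A)) $ Inl i $ r = 0"
proof -
  have "matrix_cofactor (zI_minus (restrict_op i A)) r (Inl i) = 0"
    unfolding matrix_cofactor_def
    by (intro det_eq_0_if_column_eq_0[where c = r])
      (use assms in \<open>auto simp: zI_minus_def mat_def map_entries_def restrict_op_def kept_indices_def\<close>)
  then show ?thesis
    by (simp add: adjugate_def transpose_def)
qed

text \<open>Moments \<open>m\<close> and equilibria \<open>e\<close> are independent arguments,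
  since the moments inserted later differ from the equilibria at order \<open>h\<close>.\<close>

definition scheme_residual ::
  "int ^ 'd::finite ^ 'm::finite \<Rightarrow> real ^ 'm ^ 'm \<Rightarrow> real ^ 'm \<Rightarrow> real \<Rightarrow> real
    \<Rightarrow> ('m \<Rightarrow> real \<times> (real ^ 'd) \<Rightarrow> real) \<Rightarrow> ('m \<Rightarrow> real \<times> (real ^ 'd) \<Rightarrow> real)
    \<Rightarrow> 'm \<Rightarrow> real \<times> (real ^ 'd) \<Rightarrow> real" where
  "scheme_residual c M s h k m e r p = st_apply h k [:0, 1:] (m r) p
     - (\<Sum>a\<in>UNIV. st_apply h k [:opT c M $ r $ a:] (\<lambda>p. (1 - s $ a) * m a p + s $ a * e a p) p)"

text \<open>The multiplication by the adjugate eliminates the non-conserved moments, so that any choice of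
  these is admissible on the right-hand side.\<close>

lemma fd_residual_eq:
  fixes m :: "'n::finite + 'k::finite \<Rightarrow> real \<times> (real ^ 'd::finite) \<Rightarrow> real"
  assumes m: "\<And>l. m (Inl l) = (\<lambda>p. u p $ l)"
  shows "fd_residual c M s meq h k i u p =
    (\<Sum>r\<in>kept_indices i. st_apply h k (adjugate (zI_minus (restrict_op i (opA c M s))) $ Inl i $ r)
       (scheme_residual c M s h k m (\<lambda>a p. meq (u p) $ a) r) p)"
proof -
  define A where "A = opA c M s"
  define Z where "Z = zI_minus (restrict_op i A)"
  define e where "e a p = meq (u p) $ a" for a p
  let ?C = "map_entries (\<lambda>a. [:a:])"
  have 1: "st_apply h k (det Z) (\<lambda>p. u p $ i) p = mat_apply h k (adjugate Z) (mat_apply h k Z m) (Inl i) p"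
  proof -
    have "mat_apply h k (adjugate Z ** Z) m (Inl i) p
      = (\<Sum>a\<in>UNIV. if a = Inl i then st_apply h k (det Z) (m a) p else 0)"
      unfolding mat_apply_def by (rule sum.cong) (auto simp: adjugate_mult_left st_apply_0)
    then show ?thesis by (simp add: m mat_apply_mult)
  qed
  have 2: "row_apply h k (coeff_diamond c M s i $ Inl i) (\<lambda>p. complete_moments (u p)) p
    = mat_apply h k (adjugate Z) (mat_apply h k (?C (A - restrict_op i A)) m) (Inl i) p"
  proof -
    have "row_apply h k (coeff_diamond c M s i $ Inl i) (\<lambda>p. complete_moments (u p)) p
      = mat_apply h k (coeff_diamond c M s i) m (Inl i) p"
      unfolding row_apply_def mat_apply_def
    proof (rule sum.cong)
      fix a :: "'n + 'k"
      \<comment> \<open>Non-conserved columns have zero coefficients, so the completion by 0 can be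
        exchanged for the arbitrary \<open>m\<close>; the conserved components coincide.\<close>
      show "st_apply h k (coeff_diamond c M s i $ Inl i $ a) (\<lambda>p. complete_moments (u p) $ a) p
        = st_apply h k (coeff_diamond c M s i $ Inl i $ a) (m a) p"
        by (cases a) (simp_all add: m complete_moments_def coeff_diamond_nonconserved st_apply_0)
    qed simp
    then show ?thesis by (simp add: coeff_diamond_def mat_apply_mult A_def Z_def)
  qed
  have 3: "row_apply h k (coeff_eq c M s i $ Inl i) (\<lambda>p. meq (u p)) p
    = mat_apply h k (adjugate Z) (mat_apply h k (?C (opB c M s)) e) (Inl i) p"
  proof -
    have "row_apply h k (coeff_eq c M s i $ Inl i) (\<lambda>p. meq (u p)) p
      = mat_apply h k (coeff_eq c M s i) e (Inl i) p"
      by (simp add: row_apply_def mat_apply_def e_def[abs_def])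
    then show ?thesis by (simp add: coeff_eq_def mat_apply_mult A_def Z_def)
  qed
  \<comment> \<open>The restricted matrix drops out: \<open>Z\<close> minus
    \<open>A - restrict_op i A\<close> is the time shift minus \<open>A\<close>, which leaves the
    full scheme.\<close>
  have 4: "mat_apply h k Z m r q - mat_apply h k (?C (A - restrict_op i A)) m r q
      - mat_apply h k (?C (opB c M s)) e r q = scheme_residual c M s h k m e r q" for r q
  proof -
    have "mat_apply h k Z m r q + (mat_apply h k (?C (opA c M s)) m r q
        - mat_apply h k (?C (A - restrict_op i A)) m r q) = st_apply h k [:0, 1:] (m r) q"
    proof -
      have "mat_apply h k Z m r q + mat_apply h k (?C A) m r q
        = (\<Sum>a\<in>UNIV. st_apply h k (Z $ r $ a + ?C A $ r $ a) (m a) q)"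
        by (simp add: mat_apply_def st_apply_add sum.distrib)
      also have "\<dots> = (\<Sum>a\<in>UNIV. (if a = r then st_apply h k [:0, 1:] (m r) q else 0)
          + st_apply h k (?C (A - restrict_op i A) $ r $ a) (m a) q)"
      proof (intro sum.cong)
        fix a
        have "Z $ r $ a + ?C A $ r $ a = (if a = r then [:0, 1:] else 0) + ?C (A - restrict_op i A) $ r $ a"
          by (simp add: Z_def zI_minus_def map_entries_def mat_def)
        then show "st_apply h k (Z $ r $ a + ?C A $ r $ a) (m a) q
          = (if a = r then st_apply h k [:0, 1:] (m r) q else 0)
          + st_apply h k (?C (A - restrict_op i A) $ r $ a) (m a) q"
          by (simp add: st_apply_add st_apply_0)
      qed simp
      finally show ?thesis by (simp add: sum.distrib mat_apply_def A_def)
    qed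
    moreover have "mat_apply h k (?C (opA c M s)) m r q + mat_apply h k (?C (opB c M s)) e r q
      = (\<Sum>a\<in>UNIV. st_apply h k [:opT c M $ r $ a:] (\<lambda>p. (1 - s $ a) * m a p + s $ a * e a p) q)"
      by (simp add: mat_apply_def map_entries_def opA_entry opB_entry st_apply_mult_const_op
          st_apply_arg_add sum.distrib)
    ultimately show ?thesis unfolding scheme_residual_def by linarith
  qed
  have "fd_residual c M s meq h k i u p = mat_apply h k (adjugate Z) (mat_apply h k Z m) (Inl i) p
    - mat_apply h k (adjugate Z) (mat_apply h k (?C (A - restrict_op i A)) m) (Inl i) p
    - mat_apply h k (adjugate Z) (mat_apply h k (?C (opB c M s)) e) (Inl i) p"
    unfolding fd_residual_def 2 3 using 1 by (simp add: Z_def A_def)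
  also have "\<dots> = mat_apply h k (adjugate Z) (\<lambda>r p. mat_apply h k Z m r p
    - mat_apply h k (?C (A - restrict_op i A)) m r p - mat_apply h k (?C (opB c M s)) e r p) (Inl i) p"
    unfolding mat_apply_def[of _ _ "adjugate Z"] by (simp add: st_apply_arg_diff sum_subtractf)
  also have "\<dots> = mat_apply h k (adjugate Z) (scheme_residual c M s h k m e) (Inl i) p"
    unfolding 4 ..
  also have "\<dots> = (\<Sum>r\<in>kept_indices i. st_apply h k (adjugate Z $ Inl i $ r) (scheme_residual c M s h k m e r) p)"
    unfolding mat_apply_def
    by (rule sum.mono_neutral_right) (auto simp: Z_def adjugate_restrict_eq_0 st_apply_0)
  finally show ?thesis by (simp add: Z_def A_def e_def[abs_def])
qed

text \<open>With all shifts in space and time set to 1, \<open>opT\<close> becomes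
  \<open>M ** matrix_inv M\<close>, the identity, so the matrix becomes diagonal with entries
  \<open>s\<close> on the kept indices and 1 elsewhere. The diagonal cofactor at
  \<open>Inl i\<close> omits its own entry, which is why \<open>s $ Inl i\<close> does not occur in
  the value.\<close>

lemma augment_adjugate_restrict:
  fixes M :: "real ^ ('n::finite + 'k::finite) ^ ('n + 'k)"
  assumes "invertible M" "r \<in> kept_indices i"
  shows "augment (adjugate (zI_minus (restrict_op i (opA c M s))) $ Inl i $ r)
    = (if r = Inl i then \<Prod>j\<in>UNIV. s $ Inr j else 0)"
proof -
  let ?v = "\<chi> a. if a \<in> kept_indices i then s $ a else 1"
  have "augment [:opT c M $ a $ b:] = (if a = b then 1 else 0)" for a b
  proof -
    have "[:opT c M $ a $ b:] = (\<Sum>k\<in>UNIV. [:Poly_Mapping.single (c $ k) (M $ a $ k * matrix_inv M $ k $ b):])"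
      unfolding opT_entry monom_0[symmetric] by (rule monom_sum)
    then have "augment [:opT c M $ a $ b:] = (M ** matrix_inv M) $ a $ b"
      by (simp add: augment_sum augment_single matrix_matrix_mult_def)
    then show ?thesis
      using matrix_inv_mult[OF assms(1)] by (simp add: mat_def)
  qed
  then have A: "augment [:opA c M s $ a $ b:] = (if a = b then 1 - s $ a else 0)" for a b
    using augment_mult[of "[:opT c M $ a $ b:]" "[:const_op (1 - s $ b):]"]
    by (simp add: opA_entry augment_single const_op_def mult.commute)
  have "map_entries augment (zI_minus (restrict_op i (opA c M s))) = diag_matrix ?v"
  by (simp add: vec_eq_iff map_entries_def zI_minus_def diag_matrix_def restrict_op_def mat_def
        augment_diff augment_time_shift augment_0 A del: diff_pCons)
  then have "augment (adjugate (zI_minus (restrict_op i (opA c M s))) $ Inl i $ r)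
    = (if Inl i = r then \<Prod>a\<in>UNIV - {Inl i}. ?v $ a else 0)"
    by (simp only: augment_adjugate adjugate_diag_matrix)
  moreover have "(\<Prod>a\<in>UNIV - {Inl i}. ?v $ a) = (\<Prod>a\<in>range Inr. s $ a)"
    by (rule prod.mono_neutral_cong_right) (auto simp: kept_indices_def)
  moreover have "\<dots> = (\<Prod>j\<in>UNIV. s $ Inr j)"
    by (simp add: prod.reindex)
  ultimately show ?thesis by auto
qed

subsection \<open>Transport operators\<close>

lemma smooth_fun_on_UNIV_vec_nth:
  fixes f :: "'a::euclidean_space \<Rightarrow> real ^ 'm::finite"
  assumes "smooth_fun_on UNIV f"
  shows "smooth_fun_on UNIV (\<lambda>x. f x $ r)"
proof -
  interpret forward_domain "UNIV :: 'a set" UNIV by standard auto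
  have "iter_deriv UNIV vs (\<lambda>x. f x $ r) = (\<lambda>x. iter_deriv UNIV vs f x $ r)" for vs
  proof (induction vs)
    case (Cons v vs)
    have "iter_deriv UNIV vs f differentiable_on UNIV"
      using assms by (simp add: smooth_fun_on_def)
    then have "dirderiv UNIV v (\<lambda>x. iter_deriv UNIV vs f x $ r) = (\<lambda>x. dirderiv UNIV v (iter_deriv UNIV vs f) x $ r)"
      by (simp add: fun_eq_iff dirderiv_vec_nth)
    with Cons show ?case by (simp add: iter_deriv_def)
  qed (simp add: iter_deriv_def)
  then show ?thesis
    using assms unfolding smooth_fun_on_def differentiable_on_def differentiable_def
    by (metis bounded_linear.has_derivative[OF bounded_linear_vec_nth])
qed

lemma sum_UNIV_sum_type:
  "(\<Sum>a\<in>UNIV. f a) = (\<Sum>l\<in>UNIV. f (Inl l :: 'n::finite + 'k::finite)) + (\<Sum>j\<in>UNIV. f (Inr j))"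
proof -
  have "(\<Sum>a\<in>range Inl \<union> range Inr. f (a :: 'n + 'k)) = (\<Sum>a\<in>range Inl. f a) + (\<Sum>a\<in>range Inr. f a)"
    by (rule sum.union_disjoint) auto
  then show ?thesis
    by (simp add: UNIV_sum[symmetric] sum.reindex)
qed

text \<open>The admissible directions contain all spatial vectors, hence the lattice velocities with
  both signs, while time only goes forward; the schemes use no others.\<close>

lemma forward_domain_half_space:
  fixes X :: "(real \<times> (real ^ 'd::finite)) set"
  assumes "X = {0..} \<times> UNIV \<or> X = {0<..} \<times> UNIV"
  shows "forward_domain X {v. 0 \<le> fst v}"
proof
  show "Basis \<subseteq> {v :: real \<times> (real ^ 'd). 0 \<le> fst v}"
    by (auto simp: Basis_prod_def)
qed (use assms in auto)

locale acoustic_domain = forward_domain X "{v. 0 \<le> fst v}"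
  for X :: "(real \<times> (real ^ 'd::finite)) set" +
  fixes lam :: real
  assumes lam_pos: "0 < lam"
begin

text \<open>Since the time step is \<open>h / lam\<close>, a space-time shift is \<open>h\<close>
  times a direction independent of \<open>h\<close>, whose time component is non-negative.\<close>

lemma st_apply_eq_shifts:
  "st_apply h (h / lam) P f p = (\<Sum>r\<le>degree P. \<Sum>z\<in>Poly_Mapping.keys (coeff P r).
     Poly_Mapping.lookup (coeff P r) z * f (p + h *\<^sub>R (real r / lam, - lattice_vector z)))"
  by (cases p) (simp add: st_apply_def fd_apply_def mult.commute)

lemma approx_st_apply:
  assumes "smooth_bigo k f"
  shows "approx (k + 1) (\<lambda>h. st_apply h (h / lam) P (f h)) (\<lambda>h p. augment P * f h p)"
proof -
  have "augment P * f h p = (\<Sum>r\<le>degree P. \<Sum>z\<in>Poly_Mapping.keys (coeff P r).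
     Poly_Mapping.lookup (coeff P r) z * f h p)" for h p
    by (cases p) (simp add: st_apply_def fd_apply_def flip: st_apply_zero_step)
  then show ?thesis
    unfolding st_apply_eq_shifts[abs_def]
    using lam_pos by (simp only:) (intro approx_sum approx_cmult approx_shift_1 assms, auto)
qed

text \<open>Passing to populations turns the operator matrix into derivatives along the lattice
  velocities, the directions in which streaming shifts.\<close>

lemma G_op_eq:
  assumes "f differentiable_on X" "p \<in> X"
  shows "G_op X c M r a f p =
    (\<Sum>k\<in>UNIV. M $ r $ k * matrix_inv M $ k $ a * dirderiv X (0, lattice_vector (c $ k)) f p)"
proof -
  have "(0, lattice_vector z) = (\<Sum>d\<in>UNIV. real_of_int (z $ d) *\<^sub>R (0::real, axis d (1::real)))" for z :: "int ^ 'd"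
    by (simp add: prod_eq_iff fst_sum snd_sum vec_eq_iff axis_def if_distrib[of "\<lambda>x. _ * x"] cong: if_cong)
  then have D: "dirderiv X (0, lattice_vector z) f p = (\<Sum>d\<in>UNIV. real_of_int (z $ d) * dx_op X d f p)"
    for z :: "int ^ 'd"
    using assms by (simp add: dirderiv_sum_direction dirderiv_scale_direction dx_op_def
        del: scaleR_Pair)
  have E: "(M ** diag_matrix v ** matrix_inv M) $ r $ a = (\<Sum>k\<in>UNIV. M $ r $ k * matrix_inv M $ k $ a * v $ k)"
    for v
    unfolding matrix_matrix_mult_def diag_matrix_def
    by (simp add: if_distrib[of "\<lambda>x. _ * x"] mult_ac cong: if_cong)
  have "G_op X c M r a f p = (\<Sum>d\<in>UNIV. \<Sum>k\<in>UNIV.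
      M $ r $ k * matrix_inv M $ k $ a * (real_of_int (c $ k $ d) * dx_op X d f p))"
    by (simp add: G_op_def E sum_distrib_right mult.assoc)
  also have "\<dots> = (\<Sum>k\<in>UNIV. \<Sum>d\<in>UNIV.
      M $ r $ k * matrix_inv M $ k $ a * (real_of_int (c $ k $ d) * dx_op X d f p))"
    by (rule sum.swap)
  finally show ?thesis
    by (simp only: D sum_distrib_left)
qed

lemma axis_direction: "(0, axis d 1) \<in> {v :: real \<times> (real ^ 'd). 0 \<le> fst v}"
  by simp

lemma smooth_bigo_G_op:
  "smooth_bigo k f \<Longrightarrow> smooth_bigo k (\<lambda>h. G_op X c M r a (f h))"
  unfolding G_op_def[abs_def] dx_op_def
  by (intro smooth_bigo_sum smooth_bigo_cmult smooth_bigo_dirderiv axis_direction)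

lemma approx_G_op:
  "approx k f g \<Longrightarrow> smooth_bigo j f \<Longrightarrow> smooth_bigo i g
    \<Longrightarrow> approx k (\<lambda>h. G_op X c M r a (f h)) (\<lambda>h. G_op X c M r a (g h))"
  unfolding G_op_def[abs_def] dx_op_def
  by (intro approx_sum approx_cmult approx_dirderiv axis_direction)

lemma G_op_cmult:
  "f differentiable_on X \<Longrightarrow> p \<in> X \<Longrightarrow> G_op X c M r a (\<lambda>p. b * f p) p = b * G_op X c M r a f p"
  by (simp add: G_op_def dx_op_def dirderiv_cmult sum_distrib_left mult_ac)

lemma G_op_add:
  "f differentiable_on X \<Longrightarrow> g differentiable_on X \<Longrightarrow> p \<in> X
    \<Longrightarrow> G_op X c M r a (\<lambda>p. f p + g p) p = G_op X c M r a f p + G_op X c M r a g p"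
  by (simp add: G_op_def dx_op_def dirderiv_add sum.distrib algebra_simps)

section \<open>The operator matrix on vectors of moments, and streaming\<close>

definition transport ::
  "int ^ 'd ^ 'm::finite \<Rightarrow> real ^ 'm ^ 'm \<Rightarrow> ('m \<Rightarrow> real \<Rightarrow> real \<times> (real ^ 'd) \<Rightarrow> real)
    \<Rightarrow> 'm \<Rightarrow> real \<Rightarrow> real \<times> (real ^ 'd) \<Rightarrow> real" where
  "transport c M g r h p = (\<Sum>a\<in>UNIV. G_op X c M r a (g a h) p)"

lemma smooth_bigo_transport:
  "(\<And>a. smooth_bigo k (g a)) \<Longrightarrow> smooth_bigo k (transport c M g r)"
  unfolding transport_def[abs_def] by (intro smooth_bigo_sum smooth_bigo_G_op)

lemma approx_transport:
  assumes "\<And>a. approx k (f a) (g a)" "\<And>a. smooth_bigo j (f a)" "\<And>a. smooth_bigo i (g a)"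
  shows "approx k (transport c M f r) (transport c M g r)"
  unfolding transport_def[abs_def] by (intro approx_sum approx_G_op[OF assms])

text \<open>These are the distribution functions, on which the streaming step acts
  diagonally.\<close>

definition populations ::
  "real ^ 'm ^ 'm::finite \<Rightarrow> ('m \<Rightarrow> real \<Rightarrow> real \<times> (real ^ 'd) \<Rightarrow> real)
    \<Rightarrow> 'm \<Rightarrow> real \<Rightarrow> real \<times> (real ^ 'd) \<Rightarrow> real" where
  "populations M g k h p = (\<Sum>a\<in>UNIV. matrix_inv M $ k $ a * g a h p)"

lemma smooth_bigo_populations:
  "(\<And>a. smooth_bigo k (g a)) \<Longrightarrow> smooth_bigo k (populations M g r)"
  unfolding populations_def[abs_def] by (intro smooth_bigo_sum smooth_bigo_cmult)

lemma dirderiv_lincomb: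
  fixes f :: "'i \<Rightarrow> real \<times> (real ^ 'd) \<Rightarrow> real"
  assumes "\<And>i. i \<in> I \<Longrightarrow> f i differentiable_on X" "p \<in> X"
  shows "dirderiv X v (\<lambda>p. \<Sum>i\<in>I. b i * f i p) p = (\<Sum>i\<in>I. b i * dirderiv X v (f i) p)"
  using assms by (subst dirderiv_sum) (auto simp: dirderiv_cmult intro!: sum.cong differentiable_on_mult)

lemma transport_populations:
  assumes "\<And>a. g a h differentiable_on X" "p \<in> X"
  shows "transport c M g r h p
    = (\<Sum>k\<in>UNIV. M $ r $ k * dirderiv X (0, lattice_vector (c $ k)) (populations M g k h) p)"
proof -
  have "transport c M g r h p = (\<Sum>a\<in>UNIV. \<Sum>k\<in>UNIV. M $ r $ k * (matrix_inv M $ k $ a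
      * dirderiv X (0, lattice_vector (c $ k)) (g a h) p))"
    by (simp add: transport_def G_op_eq assms mult.assoc)
  also have "\<dots> = (\<Sum>k\<in>UNIV. \<Sum>a\<in>UNIV. M $ r $ k * (matrix_inv M $ k $ a
      * dirderiv X (0, lattice_vector (c $ k)) (g a h) p))"
    by (rule sum.swap)
  finally show ?thesis
    by (simp add: populations_def[abs_def] dirderiv_lincomb assms sum_distrib_left)
qed

lemma sum_mult_mat_1:
  fixes f :: "'m::finite \<Rightarrow> real"
  assumes "A ** B = (mat 1 :: real ^ 'm ^ 'm)"
  shows "(\<Sum>k\<in>UNIV. A $ r $ k * (\<Sum>a\<in>UNIV. B $ k $ a * f a)) = f r"
proof -
  have "(\<Sum>k\<in>UNIV. A $ r $ k * (\<Sum>a\<in>UNIV. B $ k $ a * f a)) = (A *v (B *v vec_lambda f)) $ r"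
    by (simp add: matrix_vector_mult_def)
  then show ?thesis by (simp add: matrix_vector_mul_assoc assms)
qed

text \<open>Formally \<open>opT\<close> is \<open>exp (- h \<G>)\<close>, here up to its quadratic
  term: each population is shifted exactly along its own velocity, and Taylor's formula is applied
  to that shift.\<close>

lemma approx_opT:
  fixes M :: "real ^ 'm ^ 'm::finite"
  assumes g: "\<And>a. smooth_bigo 0 (g a)" and M: "invertible M"
  shows "approx 3 (\<lambda>h p. \<Sum>a\<in>UNIV. st_apply h (h / lam) [:opT c M $ r $ a:] (g a h) p)
    (\<lambda>h p. g r h p - h * transport c M g r h p + h ^ 2 / 2 * transport c M (transport c M g) r h p)"
proof -
  let ?N = "populations M g" and ?v = "\<lambda>k. (0::real, lattice_vector (c $ k))"
  have N: "smooth_bigo 0 (?N k)" for k by (intro smooth_bigo_populations g)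
  have vV: "?v k \<in> {v. 0 \<le> fst v}" "- ?v k \<in> {v. 0 \<le> fst v}" for k by auto
  have exact: "(\<Sum>a\<in>UNIV. st_apply h (h / lam) [:opT c M $ r $ a:] (g a h) p)
    = (\<Sum>k\<in>UNIV. M $ r $ k * ?N k h (p + h *\<^sub>R - ?v k))" for h p
  proof (cases p)
    case (Pair t x)
    have "(\<Sum>a\<in>UNIV. st_apply h (h / lam) [:opT c M $ r $ a:] (g a h) p)
      = (\<Sum>a\<in>UNIV. \<Sum>k\<in>UNIV. M $ r $ k * (matrix_inv M $ k $ a * g a h (p + h *\<^sub>R - ?v k)))"
      by (simp add: Pair st_apply_const opT_entry fd_apply_sum fd_apply_single mult.assoc)
    also have "\<dots> = (\<Sum>k\<in>UNIV. \<Sum>a\<in>UNIV. M $ r $ k * (matrix_inv M $ k $ a * g a h (p + h *\<^sub>R - ?v k)))"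
      by (rule sum.swap)
    finally show ?thesis by (simp add: populations_def sum_distrib_left)
  qed
  have "approx (0 + 3) (\<lambda>h p. \<Sum>k\<in>UNIV. M $ r $ k * ?N k h (p + h *\<^sub>R - ?v k))
    (\<lambda>h p. \<Sum>k\<in>UNIV. M $ r $ k * (?N k h p + h * dirderiv X (- ?v k) (?N k h) p
      + h ^ 2 / 2 * dirderiv X (- ?v k) (dirderiv X (- ?v k) (?N k h)) p))"
    by (intro approx_sum approx_cmult approx_shift_3[OF N vV(2)])
  moreover have "approx 3 (\<lambda>h p. \<Sum>k\<in>UNIV. M $ r $ k * (?N k h p + h * dirderiv X (- ?v k) (?N k h) p
      + h ^ 2 / 2 * dirderiv X (- ?v k) (dirderiv X (- ?v k) (?N k h)) p))
    (\<lambda>h p. g r h p - h * transport c M g r h p + h ^ 2 / 2 * transport c M (transport c M g) r h p)"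
  proof (rule approx_eq)
    have 1: "\<forall>\<^sub>F h in at_right 0. \<forall>k. ?N k h differentiable_on X"
      by (intro eventually_all_finite smooth_bigo_differentiable[OF N])
    have 2: "\<forall>\<^sub>F h in at_right 0. \<forall>k. dirderiv X (?v k) (?N k h) differentiable_on X"
      by (intro eventually_all_finite smooth_bigo_differentiable[OF smooth_bigo_dirderiv[OF N vV(1)]])
    have 3: "\<forall>\<^sub>F h in at_right 0. \<forall>a. g a h differentiable_on X"
      by (intro eventually_all_finite smooth_bigo_differentiable[OF g])
    have 4: "\<forall>\<^sub>F h in at_right 0. \<forall>a. transport c M g a h differentiable_on X"
      by (intro eventually_all_finite smooth_bigo_differentiable[OF smooth_bigo_transport[OF g]])
    show "\<forall>\<^sub>F h in at_right 0. \<forall>p\<in>X. (\<Sum>k\<in>UNIV. M $ r $ k * (?N k h p + h * dirderiv X (- ?v k) (?N k h) p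
      + h ^ 2 / 2 * dirderiv X (- ?v k) (dirderiv X (- ?v k) (?N k h)) p))
      = g r h p - h * transport c M g r h p + h ^ 2 / 2 * transport c M (transport c M g) r h p"
      using 1 2 3 4
    proof eventually_elim
      case (elim h)
      show ?case
      proof
        fix p assume p: "p \<in> X"
        have D1: "dirderiv X (- ?v k) (?N k h) q = - dirderiv X (?v k) (?N k h) q" if "q \<in> X" for k q
          using dirderiv_scale_direction[of "?N k h" q "-1" "?v k"] elim(1) that by simp
        have D2: "dirderiv X (- ?v k) (dirderiv X (- ?v k) (?N k h)) p
          = dirderiv X (?v k) (dirderiv X (?v k) (?N k h)) p" for k
        proof -
          have "dirderiv X (- ?v k) (dirderiv X (- ?v k) (?N k h)) p
            = dirderiv X (- ?v k) (\<lambda>q. - 1 * dirderiv X (?v k) (?N k h) q) p"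
            by (rule dirderiv_cong) (use D1 p in auto)
          also have "\<dots> = - dirderiv X (- ?v k) (dirderiv X (?v k) (?N k h)) p"
            using elim(2) p by (subst dirderiv_cmult) auto
          also have "\<dots> = dirderiv X (?v k) (dirderiv X (?v k) (?N k h)) p"
            using dirderiv_scale_direction[of "dirderiv X (?v k) (?N k h)" p "-1" "?v k"] elim(2) p by simp
          finally show ?thesis .
        qed
        \<comment> \<open>\<open>matrix_inv M ** M\<close> cancels between two transports, so the
          square of the operator matrix becomes a second derivative along a single velocity.\<close>
        have "populations M (transport c M g) k h q = dirderiv X (?v k) (?N k h) q" if "q \<in> X" for k q
          using sum_mult_mat_1[OF matrix_inv_mult(2)[OF M], of k "\<lambda>k. dirderiv X (?v k) (?N k h) q"]
          by (simp add: populations_def[of M "transport c M g"] transport_populations elim that)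
        then have D3: "dirderiv X (?v k) (populations M (transport c M g) k h) p
          = dirderiv X (?v k) (dirderiv X (?v k) (?N k h)) p" for k
          by (rule dirderiv_cong) (use p in auto)
        have "(\<Sum>k\<in>UNIV. M $ r $ k * ?N k h p) = g r h p"
          unfolding populations_def by (rule sum_mult_mat_1[OF matrix_inv_mult(1)[OF M]])
        moreover have "(\<Sum>k\<in>UNIV. M $ r $ k * (h * - dirderiv X (?v k) (?N k h) p)) = - h * transport c M g r h p"
          by (simp add: transport_populations elim p sum_distrib_left sum_negf mult_ac)
        moreover have "(\<Sum>k\<in>UNIV. M $ r $ k * (h ^ 2 / 2 * dirderiv X (?v k) (dirderiv X (?v k) (?N k h)) p))
          = h ^ 2 / 2 * transport c M (transport c M g) r h p"
          by (simp add: transport_populations[of "transport c M g"] elim p D3 sum_distrib_left mult_ac)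
        ultimately show "(\<Sum>k\<in>UNIV. M $ r $ k * (?N k h p + h * dirderiv X (- ?v k) (?N k h) p
          + h ^ 2 / 2 * dirderiv X (- ?v k) (dirderiv X (- ?v k) (?N k h)) p))
          = g r h p - h * transport c M g r h p + h ^ 2 / 2 * transport c M (transport c M g) r h p"
          unfolding D1[OF p] D2 distrib_left[of "M $ r $ _"] sum.distrib by simp
      qed
    qed
  qed
  ultimately show ?thesis
    unfolding exact by (auto intro: approx_trans)
qed

text \<open>Chosen so that one time step of the scheme is a shift by \<open>h\<close> times this
  vector; the derivative along it is the time derivative divided by \<open>lam\<close>.\<close>

abbreviation time_step :: "real \<times> (real ^ 'd)" where
  "time_step \<equiv> (1 / lam, 0)"

lemma time_step_direction: "time_step \<in> {v. 0 \<le> fst v}"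
  using lam_pos by simp

lemma st_apply_time_step: "st_apply h (h / lam) [:0, 1:] f p = f (p + h *\<^sub>R time_step)"
  by (cases p) (simp add: st_apply_time_shift)

lemma transport_add_power_mult:
  assumes "\<And>a. smooth_bigo 0 (v a)" "\<And>a. smooth_bigo 0 (q a)"
  shows "\<forall>\<^sub>F h in at_right 0. \<forall>p\<in>X. transport c M (\<lambda>a h p. v a h p + h * q a h p) r h p
    = transport c M v r h p + h * transport c M q r h p"
proof -
  have "\<forall>\<^sub>F h in at_right 0. \<forall>a. v a h differentiable_on X"
    "\<forall>\<^sub>F h in at_right 0. \<forall>a. q a h differentiable_on X"
    by (intro eventually_all_finite smooth_bigo_differentiable[OF assms(1)]
        smooth_bigo_differentiable[OF assms(2)])+
  then show ?thesis
  proof eventually_elim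
    case (elim h)
    then show ?case
      by (auto simp: transport_def G_op_add G_op_cmult differentiable_on_mult sum.distrib sum_distrib_left)
  qed
qed

lemma differentiable_on_G_op:
  "(\<And>d. dx_op X d f differentiable_on X) \<Longrightarrow> G_op X c M r a f differentiable_on X"
  unfolding G_op_def[abs_def] differentiable_on_def
  by (auto intro!: differentiable_sum differentiable_mult)

lemma dirderiv_G_op:
  assumes "\<And>d. dx_op X d f differentiable_on X" "p \<in> X"
    and "\<And>d. dx_op X d (dirderiv X v f) p = dirderiv X v (dx_op X d f) p"
  shows "dirderiv X v (G_op X c M r a f) p = G_op X c M r a (dirderiv X v f) p"
  unfolding G_op_def[abs_def] by (simp add: dirderiv_lincomb assms)

text \<open>After the collision the moments are \<open>v + h (1 - s) w\<close>. At order
  \<open>h\<close> the moments and their post-collision part leave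
  \<open>w - (1 - s) w = s w\<close>. At order \<open>h ^ 2\<close> the quadratic terms of the time
  shift and of streaming have opposite signs because the residual is their difference.\<close>

lemma approx_scheme_residual:
  fixes M :: "real ^ 'm ^ 'm::finite"
  assumes v: "\<And>a. smooth_bigo 0 (v a)" and w: "\<And>a. smooth_bigo 0 (w a)" and M: "invertible M"
  shows "approx 3
    (\<lambda>h. scheme_residual c M s h (h / lam) (\<lambda>a p. v a h p + h * w a h p) (\<lambda>a. v a h) r)
    (\<lambda>h p. h * (dirderiv X time_step (v r h) p + transport c M v r h p + s $ r * w r h p)
      + h ^ 2 * (1 / 2 * dirderiv X time_step (dirderiv X time_step (v r h)) p
        - 1 / 2 * transport c M (transport c M v) r h p
        + dirderiv X time_step (w r h) p
        + transport c M (\<lambda>a h p. (1 - s $ a) * w a h p) r h p))"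
proof -
  define q where "q a h p = (1 - s $ a) * w a h p" for a h p
  define g where "g a h p = v a h p + h * q a h p" for a h p
  let ?D = "dirderiv X time_step"
  have hmult: "smooth_bigo 1 (\<lambda>h p. h * f h p)" if "smooth_bigo 0 f" for f
    using smooth_bigo_power_mult[OF that, of 1] by simp
  have q: "smooth_bigo 0 (q a)" for a
    unfolding q_def[abs_def] by (intro smooth_bigo_cmult w)
  have g: "smooth_bigo 0 (g a)" for a
    unfolding g_def[abs_def]
    by (intro smooth_bigo_add v smooth_bigo_antimono[OF hmult[OF q]]) simp
  have gv: "approx 1 (g a) (v a)" for a
    using hmult[OF q, of a] by (simp add: approx_def g_def)
  have time: "approx 3 (\<lambda>h p. v r h (p + h *\<^sub>R time_step) + h * w r h (p + h *\<^sub>R time_step))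
    (\<lambda>h p. (v r h p + h * ?D (v r h) p + h ^ 2 / 2 * ?D (?D (v r h)) p) + (h * w r h p + h * (h * ?D (w r h) p)))"
  proof (rule approx_add)
    show "approx 3 (\<lambda>h p. v r h (p + h *\<^sub>R time_step))
      (\<lambda>h p. v r h p + h * ?D (v r h) p + h ^ 2 / 2 * ?D (?D (v r h)) p)"
      using approx_shift_3[OF v time_step_direction] by simp
    have "approx 3 (\<lambda>h p. h * w r h (p + h *\<^sub>R time_step)) (\<lambda>h p. h * w r h p + h * ?D (\<lambda>p. h * w r h p) p)"
      using approx_shift_2[OF hmult[OF w] time_step_direction, of r] by (simp add: numeral_3_eq_3)
    moreover have "approx 3 (\<lambda>h p. h * w r h p + h * ?D (\<lambda>p. h * w r h p) p) (\<lambda>h p. h * w r h p + h * (h * ?D (w r h) p))"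
      by (rule approx_eq, use smooth_bigo_differentiable[OF w[of r]] in eventually_elim)
        (simp add: dirderiv_cmult)
    ultimately show "approx 3 (\<lambda>h p. h * w r h (p + h *\<^sub>R time_step)) (\<lambda>h p. h * w r h p + h * (h * ?D (w r h) p))"
      by (rule approx_trans)
  qed
  have space: "approx 3 (\<lambda>h p. \<Sum>a\<in>UNIV. st_apply h (h / lam) [:opT c M $ r $ a:] (g a h) p)
    (\<lambda>h p. (g r h p - (h * transport c M v r h p + h * (h * transport c M q r h p)))
      + 1 / 2 * (h ^ 2 * transport c M (transport c M v) r h p))"
  proof (rule approx_trans[OF approx_opT[OF g M]])
    have "approx 3 (\<lambda>h p. g r h p - h * transport c M g r h p)
      (\<lambda>h p. g r h p - (h * transport c M v r h p + h * (h * transport c M q r h p)))"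
      by (rule approx_eq, use transport_add_power_mult[where v = v and q = q and c = c and M = M and r = r, OF v q] in eventually_elim)
        (simp add: g_def[abs_def] algebra_simps)
    moreover have "approx 3 (\<lambda>h p. 1 / 2 * (h ^ 2 * transport c M (transport c M g) r h p))
      (\<lambda>h p. 1 / 2 * (h ^ 2 * transport c M (transport c M v) r h p))"
    proof -
      \<comment> \<open>Under the factor \<open>h ^ 2\<close> accuracy \<open>h\<close> suffices, so
        \<open>g\<close> may be replaced by \<open>v\<close>.\<close>
      have "approx 1 (transport c M (transport c M g) r) (transport c M (transport c M v) r)"
        by (rule approx_transport[OF approx_transport[OF gv g v]
              smooth_bigo_transport[OF g] smooth_bigo_transport[OF v]])
      from approx_cmult[OF approx_power_mult[OF this, of 2], of "1/2"] show ?thesis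
        by (simp add: numeral_3_eq_3)
    qed
    ultimately have "approx 3 (\<lambda>h p. (g r h p - h * transport c M g r h p)
        + 1 / 2 * (h ^ 2 * transport c M (transport c M g) r h p))
      (\<lambda>h p. (g r h p - (h * transport c M v r h p + h * (h * transport c M q r h p)))
        + 1 / 2 * (h ^ 2 * transport c M (transport c M v) r h p))"
      by (rule approx_add)
    then show "approx 3 (\<lambda>h p. g r h p - h * transport c M g r h p
        + h ^ 2 / 2 * transport c M (transport c M g) r h p)
      (\<lambda>h p. (g r h p - (h * transport c M v r h p + h * (h * transport c M q r h p)))
        + 1 / 2 * (h ^ 2 * transport c M (transport c M v) r h p))"
      by simp
  qed
  have gdef: "(1 - s $ a) * (v a h p + h * w a h p) + s $ a * v a h p = g a h p" for a h p
    by (simp add: g_def q_def algebra_simps)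
  show ?thesis
    unfolding scheme_residual_def[abs_def] gdef st_apply_time_step
    by (rule approx_trans[OF approx_diff[OF time space] approx_eq])
      (simp add: g_def q_def[abs_def] algebra_simps power2_eq_square)
qed

end

subsection \<open>Expansion of the scheme\<close>

text \<open>One setting for both claims: \<open>u\<close> is constant in \<open>h\<close> for a
  target solution and varies with \<open>h\<close> for the modified equations.\<close>

locale lbm_family = acoustic_domain X lam
  for X :: "(real \<times> (real ^ 'd::finite)) set" and lam +
  fixes c :: "int ^ 'd ^ ('n::finite + 'k::finite)"
    and M :: "real ^ ('n + 'k) ^ ('n + 'k)"
    and s :: "real ^ ('n + 'k)"
    and meq :: "real ^ 'n \<Rightarrow> real ^ ('n + 'k)"
    and u :: "real \<Rightarrow> real \<times> (real ^ 'd) \<Rightarrow> real ^ 'n"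
  assumes M: "invertible M"
    and s: "\<And>j. s $ Inr j \<noteq> 0"
    and meq: "smooth_fun_on UNIV meq"
    and meq_conserved: "\<And>w l. meq w $ Inl l = w $ l"
    and u: "\<And>l. smooth_bigo 0 (\<lambda>h p. u h p $ l)"
begin

definition eqm :: "'n + 'k \<Rightarrow> real \<Rightarrow> real \<times> (real ^ 'd) \<Rightarrow> real" where
  "eqm a h p = meq (u h p) $ a"

definition defect :: "'n + 'k \<Rightarrow> real \<Rightarrow> real \<times> (real ^ 'd) \<Rightarrow> real" where
  "defect a h p = dirderiv X time_step (eqm a h) p + transport c M eqm a h p"

text \<open>Solves \<open>defect + s * correction = 0\<close> in the non-conserved rows. The
  conserved moments are given by \<open>u\<close>, so no correction is available there.\<close>

definition correction :: "'n + 'k \<Rightarrow> real \<Rightarrow> real \<times> (real ^ 'd) \<Rightarrow> real" where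
  "correction a h p = (case a of Inl l \<Rightarrow> 0 | Inr j \<Rightarrow> - 1 / s $ Inr j * defect (Inr j) h p)"

definition row_residual :: "'n + 'k \<Rightarrow> real \<Rightarrow> real \<times> (real ^ 'd) \<Rightarrow> real" where
  "row_residual r h = scheme_residual c M s h (h / lam) (\<lambda>a p. eqm a h p + h * correction a h p) (\<lambda>a. eqm a h) r"

lemma eqm_conserved: "eqm (Inl l) h = (\<lambda>p. u h p $ l)"
  by (simp add: fun_eq_iff eqm_def meq_conserved)

lemma smooth_bigo_eqm: "smooth_bigo 0 (eqm a)"
  unfolding eqm_def[abs_def] by (rule smooth_bigo_compose[OF u smooth_fun_on_UNIV_vec_nth[OF meq]])

lemma smooth_bigo_defect: "smooth_bigo 0 (defect a)"
  unfolding defect_def[abs_def]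
  by (intro smooth_bigo_add smooth_bigo_dirderiv[OF smooth_bigo_eqm time_step_direction]
      smooth_bigo_transport[OF smooth_bigo_eqm])

lemma correction_Inl: "correction (Inl l) = (\<lambda>h p. 0)"
  by (simp add: correction_def fun_eq_iff)

lemma correction_Inr: "correction (Inr j) = (\<lambda>h p. - 1 / s $ Inr j * defect (Inr j) h p)"
  by (simp add: correction_def fun_eq_iff)

lemma smooth_bigo_correction: "smooth_bigo 0 (correction a)"
  by (cases a)
    (simp_all only: correction_Inl correction_Inr smooth_bigo_zero smooth_bigo_cmult smooth_bigo_defect)

lemma fd_residual_eq_rows:
  "fd_residual c M s meq h (h / lam) i (u h) p =
    st_apply h (h / lam) (adjugate (zI_minus (restrict_op i (opA c M s))) $ Inl i $ Inl i) (row_residual (Inl i) h) p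
    + (\<Sum>j\<in>UNIV. st_apply h (h / lam) (adjugate (zI_minus (restrict_op i (opA c M s))) $ Inl i $ Inr j)
        (row_residual (Inr j) h) p)"
proof -
  let ?m = "\<lambda>a p. eqm a h p + h * correction a h p"
  have "?m (Inl l) = (\<lambda>p. u h p $ l)" for l
    by (simp add: eqm_conserved correction_Inl)
  then have "fd_residual c M s meq h (h / lam) i (u h) p = (\<Sum>r\<in>kept_indices i.
      st_apply h (h / lam) (adjugate (zI_minus (restrict_op i (opA c M s))) $ Inl i $ r) (row_residual r h) p)"
    unfolding row_residual_def eqm_def[abs_def] by (rule fd_residual_eq)
  also have "\<dots> = st_apply h (h / lam) (adjugate (zI_minus (restrict_op i (opA c M s))) $ Inl i $ Inl i) (row_residual (Inl i) h) p
    + (\<Sum>r\<in>range Inr. st_apply h (h / lam) (adjugate (zI_minus (restrict_op i (opA c M s))) $ Inl i $ r) (row_residual r h) p)"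
    unfolding kept_indices_def by (subst sum.insert) auto
  finally show ?thesis by (simp add: sum.reindex)
qed

definition second_coeff :: "'n + 'k \<Rightarrow> real \<Rightarrow> real \<times> (real ^ 'd) \<Rightarrow> real" where
  "second_coeff r h p = 1 / 2 * dirderiv X time_step (dirderiv X time_step (eqm r h)) p
     - 1 / 2 * transport c M (transport c M eqm) r h p
     + dirderiv X time_step (correction r h) p
     + transport c M (\<lambda>a h p. (1 - s $ a) * correction a h p) r h p"

lemma smooth_bigo_second_coeff: "smooth_bigo 0 (second_coeff r)"
  unfolding second_coeff_def[abs_def]
  by (intro smooth_bigo_add smooth_bigo_diff smooth_bigo_cmult smooth_bigo_transport smooth_bigo_correction
      smooth_bigo_eqm smooth_bigo_dirderiv[OF _ time_step_direction])

lemma approx_row_residual: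
  "approx 3 (row_residual r) (\<lambda>h p. h * (defect r h p + s $ r * correction r h p) + h ^ 2 * second_coeff r h p)"
  unfolding row_residual_def[abs_def] defect_def second_coeff_def
  by (rule approx_scheme_residual[OF smooth_bigo_eqm smooth_bigo_correction M])

lemma smooth_bigo_row_residual_Inr: "smooth_bigo 2 (row_residual (Inr j))"
proof -
  have "smooth_bigo 2 (\<lambda>h p. h ^ 2 * second_coeff (Inr j) h p)"
    using smooth_bigo_power_mult[OF smooth_bigo_second_coeff, of 2] by simp
  then have "smooth_bigo 2 (\<lambda>h p. h * (defect (Inr j) h p + s $ Inr j * correction (Inr j) h p)
      + h ^ 2 * second_coeff (Inr j) h p)"
    using s[of j] by (simp add: correction_Inr)
  then show ?thesis
    by - (rule approx_smooth_bigo[OF approx_antimono[OF approx_row_residual]], simp, assumption)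
qed

lemma approx_row_residual_Inl:
  "approx 3 (row_residual (Inl l)) (\<lambda>h p. h * defect (Inl l) h p + h ^ 2 * second_coeff (Inl l) h p)"
  using approx_row_residual[of "Inl l"] by (simp add: correction_Inl)

lemma approx_row_residual_Inl_2: "approx 2 (row_residual (Inl l)) (\<lambda>h p. h * defect (Inl l) h p)"
proof (rule approx_trans[OF approx_antimono[OF approx_row_residual_Inl]])
  show "approx 2 (\<lambda>h p. h * defect (Inl l) h p + h ^ 2 * second_coeff (Inl l) h p) (\<lambda>h p. h * defect (Inl l) h p)"
    using smooth_bigo_power_mult[OF smooth_bigo_second_coeff, of 2 "Inl l"] by (simp add: approx_def)
qed simp

text \<open>Replacing an operator by its \<open>augment\<close> costs an error of one more factor
  \<open>h\<close>. Non-conserved rows have order 2 and entries with vanishing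
  \<open>augment\<close>, so they contribute at order 3; this is the origin of
  \<open>k \<le> 2\<close>.\<close>

lemma approx_fd_residual:
  assumes "smooth_bigo k (row_residual (Inl i))" "k \<le> 2"
  shows "approx (k + 1) (\<lambda>h. fd_residual c M s meq h (h / lam) i (u h))
    (\<lambda>h p. (\<Prod>j\<in>UNIV. s $ Inr j) * row_residual (Inl i) h p)"
proof -
  let ?a = "\<lambda>r. adjugate (zI_minus (restrict_op i (opA c M s))) $ Inl i $ r"
  have "approx (k + 1) (\<lambda>h. st_apply h (h / lam) (?a (Inl i)) (row_residual (Inl i) h))
      (\<lambda>h p. (\<Prod>j\<in>UNIV. s $ Inr j) * row_residual (Inl i) h p)"
    using approx_st_apply[OF assms(1), of "?a (Inl i)"] augment_adjugate_restrict[OF M, of "Inl i" i c s]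
    by (simp add: kept_indices_def)
  moreover have "approx (k + 1) (\<lambda>h p. \<Sum>j\<in>UNIV. st_apply h (h / lam) (?a (Inr j)) (row_residual (Inr j) h) p)
      (\<lambda>h p. \<Sum>j\<in>(UNIV :: 'k set). 0)"
  proof (rule approx_sum)
    fix j :: 'k
    have "augment (?a (Inr j)) = 0"
      using augment_adjugate_restrict[OF M, of "Inr j" i c s] by (simp add: kept_indices_def)
    then have "approx (2 + 1) (\<lambda>h. st_apply h (h / lam) (?a (Inr j)) (row_residual (Inr j) h)) (\<lambda>h p. 0)"
      using approx_st_apply[OF smooth_bigo_row_residual_Inr, of "?a (Inr j)" j] by simp
    then show "approx (k + 1) (\<lambda>h p. st_apply h (h / lam) (?a (Inr j)) (row_residual (Inr j) h) p) (\<lambda>h p. 0)"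
      by (rule approx_antimono) (use assms(2) in simp)
  qed
  ultimately show ?thesis
    unfolding fd_residual_eq_rows[abs_def] using approx_add by fastforce
qed

text \<open>Assumes no smallness of the defects; it is the source of the a posteriori bound on those
  of the conserved moments.\<close>

lemma approx_fd_residual_first_order:
  "approx 2 (\<lambda>h. fd_residual c M s meq h (h / lam) i (u h))
    (\<lambda>h p. (\<Prod>j\<in>UNIV. s $ Inr j) * (h * defect (Inl i) h p))"
proof -
  have "smooth_bigo 1 (\<lambda>h p. h * defect (Inl i) h p)"
    using smooth_bigo_power_mult[OF smooth_bigo_defect, of 1] by simp
  then have "smooth_bigo 1 (row_residual (Inl i))"
    by - (rule approx_smooth_bigo[OF approx_antimono[OF approx_row_residual_Inl_2]], simp, assumption)
  from approx_fd_residual[OF this] show ?thesis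
    using approx_cmult[OF approx_row_residual_Inl_2] by (auto intro: approx_trans simp: numeral_2_eq_2)
qed

section \<open>Identification of the second-order term\<close>

lemma gamma1_eq: "gamma1 X c M meq lam l (u h) p = lam * transport c M eqm (Inl l) h p"
  unfolding gamma1_def transport_def sum_UNIV_sum_type
  by (simp add: eqm_conserved distrib_left) (simp add: eqm_def[abs_def])

lemma defect_conserved:
  "\<forall>\<^sub>F h in at_right 0. \<forall>p\<in>X. \<forall>l. lam * defect (Inl l) h p
    = dt_op X (\<lambda>p. u h p $ l) p + gamma1 X c M meq lam l (u h) p"
proof -
  have "\<forall>\<^sub>F h in at_right 0. \<forall>l. (\<lambda>p. u h p $ l) differentiable_on X"
    by (intro eventually_all_finite smooth_bigo_differentiable[OF u])
  then show ?thesis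
  proof eventually_elim
    case (elim h)
    show ?case
    proof (intro ballI allI)
      fix p l assume "p \<in> X"
      with elim have "dirderiv X time_step (\<lambda>p. u h p $ l) p = 1 / lam * dirderiv X (1, 0) (\<lambda>p. u h p $ l) p"
        using dirderiv_scale_direction[of "\<lambda>p. u h p $ l" p "1 / lam" "(1, 0)"] by simp
      then show "lam * defect (Inl l) h p = dt_op X (\<lambda>p. u h p $ l) p + gamma1 X c M meq lam l (u h) p"
        using lam_pos by (simp add: defect_def eqm_conserved gamma1_eq dt_op_def distrib_left)
    qed
  qed
qed

text \<open>The bracket in the second-order term of the theorem. It is what the defect of
  equilibrium \<open>j\<close> becomes when the time derivatives of the conserved moments are
  replaced by \<open>- gamma1\<close>.\<close>

definition flux_defect :: "'k \<Rightarrow> real \<Rightarrow> real \<times> (real ^ 'd) \<Rightarrow> real" where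
  "flux_defect j h p = (\<Sum>l\<in>UNIV. G_op X c M (Inr j) (Inl l) (\<lambda>p. u h p $ l) p)
     + (\<Sum>l\<in>UNIV. G_op X c M (Inr j) (Inr l) (\<lambda>p. meq (u h p) $ Inr l) p)
     - 1 / lam * (\<Sum>l\<in>UNIV. dirderiv UNIV (axis l 1) (\<lambda>w. meq w $ Inr j) (u h p)
                             * gamma1 X c M meq lam l (u h) p)"

lemma second_order_term_eq:
  "second_order_term X c M s meq lam i (u h) p =
    (\<Sum>j\<in>UNIV. (1 / s $ Inr j - 1 / 2) * G_op X c M (Inl i) (Inr j) (flux_defect j h) p)"
  unfolding second_order_term_def flux_defect_def[abs_def] ..

lemma flux_defect_eq:
  "flux_defect j h p = transport c M eqm (Inr j) h p
    - (\<Sum>l\<in>UNIV. dirderiv UNIV (axis l 1) (\<lambda>w. meq w $ Inr j) (u h p) * transport c M eqm (Inl l) h p)"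
proof -
  have "1 / lam * (\<Sum>l\<in>UNIV. dirderiv UNIV (axis l 1) (\<lambda>w. meq w $ Inr j) (u h p) * gamma1 X c M meq lam l (u h) p)
    = (\<Sum>l\<in>UNIV. dirderiv UNIV (axis l 1) (\<lambda>w. meq w $ Inr j) (u h p) * transport c M eqm (Inl l) h p)"
    using lam_pos by (simp add: gamma1_eq sum_distrib_left mult.left_commute)
  then show ?thesis
    unfolding flux_defect_def transport_def[of _ _ _ "Inr j"] sum_UNIV_sum_type
    by (simp add: eqm_conserved) (simp add: eqm_def[abs_def])
qed

lemma smooth_bigo_dmeq:
  "smooth_bigo 0 (\<lambda>h p. dirderiv UNIV v (\<lambda>w. meq w $ r) (u h p))"
  by (rule smooth_bigo_compose[OF u smooth_fun_on_dirderiv[OF smooth_fun_on_UNIV_vec_nth[OF meq]]])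

lemma smooth_bigo_flux_defect: "smooth_bigo 0 (flux_defect j)"
proof -
  have "smooth_bigo (0 + 0) (\<lambda>h p. dirderiv UNIV (axis l 1) (\<lambda>w. meq w $ Inr j) (u h p)
      * transport c M eqm (Inl l) h p)" for l
    by (intro smooth_bigo_mult smooth_bigo_dmeq smooth_bigo_transport smooth_bigo_eqm)
  then show ?thesis
    unfolding flux_defect_eq[abs_def]
    by (intro smooth_bigo_diff smooth_bigo_sum smooth_bigo_transport smooth_bigo_eqm) simp
qed

lemma smooth_bigo_second_order_term:
  "smooth_bigo 0 (\<lambda>h. second_order_term X c M s meq lam i (u h))"
  unfolding second_order_term_eq[abs_def]
  by (intro smooth_bigo_sum smooth_bigo_cmult smooth_bigo_G_op smooth_bigo_flux_defect)

text \<open>The time derivatives of the equilibria are expressed through space derivatives by the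
  first-order equations for the conserved moments.\<close>

lemma approx_defect_Inr:
  assumes "\<And>l. smooth_bigo 1 (defect (Inl l))"
  shows "approx 1 (defect (Inr j)) (flux_defect j)"
  unfolding approx_def
proof (rule smooth_bigo_cong)
  have "smooth_bigo (0 + 1) (\<lambda>h p. dirderiv UNIV (axis l 1) (\<lambda>w. meq w $ Inr j) (u h p) * defect (Inl l) h p)" for l
    by (intro smooth_bigo_mult smooth_bigo_dmeq assms)
  then show "smooth_bigo 1 (\<lambda>h p. \<Sum>l\<in>UNIV.
      dirderiv UNIV (axis l 1) (\<lambda>w. meq w $ Inr j) (u h p) * defect (Inl l) h p)"
    by (intro smooth_bigo_sum) simp
  have "\<forall>\<^sub>F h in at_right 0. \<forall>l. (\<lambda>p. u h p $ l) differentiable_on X"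
    by (intro eventually_all_finite smooth_bigo_differentiable[OF u])
  then show "\<forall>\<^sub>F h in at_right 0. \<forall>p\<in>X. (\<Sum>l\<in>UNIV.
      dirderiv UNIV (axis l 1) (\<lambda>w. meq w $ Inr j) (u h p) * defect (Inl l) h p)
      = defect (Inr j) h p - flux_defect j h p"
  proof eventually_elim
    case (elim h)
    show ?case
    proof
      fix p assume "p \<in> X"
      with elim have "dirderiv X time_step (eqm (Inr j) h) p = (\<Sum>l\<in>UNIV.
          dirderiv UNIV (axis l 1) (\<lambda>w. meq w $ Inr j) (u h p) * dirderiv X time_step (\<lambda>p. u h p $ l) p)"
        unfolding eqm_def[abs_def]
        using smooth_fun_on_differentiable[OF smooth_fun_on_UNIV_vec_nth[OF meq]]
        by (intro dirderiv_compose_vec(2)[where f = "u h" and g = "\<lambda>w. meq w $ Inr j"]) auto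
      then show "(\<Sum>l\<in>UNIV. dirderiv UNIV (axis l 1) (\<lambda>w. meq w $ Inr j) (u h p) * defect (Inl l) h p)
        = defect (Inr j) h p - flux_defect j h p"
        by (simp add: defect_def flux_defect_eq eqm_conserved distrib_left sum.distrib)
    qed
  qed
qed

text \<open>\<open>\<partial>\<^sub>t / lam\<close> commutes with the constant-coefficient matrix
  \<open>\<G>\<close>, so the left-hand side is \<open>\<partial>\<^sub>t / lam - \<G>\<close>
  applied to the defects. The conserved defects are \<open>O(h)\<close> together with their
  derivatives, and only \<open>\<G>\<close> on the non-conserved ones remains.\<close>

lemma approx_wave_defect:
  assumes "\<And>l. smooth_bigo 1 (defect (Inl l))"
  shows "approx 1
    (\<lambda>h p. dirderiv X time_step (dirderiv X time_step (eqm (Inl i) h)) p - transport c M (transport c M eqm) (Inl i) h p)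
    (\<lambda>h p. - (\<Sum>j\<in>UNIV. G_op X c M (Inl i) (Inr j) (defect (Inr j) h) p))"
proof -
  let ?D = "dirderiv X time_step" and ?T = "transport c M"
  let ?Dv = "\<lambda>a h p. ?D (eqm a h) p"
  have Dv: "smooth_bigo 0 (?Dv a)" for a
    by (rule smooth_bigo_dirderiv[OF smooth_bigo_eqm time_step_direction])
  have Tv: "smooth_bigo 0 (?T eqm a)" for a
    by (rule smooth_bigo_transport[OF smooth_bigo_eqm])
  have "\<forall>\<^sub>F h in at_right 0. \<forall>a. ?D (eqm a h) differentiable_on X"
    "\<forall>\<^sub>F h in at_right 0. \<forall>a. ?T eqm a h differentiable_on X"
    "\<forall>\<^sub>F h in at_right 0. \<forall>a. \<forall>d. dx_op X d (eqm a h) differentiable_on X"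
    "\<forall>\<^sub>F h in at_right 0. \<forall>a. \<forall>d. \<forall>p\<in>X. dx_op X d (?D (eqm a h)) p = ?D (dx_op X d (eqm a h)) p"
    unfolding dx_op_def
    by (intro eventually_all_finite smooth_bigo_differentiable[OF Dv] smooth_bigo_differentiable[OF Tv]
        smooth_bigo_differentiable[OF smooth_bigo_dirderiv[OF smooth_bigo_eqm axis_direction]]
        smooth_bigo_dirderiv_commute[OF smooth_bigo_eqm time_step_direction axis_direction])+
  then have eq: "\<forall>\<^sub>F h in at_right 0. \<forall>p\<in>X. ?D (defect (Inl i) h) p - ?T defect (Inl i) h p
    = ?D (?D (eqm (Inl i) h)) p - ?T (?T eqm) (Inl i) h p"
  proof eventually_elim
    case (elim h)
    show ?case
    proof
      fix p assume p: "p \<in> X"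
      have "?D (?T eqm (Inl i) h) p = (\<Sum>a\<in>UNIV. G_op X c M (Inl i) a (?D (eqm a h)) p)"
        unfolding transport_def[abs_def]
        using elim p by (simp add: dirderiv_sum differentiable_on_G_op dirderiv_G_op)
      then have "?D (?T eqm (Inl i) h) p = ?T (\<lambda>a h. ?D (eqm a h)) (Inl i) h p"
        by (simp add: transport_def)
      moreover have "?D (defect (Inl i) h) p = ?D (?D (eqm (Inl i) h)) p + ?D (?T eqm (Inl i) h) p"
        unfolding defect_def[abs_def] using elim p by (simp add: dirderiv_add)
      moreover have "?T defect (Inl i) h p = ?T (\<lambda>a h. ?D (eqm a h)) (Inl i) h p + ?T (?T eqm) (Inl i) h p"
        unfolding transport_def[of c M _ "Inl i"] defect_def[abs_def]
        using elim p by (simp add: G_op_add sum.distrib)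
      ultimately show "?D (defect (Inl i) h) p - ?T defect (Inl i) h p
        = ?D (?D (eqm (Inl i) h)) p - ?T (?T eqm) (Inl i) h p"
        by simp
    qed
  qed
  have "smooth_bigo 1 (\<lambda>h p. ?D (defect (Inl i) h) p - (\<Sum>l\<in>UNIV. G_op X c M (Inl i) (Inl l) (defect (Inl l) h) p))"
    by (intro smooth_bigo_diff smooth_bigo_sum smooth_bigo_G_op assms
        smooth_bigo_dirderiv[OF _ time_step_direction])
  then have "approx 1 (\<lambda>h p. ?D (defect (Inl i) h) p - ?T defect (Inl i) h p)
    (\<lambda>h p. - (\<Sum>j\<in>UNIV. G_op X c M (Inl i) (Inr j) (defect (Inr j) h) p))"
    by (simp add: approx_def transport_def[of c M defect] sum_UNIV_sum_type algebra_simps)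
  then show ?thesis
    by (rule approx_trans[OF approx_sym[OF approx_eq[OF eq]]])
qed

text \<open>Origin of \<open>1 / s - 1 / 2\<close>: the wave term gives \<open>- 1 / 2\<close>, the
  post-collision part of the correction gives \<open>(1 - s) * (- 1 / s) = 1 - 1 / s\<close>, and
  the sum is \<open>1 / 2 - 1 / s\<close>. The time derivative of the correction drops out in a
  conserved row.\<close>

lemma approx_second_coeff:
  assumes "\<And>l. smooth_bigo 1 (defect (Inl l))"
  shows "approx 1 (second_coeff (Inl i)) (\<lambda>h p. - 1 * second_order_term X c M s meq lam i (u h) p)"
proof -
  let ?G = "\<lambda>j. G_op X c M (Inl i) (Inr j)"
  let ?W = "\<lambda>h p. dirderiv X time_step (dirderiv X time_step (eqm (Inl i) h)) p
    - transport c M (transport c M eqm) (Inl i) h p"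
  have "\<forall>\<^sub>F h in at_right 0. \<forall>j. defect (Inr j) h differentiable_on X"
    by (intro eventually_all_finite smooth_bigo_differentiable[OF smooth_bigo_defect])
  then have expand: "approx 1 (second_coeff (Inl i)) (\<lambda>h p. 1 / 2 * ?W h p
    + (\<Sum>j\<in>UNIV. (1 - 1 / s $ Inr j) * ?G j (defect (Inr j) h) p))"
  proof (intro approx_eq, eventually_elim)
    case (elim h)
    show ?case
    proof
      fix p assume p: "p \<in> X"
      have zero: "(1 - s $ Inl l) * correction (Inl l) h q = 0" for l q by (simp add: correction_Inl)
      have "(1 - s $ Inr j) * correction (Inr j) h q = (1 - 1 / s $ Inr j) * defect (Inr j) h q" for j q
        using s[of j] by (simp add: correction_Inr field_simps)
      then have "transport c M (\<lambda>a h p. (1 - s $ a) * correction a h p) (Inl i) h p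
        = (\<Sum>j\<in>UNIV. (1 - 1 / s $ Inr j) * ?G j (defect (Inr j) h) p)"
        using elim p
        by (simp add: transport_def sum_UNIV_sum_type zero G_op_cmult)
          (simp add: G_op_def dx_op_def dirderiv_const)
      then show "second_coeff (Inl i) h p = 1 / 2 * ?W h p
        + (\<Sum>j\<in>UNIV. (1 - 1 / s $ Inr j) * ?G j (defect (Inr j) h) p)"
        using p by (simp add: second_coeff_def correction_Inl dirderiv_const)
    qed
  qed
  have collect: "1 / 2 * - (\<Sum>j\<in>UNIV. ?G j (defect (Inr j) h) p)
      + (\<Sum>j\<in>UNIV. (1 - 1 / s $ Inr j) * ?G j (defect (Inr j) h) p)
    = - 1 * (\<Sum>j\<in>UNIV. (1 / s $ Inr j - 1 / 2) * ?G j (defect (Inr j) h) p)" for h p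
    by (simp add: sum_distrib_left flip: sum.distrib sum_negf) (intro sum.cong, auto simp: algebra_simps)
  have "approx 1 (\<lambda>h p. 1 / 2 * ?W h p + (\<Sum>j\<in>UNIV. (1 - 1 / s $ Inr j) * ?G j (defect (Inr j) h) p))
    (\<lambda>h p. - 1 * (\<Sum>j\<in>UNIV. (1 / s $ Inr j - 1 / 2) * ?G j (defect (Inr j) h) p))"
    unfolding collect[symmetric]
    by (intro approx_add approx_cmult approx_wave_defect assms approx_refl)
  moreover have "approx 1 (\<lambda>h p. - 1 * (\<Sum>j\<in>UNIV. (1 / s $ Inr j - 1 / 2) * ?G j (defect (Inr j) h) p))
    (\<lambda>h p. - 1 * (\<Sum>j\<in>UNIV. (1 / s $ Inr j - 1 / 2) * ?G j (flux_defect j h) p))"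
    by (intro approx_cmult approx_sum approx_G_op[OF approx_defect_Inr[OF assms] smooth_bigo_defect smooth_bigo_flux_defect])
  ultimately show ?thesis
    unfolding second_order_term_eq by (rule approx_trans[OF expand approx_trans])
qed

lemma approx_fd_residual_second_order:
  assumes "\<And>l. smooth_bigo 1 (defect (Inl l))"
  shows "approx 3 (\<lambda>h. fd_residual c M s meq h (h / lam) i (u h))
    (\<lambda>h p. (\<Prod>j\<in>UNIV. s $ Inr j) * (h * defect (Inl i) h p - h ^ 2 * second_order_term X c M s meq lam i (u h) p))"
proof -
  have "smooth_bigo 2 (\<lambda>h p. h * defect (Inl i) h p)"
    using smooth_bigo_power_mult[OF assms, of 1 i] by (simp add: numeral_2_eq_2)
  then have "smooth_bigo 2 (row_residual (Inl i))"
    by (rule approx_smooth_bigo[OF approx_row_residual_Inl_2])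
  from approx_fd_residual[OF this] have "approx 3 (\<lambda>h. fd_residual c M s meq h (h / lam) i (u h))
    (\<lambda>h p. (\<Prod>j\<in>UNIV. s $ Inr j) * row_residual (Inl i) h p)" by simp
  moreover have "approx 3 (\<lambda>h p. (\<Prod>j\<in>UNIV. s $ Inr j) * row_residual (Inl i) h p)
    (\<lambda>h p. (\<Prod>j\<in>UNIV. s $ Inr j) * (h * defect (Inl i) h p + h ^ 2 * (- 1 * second_order_term X c M s meq lam i (u h) p)))"
  proof (intro approx_cmult approx_trans[OF approx_row_residual_Inl] approx_add approx_refl)
    show "approx 3 (\<lambda>h p. h ^ 2 * second_coeff (Inl i) h p) (\<lambda>h p. h ^ 2 * (- 1 * second_order_term X c M s meq lam i (u h) p))"
      using approx_power_mult[OF approx_second_coeff[OF assms], of 2 i] by simp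
  qed
  ultimately show ?thesis by (auto dest: approx_trans)
qed

lemma prod_relaxation_nonzero: "(\<Prod>j\<in>UNIV. s $ Inr j) \<noteq> 0"
  using s by simp

section \<open>Truncation error and modified equations\<close>

lemma truncation_error_expansion:
  assumes "\<forall>\<^sub>F h in at_right 0. \<forall>p\<in>X. \<forall>l. dt_op X (\<lambda>p. u h p $ l) p + gamma1 X c M meq lam l (u h) p = 0"
  shows "smooth_bigo 2 (\<lambda>h p. truncation_error c M s meq h (h / lam) i (u h) p
    - lam * h * second_order_term X c M s meq lam i (u h) p)"
proof -
  let ?Pi = "\<Prod>j\<in>UNIV. s $ Inr j"
  have zero: "\<forall>\<^sub>F h in at_right 0. \<forall>p\<in>X. \<forall>l. defect (Inl l) h p = 0"
    using defect_conserved assms by eventually_elim (use lam_pos in auto)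
  then have "smooth_bigo 1 (defect (Inl l))" for l
    by (intro smooth_bigo_cong[OF smooth_bigo_zero]) (auto elim: eventually_mono)
  then have "approx 3 (\<lambda>h. fd_residual c M s meq h (h / lam) i (u h))
    (\<lambda>h p. ?Pi * (h * defect (Inl i) h p - h ^ 2 * second_order_term X c M s meq lam i (u h) p))"
    by (rule approx_fd_residual_second_order)
  then have R: "smooth_bigo 3 (\<lambda>h p. - (lam / ?Pi) * (fd_residual c M s meq h (h / lam) i (u h) p
      - ?Pi * (h * defect (Inl i) h p - h ^ 2 * second_order_term X c M s meq lam i (u h) p)))"
    unfolding approx_def by (rule smooth_bigo_cmult)
  \<comment> \<open>The factor \<open>h\<close> compensates the time step \<open>h / lam\<close> in
    the denominator; it is cancelled at the end, which turns order 3 into order 2.\<close>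
  have "smooth_bigo (1 + 2) (\<lambda>h p. h ^ 1 * (truncation_error c M s meq h (h / lam) i (u h) p
    - lam * h * second_order_term X c M s meq lam i (u h) p))"
  proof (rule smooth_bigo_cong)
    show "smooth_bigo (1 + 2) (\<lambda>h p. - (lam / ?Pi) * (fd_residual c M s meq h (h / lam) i (u h) p
      - ?Pi * (h * defect (Inl i) h p - h ^ 2 * second_order_term X c M s meq lam i (u h) p)))"
      using R by (simp add: numeral_3_eq_3)
    show "\<forall>\<^sub>F h in at_right 0. \<forall>p\<in>X. - (lam / ?Pi) * (fd_residual c M s meq h (h / lam) i (u h) p
      - ?Pi * (h * defect (Inl i) h p - h ^ 2 * second_order_term X c M s meq lam i (u h) p))
      = h ^ 1 * (truncation_error c M s meq h (h / lam) i (u h) p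
        - lam * h * second_order_term X c M s meq lam i (u h) p)"
      using zero eventually_small_right
    proof eventually_elim
      case (elim h)
      then show ?case
        unfolding truncation_error_def using prod_relaxation_nonzero lam_pos
        by (simp add: divide_simps del: prod_zero_iff) (simp add: algebra_simps power2_eq_square)
    qed
  qed
  then show ?thesis by (rule smooth_bigo_power_cancel)
qed

lemma modified_equation:
  assumes "\<forall>\<^sub>F h in at_right 0. \<forall>i. \<forall>p\<in>X. fd_residual c M s meq h (h / lam) i (u h) p = 0"
  shows "smooth_bigo 2 (\<lambda>h p. dt_op X (\<lambda>p. u h p $ i) p + gamma1 X c M meq lam i (u h) p
    - lam * h * second_order_term X c M s meq lam i (u h) p)"
proof -
  let ?Pi = "\<Prod>j\<in>UNIV. s $ Inr j"
  \<comment> \<open>First pass: the residual vanishes, so its expansion modulo \<open>h ^ 2\<close>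
    bounds \<open>h\<close> times the defect.\<close>
  have "smooth_bigo 1 (defect (Inl l))" for l
  proof (rule smooth_bigo_power_cancel[of 1], rule smooth_bigo_cong)
    show "smooth_bigo (1 + 1) (\<lambda>h p. - (1 / ?Pi) * (fd_residual c M s meq h (h / lam) l (u h) p
        - ?Pi * (h * defect (Inl l) h p)))"
      unfolding one_add_one
      by (rule smooth_bigo_cmult[OF approx_fd_residual_first_order[unfolded approx_def]])
    show "\<forall>\<^sub>F h in at_right 0. \<forall>p\<in>X. - (1 / ?Pi) * (fd_residual c M s meq h (h / lam) l (u h) p
        - ?Pi * (h * defect (Inl l) h p)) = h ^ 1 * defect (Inl l) h p"
      using assms by eventually_elim (use prod_relaxation_nonzero in simp)
  qed
  \<comment> \<open>Second pass, with the defects now known to be \<open>O(h)\<close>. The factor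
    removes the product of the relaxation rates, restores \<open>lam\<close> in front of the defect,
    and its sign accounts for the vanishing residual being the minuend.\<close>
  note R = smooth_bigo_cmult[OF approx_fd_residual_second_order[OF this, unfolded approx_def], of "- (lam / ?Pi)"]
  have "smooth_bigo (1 + 2) (\<lambda>h p. h ^ 1 * (dt_op X (\<lambda>p. u h p $ i) p + gamma1 X c M meq lam i (u h) p
    - lam * h * second_order_term X c M s meq lam i (u h) p))"
  proof (rule smooth_bigo_cong)
    show "smooth_bigo (1 + 2) (\<lambda>h p. - (lam / ?Pi) * (fd_residual c M s meq h (h / lam) i (u h) p
      - ?Pi * (h * defect (Inl i) h p - h ^ 2 * second_order_term X c M s meq lam i (u h) p)))"
      using R by (simp add: numeral_3_eq_3)
    show "\<forall>\<^sub>F h in at_right 0. \<forall>p\<in>X. - (lam / ?Pi) * (fd_residual c M s meq h (h / lam) i (u h) p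
      - ?Pi * (h * defect (Inl i) h p - h ^ 2 * second_order_term X c M s meq lam i (u h) p))
      = h ^ 1 * (dt_op X (\<lambda>p. u h p $ i) p + gamma1 X c M meq lam i (u h) p
        - lam * h * second_order_term X c M s meq lam i (u h) p)"
      using assms defect_conserved
    proof eventually_elim
      case (elim h)
      show ?case
      proof
        fix p assume p: "p \<in> X"
        with elim have e: "dt_op X (\<lambda>p. u h p $ i) p + gamma1 X c M meq lam i (u h) p = lam * defect (Inl i) h p"
          by simp
        have R0: "fd_residual c M s meq h (h / lam) i (u h) p = 0"
          using elim p by blast
        show "- (lam / ?Pi) * (fd_residual c M s meq h (h / lam) i (u h) p
          - ?Pi * (h * defect (Inl i) h p - h ^ 2 * second_order_term X c M s meq lam i (u h) p))
          = h ^ 1 * (dt_op X (\<lambda>p. u h p $ i) p + gamma1 X c M meq lam i (u h) p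
            - lam * h * second_order_term X c M s meq lam i (u h) p)"
          unfolding e R0 using prod_relaxation_nonzero
          by (simp add: field_simps power2_eq_square del: prod_zero_iff)
      qed
    qed
  qed
  then show ?thesis by (rule smooth_bigo_power_cancel)
qed

end

theorem theorem4p7:
  fixes c :: "int ^ 'd::finite ^ ('n::finite + 'k::finite)"
    and M :: "real ^ ('n + 'k) ^ ('n + 'k)"
    and s :: "real ^ ('n + 'k)"
    and meq :: "real ^ 'n \<Rightarrow> real ^ ('n + 'k)"
    and lam :: real
    and X :: "(real \<times> (real ^ 'd)) set"
  assumes "CARD('d) \<in> {1, 2, 3}"
    and "invertible M"
    and "\<And>j. 0 < s $ Inr j \<and> s $ Inr j \<le> 2"
    and "smooth_fun_on UNIV meq"
    and "\<And>w i. meq w $ Inl i = w $ i"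
    and "lam > 0"
    and "X = {0..} \<times> UNIV \<or> X = {0<..} \<times> UNIV"
  shows "consistent_with_target X c M s meq lam
    \<and> (\<forall>u i. smooth_fun_on X u \<and> target_pde_solution X c M meq lam u \<longrightarrow>
         locally_uniform_bigo X
           (\<lambda>\<Delta>x p. truncation_error c M s meq \<Delta>x (\<Delta>x / lam) i u p
                     - lam * \<Delta>x * second_order_term X c M s meq lam i u p)
           (\<lambda>\<Delta>x. \<Delta>x ^ 2))
    \<and> (\<forall>u. (\<forall>\<^sub>F \<Delta>x in at_right 0. smooth_fun_on X (u \<Delta>x)) \<and>
           derivatives_locally_bounded X u \<and>
           (\<forall>\<^sub>F \<Delta>x in at_right 0. \<forall>i. \<forall>p\<in>X. fd_residual c M s meq \<Delta>x (\<Delta>x / lam) i (u \<Delta>x) p = 0) \<longrightarrow>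
         (\<forall>i. locally_uniform_bigo X
           (\<lambda>\<Delta>x p. dt_op X (\<lambda>p. u \<Delta>x p $ i) p + gamma1 X c M meq lam i (u \<Delta>x) p
                     - lam * \<Delta>x * second_order_term X c M s meq lam i (u \<Delta>x) p)
           (\<lambda>\<Delta>x. \<Delta>x ^ 2)))"
proof -
  interpret forward_domain X "{v. 0 \<le> fst v}"
    using assms(7) by (rule forward_domain_half_space)
  have family: "lbm_family X lam M s meq u"
    if "\<forall>\<^sub>F \<Delta>x in at_right 0. smooth_fun_on X (u \<Delta>x)" "derivatives_locally_bounded X u" for u
  proof
    show "s $ Inr j \<noteq> 0" for j using assms(3)[of j] by simp
    show "smooth_bigo 0 (\<lambda>h p. u h p $ l)" for l
      using that by (rule smooth_bigo_component)
  qed (use assms in auto)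
  have T: "smooth_bigo 2 (\<lambda>\<Delta>x p. truncation_error c M s meq \<Delta>x (\<Delta>x / lam) i u p
        - lam * \<Delta>x * second_order_term X c M s meq lam i u p)"
      "smooth_bigo 1 (\<lambda>\<Delta>x. truncation_error c M s meq \<Delta>x (\<Delta>x / lam) i u)"
    if sol: "smooth_fun_on X u" "target_pde_solution X c M meq lam u" for u i
  proof -
    interpret lbm_family X lam c M s meq "\<lambda>_. u"
      by (rule family) (use sol derivatives_locally_bounded_const in auto)
    show T: "smooth_bigo 2 (\<lambda>\<Delta>x p. truncation_error c M s meq \<Delta>x (\<Delta>x / lam) i u p
        - lam * \<Delta>x * second_order_term X c M s meq lam i u p)"
      by (rule truncation_error_expansion) (use sol in \<open>simp add: target_pde_solution_def\<close>)
    \<comment> \<open>The leading term of the truncation error is itself \<open>O(h)\<close>, which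
      gives consistency.\<close>
    have "smooth_bigo 1 (\<lambda>\<Delta>x p. lam * (\<Delta>x ^ 1 * second_order_term X c M s meq lam i u p))"
      using smooth_bigo_cmult[OF smooth_bigo_power_mult[OF smooth_bigo_second_order_term, of 1]] by simp
    from smooth_bigo_add[OF smooth_bigo_antimono[OF T, of 1] this]
    show "smooth_bigo 1 (\<lambda>\<Delta>x. truncation_error c M s meq \<Delta>x (\<Delta>x / lam) i u)"
      by (simp add: mult.assoc)
  qed
  have "consistent_with_target X c M s meq lam"
    unfolding consistent_with_target_def
    using smooth_bigo_bound[OF T(2)] by (auto intro!: uniform_limit_if_locally_uniform_bigo)
  moreover have "locally_uniform_bigo X
      (\<lambda>\<Delta>x p. dt_op X (\<lambda>p. u \<Delta>x p $ i) p + gamma1 X c M meq lam i (u \<Delta>x) p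
        - lam * \<Delta>x * second_order_term X c M s meq lam i (u \<Delta>x) p) (\<lambda>\<Delta>x. \<Delta>x ^ 2)"
    if u: "\<forall>\<^sub>F \<Delta>x in at_right 0. smooth_fun_on X (u \<Delta>x)" "derivatives_locally_bounded X u"
      and R: "\<forall>\<^sub>F \<Delta>x in at_right 0. \<forall>i. \<forall>p\<in>X. fd_residual c M s meq \<Delta>x (\<Delta>x / lam) i (u \<Delta>x) p = 0"
    for u i
  proof -
    interpret lbm_family X lam c M s meq u
      using u by (rule family)
    show ?thesis
      using R by (intro smooth_bigo_bound modified_equation)
  qed
  ultimately show ?thesis
    using smooth_bigo_bound[OF T(1)] by blast
qed

end
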